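(* Let $(M,g)$ be a (not necessarily complete) Riemannian manifold of dimension $n$, let $0<m<\infty$, and let $f\in C^\infty(M)$ be such that $\operatorname{Ric}_f^m\geq 0$ on $M$ and $\Delta_f f=\phi(f)$ on $M$, where $\phi\colon\mathbb{R}\to\mathbb{R}$ is a differentiable function such that $$\phi'(t)+\frac{2}{n}\phi(t)\geq 0\quad\text{for all } t\in\mathbb{R}.$$ Then for all $x\in M$ and $a>0$ such that the ball $B(x,a)$ is geodesically connected in $M$ and the closure $\overline{B(x,a)}$ is compact, $$|\nabla f|^2(x)\leq\frac{2n(m+n+6)}{a^2}.$$
   Context: Riemannian manifolds are smooth, connected and without boundary. For $f\in C^\infty(M)$ and $0<m<\infty$, the Bakry-Émery-Ricci tensor is $\operatorname{Ric}_f^m=\operatorname{Ric}+\nabla^2 f-\frac{1}{m}\,df\otimes df$, where $\operatorname{Ric}$ is the Ricci tensor of $g$ and $\nabla^2 f$ is the Hessian of $f$; $\operatorname{Ric}_f^m\ge 0$ means that this symmetric 2-tensor is positive semidefinite at every point. The $f$-Laplacian is $\Delta_f u=\Delta u-\langle\nabla f,\nabla u\rangle$, where $\Delta$ is the trace of the Hessian. $B(x,a)$ is the open metric ball of radius $a$ about $x$ for the Riemannian distance. A subset $U\subset M$ is geodesically connected in $M$ if for all $p,q\in U$ there is a minimal geodesic connecting $p$ to $q$ which lies in $M$. *)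

theory Defs
  imports "HOL-Analysis.Analysis"
begin

section \<open>Smooth functions on open subsets of Euclidean space\<close>

definition partial :: "'n::finite \<Rightarrow> (real^'n \<Rightarrow> real) \<Rightarrow> real^'n \<Rightarrow> real" where
  "partial i F x = frechet_derivative F (at x) (axis i 1)"

fun Ck_on :: "nat \<Rightarrow> (real^'n::finite) set \<Rightarrow> (real^'n \<Rightarrow> real) \<Rightarrow> bool" where
  "Ck_on 0 S F \<longleftrightarrow> continuous_on S F"
| "Ck_on (Suc k) S F \<longleftrightarrow>
     (\<forall>x\<in>S. F differentiable (at x)) \<and> (\<forall>i. Ck_on k S (partial i F))"

text \<open>Only meant for open \<open>S\<close>.\<close>

definition smooth_on :: "(real^'n::finite) set \<Rightarrow> (real^'n \<Rightarrow> real) \<Rightarrow> bool" where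
  "smooth_on S F \<longleftrightarrow> (\<forall>k. Ck_on k S F)"


section \<open>Smooth manifolds\<close>

text \<open>
  The manifold is the whole type \<open>'a\<close> with its type class topology, which is Hausdorff and second
  countable, and its dimension is \<open>CARD('n)\<close>.  A chart is a pair \<open>(U, \<phi>)\<close>, where only the values of
  \<open>\<phi>\<close> on \<open>U\<close> matter.
\<close>

type_synonym ('a, 'n) chart = "'a set \<times> ('a \<Rightarrow> real^'n)"

definition chart_inv :: "('a, 'n::finite) chart \<Rightarrow> real^'n \<Rightarrow> 'a" where
  "chart_inv c = inv_into (fst c) (snd c)"

definition chart_image :: "('a, 'n::finite) chart \<Rightarrow> (real^'n) set" where
  "chart_image c = snd c ` fst c"

definition smooth_atlas ::
  "('a::{t2_space, second_countable_topology}, 'n::finite) chart set \<Rightarrow> bool" where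
  "smooth_atlas A \<longleftrightarrow>
     (\<Union>c\<in>A. fst c) = UNIV \<and>
     (\<forall>c\<in>A. open (fst c) \<and> open (chart_image c) \<and>
        homeomorphism (fst c) (chart_image c) (snd c) (chart_inv c)) \<and>
     (\<forall>c\<in>A. \<forall>d\<in>A. \<forall>i. smooth_on (snd c ` (fst c \<inter> fst d)) (\<lambda>x. snd d (chart_inv c x) $ i))"

definition smooth_fun_on ::
  "('a::topological_space, 'n::finite) chart set \<Rightarrow> 'a set \<Rightarrow> ('a \<Rightarrow> real) \<Rightarrow> bool" where
  "smooth_fun_on A W h \<longleftrightarrow> (\<forall>c\<in>A. smooth_on (snd c ` (fst c \<inter> W)) (h \<circ> chart_inv c))"

definition smooth_near ::
  "('a::topological_space, 'n::finite) chart set \<Rightarrow> 'a \<Rightarrow> ('a \<Rightarrow> real) \<Rightarrow> bool" where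
  "smooth_near A p h \<longleftrightarrow> (\<exists>W. open W \<and> p \<in> W \<and> smooth_fun_on A W h)"


section \<open>Tangent vectors\<close>

type_synonym 'a tangent = "('a \<Rightarrow> real) \<Rightarrow> real"

text \<open>
  Tangent vectors at \<open>p\<close> are derivations at \<open>p\<close> of the functions that are smooth near \<open>p\<close>, extended
  by \<open>0\<close> to all other functions.  They only depend on the germ at \<open>p\<close>: if \<open>h\<close> vanishes on a
  neighbourhood \<open>W\<close> of \<open>p\<close>, then \<open>h = h \<cdot> b\<close> for the indicator \<open>b\<close> of the complement of \<open>W\<close>, and
  the Leibniz rule gives \<open>v h = 0\<close>.
\<close>

definition tangent_space ::
  "('a::topological_space, 'n::finite) chart set \<Rightarrow> 'a \<Rightarrow> 'a tangent set" where
  "tangent_space A p = {v.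
     (\<forall>h. \<not> smooth_near A p h \<longrightarrow> v h = 0) \<and>
     (\<forall>h k a. smooth_near A p h \<longrightarrow> smooth_near A p k \<longrightarrow>
        v (\<lambda>q. a * h q + k q) = a * v h + v k) \<and>
     (\<forall>h k. smooth_near A p h \<longrightarrow> smooth_near A p k \<longrightarrow>
        v (\<lambda>q. h q * k q) = h p * v k + k p * v h)}"

definition coord_vector ::
  "('a::topological_space, 'n::finite) chart set \<Rightarrow> ('a, 'n) chart \<Rightarrow> 'n \<Rightarrow> 'a \<Rightarrow> 'a tangent" where
  "coord_vector A c i p =
     (\<lambda>h. if smooth_near A p h then partial i (h \<circ> chart_inv c) (snd c p) else 0)"

text \<open>The coefficient of a tangent vector with respect to the \<open>i\<close>-th coordinate vector.\<close>

definition component :: "('a, 'n::finite) chart \<Rightarrow> 'a tangent \<Rightarrow> 'n \<Rightarrow> real" where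
  "component c v i = v (\<lambda>q. snd c q $ i)"

definition velocity ::
  "('a::topological_space, 'n::finite) chart set \<Rightarrow> (real \<Rightarrow> 'a) \<Rightarrow> real \<Rightarrow> 'a tangent" where
  "velocity A \<gamma> t = (\<lambda>h. if smooth_near A (\<gamma> t) h then deriv (h \<circ> \<gamma>) t else 0)"


section \<open>Riemannian metrics\<close>

type_synonym 'a metric = "'a \<Rightarrow> 'a tangent \<Rightarrow> 'a tangent \<Rightarrow> real"

definition metric_matrix ::
  "('a::topological_space, 'n::finite) chart set \<Rightarrow> 'a metric \<Rightarrow> ('a, 'n) chart \<Rightarrow>
     real^'n \<Rightarrow> real^'n^'n" where
  "metric_matrix A g c x = (let p = chart_inv c x in
     \<chi> i j. g p (coord_vector A c i p) (coord_vector A c j p))"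

definition riemannian_metric ::
  "('a::topological_space, 'n::finite) chart set \<Rightarrow> 'a metric \<Rightarrow> bool" where
  "riemannian_metric A g \<longleftrightarrow>
     (\<forall>p. \<forall>u\<in>tangent_space A p. \<forall>v\<in>tangent_space A p. \<forall>w\<in>tangent_space A p. \<forall>a.
        g p u v = g p v u \<and>
        g p (\<lambda>h. a * u h + v h) w = a * g p u w + g p v w) \<and>
     (\<forall>p. \<forall>v\<in>tangent_space A p. v \<noteq> (\<lambda>h. 0) \<longrightarrow> g p v v > 0) \<and>
     (\<forall>c\<in>A. \<forall>i j. smooth_on (chart_image c) (\<lambda>x. metric_matrix A g c x $ i $ j))"

definition riemannian_manifold ::
  "('a::{t2_space, second_countable_topology}, 'n::finite) chart set \<Rightarrow> 'a metric \<Rightarrow> bool" where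
  "riemannian_manifold A g \<longleftrightarrow>
     connected (UNIV :: 'a set) \<and> smooth_atlas A \<and> riemannian_metric A g"

definition gradient ::
  "('a::topological_space, 'n::finite) chart set \<Rightarrow> 'a metric \<Rightarrow> ('a \<Rightarrow> real) \<Rightarrow> 'a \<Rightarrow> 'a tangent"
  where
  "gradient A g u p =
     (THE v. v \<in> tangent_space A p \<and> (\<forall>w\<in>tangent_space A p. g p v w = w u))"


section \<open>Curvature and Hessian in local coordinates\<close>

text \<open>Here \<open>G\<close> is the matrix of the metric as a function of the coordinates.\<close>

text \<open>\<open>christoffel G k i j\<close> is \<open>\<Gamma>\<^sup>k\<^sub>i\<^sub>j\<close>.\<close>

definition christoffel ::
  "(real^'n::finite \<Rightarrow> real^'n^'n) \<Rightarrow> 'n \<Rightarrow> 'n \<Rightarrow> 'n \<Rightarrow> real^'n \<Rightarrow> real" where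
  "christoffel G k i j x =
     1/2 * (\<Sum>l\<in>UNIV. matrix_inv (G x) $ k $ l *
       (partial i (\<lambda>y. G y $ j $ l) x + partial j (\<lambda>y. G y $ i $ l) x
        - partial l (\<lambda>y. G y $ i $ j) x))"

text \<open>\<open>R(\<partial>\<^sub>i, \<partial>\<^sub>j)\<partial>\<^sub>k = \<Sum>\<^sub>l curvature G l k i j \<cdot> \<partial>\<^sub>l\<close> with
  \<open>R(X,Y)Z = \<nabla>\<^sub>X\<nabla>\<^sub>Y Z - \<nabla>\<^sub>Y\<nabla>\<^sub>X Z - \<nabla>\<^bsub>[X,Y]\<^esub> Z\<close>, and \<open>Ric(Y,Z)\<close> is the trace of
  \<open>X \<mapsto> R(X,Y)Z\<close>, so that round spheres have positive Ricci curvature.\<close>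

definition curvature ::
  "(real^'n::finite \<Rightarrow> real^'n^'n) \<Rightarrow> 'n \<Rightarrow> 'n \<Rightarrow> 'n \<Rightarrow> 'n \<Rightarrow> real^'n \<Rightarrow> real" where
  "curvature G l k i j x =
     partial i (christoffel G l j k) x - partial j (christoffel G l i k) x
     + (\<Sum>s\<in>UNIV. christoffel G l i s x * christoffel G s j k x
                 - christoffel G l j s x * christoffel G s i k x)"

definition ricci ::
  "(real^'n::finite \<Rightarrow> real^'n^'n) \<Rightarrow> 'n \<Rightarrow> 'n \<Rightarrow> real^'n \<Rightarrow> real" where
  "ricci G j k x = (\<Sum>i\<in>UNIV. curvature G i k i j x)"

definition hessian ::
  "(real^'n::finite \<Rightarrow> real^'n^'n) \<Rightarrow> (real^'n \<Rightarrow> real) \<Rightarrow> 'n \<Rightarrow> 'n \<Rightarrow> real^'n \<Rightarrow> real" where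
  "hessian G F i j x =
     partial i (partial j F) x - (\<Sum>k\<in>UNIV. christoffel G k i j x * partial k F x)"


section \<open>Bakry-Emery-Ricci tensor and weighted Laplacian\<close>

text \<open>
  The following three are computed in a chart \<open>c\<close> around \<open>p\<close>.  The values do not depend on the chart;
  conditions on them are imposed in every chart of the atlas.
\<close>

definition bakry_emery_ricci ::
  "('a::topological_space, 'n::finite) chart set \<Rightarrow> 'a metric \<Rightarrow> ('a \<Rightarrow> real) \<Rightarrow> real \<Rightarrow>
     ('a, 'n) chart \<Rightarrow> 'a \<Rightarrow> 'a tangent \<Rightarrow> 'a tangent \<Rightarrow> real" where
  "bakry_emery_ricci A g f m c p v w =
     (let G = metric_matrix A g c; F = f \<circ> chart_inv c; x = snd c p in
      \<Sum>i\<in>UNIV. \<Sum>j\<in>UNIV.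
        (ricci G i j x + hessian G F i j x - 1/m * (partial i F x * partial j F x))
        * component c v i * component c w j)"

definition laplacian ::
  "('a::topological_space, 'n::finite) chart set \<Rightarrow> 'a metric \<Rightarrow> ('a, 'n) chart \<Rightarrow>
     ('a \<Rightarrow> real) \<Rightarrow> 'a \<Rightarrow> real" where
  "laplacian A g c u p =
     (let G = metric_matrix A g c; x = snd c p in
      \<Sum>i\<in>UNIV. \<Sum>j\<in>UNIV. matrix_inv (G x) $ i $ j * hessian G (u \<circ> chart_inv c) i j x)"

definition f_laplacian ::
  "('a::topological_space, 'n::finite) chart set \<Rightarrow> 'a metric \<Rightarrow> ('a \<Rightarrow> real) \<Rightarrow> ('a, 'n) chart \<Rightarrow>
     ('a \<Rightarrow> real) \<Rightarrow> 'a \<Rightarrow> real" where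
  "f_laplacian A g f c u p =
     laplacian A g c u p - g p (gradient A g f p) (gradient A g u p)"

definition bakry_emery_ricci_nonneg ::
  "('a::topological_space, 'n::finite) chart set \<Rightarrow> 'a metric \<Rightarrow> ('a \<Rightarrow> real) \<Rightarrow> real \<Rightarrow> bool" where
  "bakry_emery_ricci_nonneg A g f m \<longleftrightarrow>
     (\<forall>c\<in>A. \<forall>p\<in>fst c. \<forall>v\<in>tangent_space A p. bakry_emery_ricci A g f m c p v v \<ge> 0)"


section \<open>Riemannian distance and minimal geodesics\<close>

definition C1_curve_on ::
  "('a::topological_space, 'n::finite) chart set \<Rightarrow> real \<Rightarrow> real \<Rightarrow> (real \<Rightarrow> 'a) \<Rightarrow> bool" where
  "C1_curve_on A a b \<gamma> \<longleftrightarrow> continuous_on {a..b} \<gamma> \<and>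
     (\<forall>c\<in>A. (\<forall>t\<in>{t\<in>{a..b}. \<gamma> t \<in> fst c}. (snd c \<circ> \<gamma>) differentiable (at t within {a..b})) \<and>
        continuous_on {t\<in>{a..b}. \<gamma> t \<in> fst c}
          (\<lambda>t. vector_derivative (snd c \<circ> \<gamma>) (at t within {a..b})))"

text \<open>
  Piecewise continuously differentiable curves on \<open>[0,1]\<close>, with one-sided derivatives at the finitely
  many break points \<open>S\<close>, so that the speed is bounded and piecewise continuous.
\<close>

definition piecewise_C1_curve ::
  "('a::topological_space, 'n::finite) chart set \<Rightarrow> (real \<Rightarrow> 'a) \<Rightarrow> bool" where
  "piecewise_C1_curve A \<gamma> \<longleftrightarrow> continuous_on {0..1} \<gamma> \<and>
     (\<exists>S. finite S \<and>
        (\<forall>a b. 0 \<le> a \<and> a < b \<and> b \<le> 1 \<and> {a<..<b} \<inter> S = {} \<longrightarrow> C1_curve_on A a b \<gamma>))"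

definition curve_length ::
  "('a::topological_space, 'n::finite) chart set \<Rightarrow> 'a metric \<Rightarrow> (real \<Rightarrow> 'a) \<Rightarrow> real" where
  "curve_length A g \<gamma> =
     integral {0..1} (\<lambda>t. sqrt (g (\<gamma> t) (velocity A \<gamma> t) (velocity A \<gamma> t)))"

definition riemannian_dist ::
  "('a::topological_space, 'n::finite) chart set \<Rightarrow> 'a metric \<Rightarrow> 'a \<Rightarrow> 'a \<Rightarrow> real" where
  "riemannian_dist A g p q =
     Inf {curve_length A g \<gamma> |\<gamma>. piecewise_C1_curve A \<gamma> \<and> \<gamma> 0 = p \<and> \<gamma> 1 = q}"

definition metric_ball ::
  "('a::topological_space, 'n::finite) chart set \<Rightarrow> 'a metric \<Rightarrow> 'a \<Rightarrow> real \<Rightarrow> 'a set" where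
  "metric_ball A g x a = {y. riemannian_dist A g x y < a}"

text \<open>Solutions of the geodesic equation on \<open>[0,1]\<close>, with one-sided derivatives at the end points.\<close>

definition geodesic ::
  "('a::topological_space, 'n::finite) chart set \<Rightarrow> 'a metric \<Rightarrow> (real \<Rightarrow> 'a) \<Rightarrow> bool" where
  "geodesic A g \<gamma> \<longleftrightarrow> continuous_on {0..1} \<gamma> \<and>
     (\<forall>c\<in>A. \<forall>t\<in>{0..1}. \<gamma> t \<in> fst c \<longrightarrow>
        (let G = metric_matrix A g c; x = snd c \<circ> \<gamma>;
             x' = (\<lambda>s. vector_derivative x (at s within {0..1})) in
         x differentiable (at t within {0..1}) \<and>
         (x' has_vector_derivative
            (\<chi> k. - (\<Sum>i\<in>UNIV. \<Sum>j\<in>UNIV. christoffel G k i j (x t) * x' t $ i * x' t $ j)))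
           (at t within {0..1})))"

definition minimal_geodesic ::
  "('a::topological_space, 'n::finite) chart set \<Rightarrow> 'a metric \<Rightarrow> 'a \<Rightarrow> 'a \<Rightarrow> (real \<Rightarrow> 'a) \<Rightarrow> bool"
  where
  "minimal_geodesic A g p q \<gamma> \<longleftrightarrow>
     geodesic A g \<gamma> \<and> \<gamma> 0 = p \<and> \<gamma> 1 = q \<and> curve_length A g \<gamma> = riemannian_dist A g p q"

text \<open>The geodesic is only required to stay in the manifold, not in \<open>U\<close>.\<close>

definition geodesically_connected ::
  "('a::topological_space, 'n::finite) chart set \<Rightarrow> 'a metric \<Rightarrow> 'a set \<Rightarrow> bool" where
  "geodesically_connected A g U \<longleftrightarrow> (\<forall>p\<in>U. \<forall>q\<in>U. \<exists>\<gamma>. minimal_geodesic A g p q \<gamma>)"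

end

theory Submission
  imports Defs
begin

text \<open>
  Let \<open>u = |\<nabla>f|\<^sup>2\<close>.  The Bochner formula, \<open>Ric\<^sub>f\<^sup>m \<ge> 0\<close> and the hypothesis on \<open>\<phi>\<close> give
  \<open>\<Delta>\<^sub>f u \<ge> 2 u\<^sup>2 / n\<close>, and the maximum principle is applied to \<open>(a\<^sup>2 - d(x,\<cdot>)\<^sup>2)\<^sup>2 u\<close> on the ball.
  At a maximum point \<open>y\<close> the distance, which need not be smooth there, is replaced by an upper
  barrier: the square root of the energy of a variation of a minimal geodesic \<open>\<gamma>\<close> from \<open>x\<close> to \<open>y\<close>
  along \<open>t E\<^sub>i(t)\<close>, where \<open>E\<^sub>i\<close> is a parallel orthonormal frame.  By the second variation formula
  the second derivatives of the energies in the directions \<open>E\<^sub>i\<close> add up to at most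
  \<open>2 (n + m + (f \<circ> \<gamma>)'(1))\<close>, which is the comparison theorem for \<open>\<Delta>\<^sub>f d\<^sup>2\<close>.  Everything is
  computed in charts; a geodesic is covered by finitely many of them, so the variation is built
  piece by piece, and the only tensorial fact needed to pass from one chart to the next is the
  transformation law of the Christoffel symbols.
\<close>

section \<open>Calculus of \<open>C\<^sup>k\<close> functions\<close>

text \<open>As completeness is not assumed, the only geodesics at hand are the minimal ones supplied
  by geodesic connectedness. Energies are varied instead of lengths because they stay differentiable
  when y = x and the geodesic is constant. The exponent 2 on a^2 - d^2 matches the quadratic term of
  the Bochner inequality: with h = a^2 - d^2 at the maximum, the first-order condition turns the
  second-order one into 2 h^2 u^2 / n <= u (4 h (n + m) + 24 d^2). The drift terms (f o
  \<gamma>)'(1), over which there is no control, have cancelled here: one comes from the comparison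
  inequality, the other from the derivative of u along the gradient of f. Since h and d^2 are at
  most a^2, the maximum of h^2 u is at most 2 n (n + m + 6) a^2, and at x the product is a^4 u(x).
  The summand m in n + m comes from completing a square in the Ricci bound; the 24 comes from the
  squared first derivatives of the energies, which add up to 4 d^2 over the frame.\<close>

lemma isCont_eventually_in:
  assumes "isCont h x" "open S" "h x \<in> S" shows "eventually (\<lambda>y. h y \<in> S) (nhds x)"
  using assms unfolding isCont_def tendsto_at_iff_tendsto_nhds by (rule topological_tendstoD)

lemma partial_eqI: "(F has_derivative D) (at x) \<Longrightarrow> partial i F x = D (axis i 1)"
  unfolding partial_def by (metis frechet_derivative_at)

lemma has_derivative_partial:
  assumes "F differentiable (at x)"
  shows "(F has_derivative (\<lambda>v. \<Sum>i\<in>UNIV. v $ i * partial i F x)) (at x)"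
proof -
  let ?D = "frechet_derivative F (at x)"
  have D: "(F has_derivative ?D) (at x)"
    using assms frechet_derivative_works by blast
  then have lin: "linear ?D"
    by (simp add: has_derivative_bounded_linear bounded_linear.linear)
  have "?D v = (\<Sum>i\<in>UNIV. v $ i * partial i F x)" for v
  proof -
    have "?D v = ?D (\<Sum>i\<in>UNIV. v $ i *\<^sub>R axis i 1)"
      by (metis (no_types) basis_expansion scalar_mult_eq_scaleR)
    also have "\<dots> = (\<Sum>i\<in>UNIV. v $ i * partial i F x)"
      by (simp add: linear_sum[OF lin] linear_scale[OF lin] partial_def)
    finally show ?thesis .
  qed
  then show ?thesis using D by (metis (no_types, lifting) ext)
qed

lemma partial_cong:
  assumes "open S" "x \<in> S" "\<And>y. y \<in> S \<Longrightarrow> F y = F' y"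
  shows "partial i F x = partial i F' x"
proof -
  have "(F has_derivative D) (at x) \<longleftrightarrow> (F' has_derivative D) (at x)" for D
    using has_derivative_transform_within_open[of F D x UNIV S F']
      has_derivative_transform_within_open[of F' D x UNIV S F] assms by auto
  then show ?thesis unfolding partial_def frechet_derivative_def by simp
qed

lemma differentiable_cong_open:
  assumes "open S" "x \<in> S" "\<And>y. y \<in> S \<Longrightarrow> F y = F' y"
  shows "F differentiable (at x) \<longleftrightarrow> F' differentiable (at x)"
  using has_derivative_transform_within_open[of F _ x UNIV S F']
      has_derivative_transform_within_open[of F' _ x UNIV S F] assms
  unfolding differentiable_def by auto

text \<open>The rules for partial derivatives of sums, products and compositions hold only at points
  of \<open>S\<close>, so the inductions on \<open>k\<close> below have to exchange a partial
  derivative for a function that agrees with it on \<open>S\<close>.\<close>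

lemma Ck_on_cong:
  assumes "open S" "\<And>y. y \<in> S \<Longrightarrow> F y = F' y"
  shows "Ck_on k S F \<longleftrightarrow> Ck_on k S F'"
  using assms(2)
proof (induction k arbitrary: F F')
  case 0
  then show ?case by (simp cong: continuous_on_cong)
next
  case (Suc k)
  have "Ck_on k S (partial i F) \<longleftrightarrow> Ck_on k S (partial i F')" for i
    by (rule Suc.IH) (use partial_cong[OF assms(1)] Suc.prems in blast)
  moreover have "F differentiable (at x) \<longleftrightarrow> F' differentiable (at x)" if "x \<in> S" for x
    using differentiable_cong_open[OF assms(1) that] Suc.prems by blast
  ultimately show ?case by simp
qed

lemma smooth_on_cong:
  "open S \<Longrightarrow> (\<And>y. y \<in> S \<Longrightarrow> F y = F' y) \<Longrightarrow> smooth_on S F \<longleftrightarrow> smooth_on S F'"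
  unfolding smooth_on_def using Ck_on_cong by blast

lemma Ck_on_Suc_imp:
  assumes "Ck_on (Suc k) S F" shows "Ck_on k S F"
  using assms
proof (induction k arbitrary: F)
  case 0
  then show ?case
    by (metis Ck_on.simps(1,2) continuous_at_imp_continuous_on differentiable_imp_continuous_within)
next
  case (Suc k)
  then show ?case by (metis Ck_on.simps(2))
qed

lemma Ck_on_continuous: "Ck_on k S F \<Longrightarrow> continuous_on S F"
  by (induction k) (use Ck_on_Suc_imp in \<open>force simp del: Ck_on.simps(2)\<close>)+

lemma Ck_on_subset: "Ck_on k S F \<Longrightarrow> T \<subseteq> S \<Longrightarrow> Ck_on k T F"
  by (induction k arbitrary: F) (auto intro: continuous_on_subset)

lemma smooth_on_subset: "smooth_on S F \<Longrightarrow> T \<subseteq> S \<Longrightarrow> smooth_on T F"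
  unfolding smooth_on_def using Ck_on_subset by blast

lemma smooth_onD:
  assumes "smooth_on S F"
  shows smooth_on_partial: "smooth_on S (partial i F)"
    and smooth_on_differentiable: "x \<in> S \<Longrightarrow> F differentiable (at x)"
    and smooth_on_continuous: "continuous_on S F"
  using assms unfolding smooth_on_def by (metis Ck_on.simps)+

lemma Ck_on_const:
  fixes S :: "(real^'n::finite) set"
  shows "Ck_on k S (\<lambda>x. c)"
proof (induction k arbitrary: c)
  case (Suc k)
  have "partial i (\<lambda>x::real^'n. c) = (\<lambda>x. 0)" for i
    by (rule ext, subst partial_eqI[where D="\<lambda>v. 0"]) auto
  then show ?case using Suc by simp
qed simp

lemma partial_add:
  assumes "F differentiable (at x)" "H differentiable (at x)"
  shows "partial i (\<lambda>x. F x + H x) x = partial i F x + partial i H x"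
  by (subst partial_eqI[OF has_derivative_add[OF has_derivative_partial[OF assms(1)] has_derivative_partial[OF assms(2)]]])
    (simp add: axis_def if_distrib[of "\<lambda>a. a * _"] cong: if_cong)

lemma partial_mult:
  assumes "F differentiable (at x)" "H differentiable (at x)"
  shows "partial i (\<lambda>x. F x * H x) x = F x * partial i H x + partial i F x * H x"
  by (subst partial_eqI[OF has_derivative_mult[OF has_derivative_partial[OF assms(1)] has_derivative_partial[OF assms(2)]]])
    (simp add: axis_def if_distrib[of "\<lambda>a. a * _"] cong: if_cong)

lemma partial_inverse:
  assumes "F differentiable (at x)" "F x \<noteq> 0"
  shows "partial i (\<lambda>x. inverse (F x)) x = - 1 * (partial i F x * (inverse (F x) * inverse (F x)))"
  by (subst partial_eqI[OF Deriv.has_derivative_inverse[OF assms(2) has_derivative_partial[OF assms(1)]]])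
    (simp add: axis_def if_distrib[of "\<lambda>a. a * _"] cong: if_cong)

lemma Ck_on_add:
  assumes "open S" "Ck_on k S F" "Ck_on k S H"
  shows "Ck_on k S (\<lambda>x. F x + H x)"
  using assms(2,3)
proof (induction k arbitrary: F H)
  case 0 then show ?case by (auto intro: continuous_intros)
next
  case (Suc k)
  have "Ck_on k S (partial i (\<lambda>x. F x + H x))" for i
    by (rule iffD1[OF Ck_on_cong[OF assms(1)] Suc.IH[of "partial i F" "partial i H"]])
      (use Suc.prems in \<open>auto simp: partial_add\<close>)
  with Suc.prems show ?case by auto
qed

lemma Ck_on_mult:
  assumes "open S" "Ck_on k S F" "Ck_on k S H"
  shows "Ck_on k S (\<lambda>x. F x * H x)"
  using assms(2,3)
proof (induction k arbitrary: F H)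
  case 0 then show ?case by (auto intro: continuous_intros)
next
  case (Suc k)
  have "Ck_on k S (partial i (\<lambda>x. F x * H x))" for i
  proof (rule iffD1[OF Ck_on_cong[OF assms(1)] Ck_on_add[OF assms(1)]])
    show "Ck_on k S (\<lambda>x. F x * partial i H x)" "Ck_on k S (\<lambda>x. partial i F x * H x)"
      using Suc.IH Suc.prems Ck_on_Suc_imp by (metis Ck_on.simps(2))+
  qed (use Suc.prems in \<open>auto simp: partial_mult\<close>)
  with Suc.prems show ?case by auto
qed

text \<open>The derivative of the inverse contains the inverse again, but only with one order of
  differentiability less, so the induction closes.\<close>

lemma Ck_on_inverse:
  assumes "open S" "Ck_on k S F" "\<And>x. x \<in> S \<Longrightarrow> F x \<noteq> 0"
  shows "Ck_on k S (\<lambda>x. inverse (F x))"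
  using assms(2)
proof (induction k)
  case 0 then show ?case using assms(3) by (auto intro!: continuous_intros)
next
  case (Suc k)
  then have inv: "Ck_on k S (\<lambda>x. inverse (F x))" using Ck_on_Suc_imp by blast
  have "Ck_on k S (partial i (\<lambda>x. inverse (F x)))" for i
    by (rule iffD1[OF Ck_on_cong[OF assms(1)] Ck_on_mult[OF assms(1) Ck_on_const[where c="-1"]
      Ck_on_mult[OF assms(1) _ Ck_on_mult[OF assms(1) inv inv], of "partial i F"]]])
      (use Suc.prems assms(3) in \<open>auto simp: partial_inverse\<close>)
  moreover have "(\<lambda>x. inverse (F x)) differentiable (at x)" if "x \<in> S" for x
    using Suc.prems assms(3)[OF that] that by (simp add: differentiable_inverse)
  ultimately show ?case by auto
qed

lemma Ck_on_sum:
  assumes "open S" "finite I" "\<And>i. i \<in> I \<Longrightarrow> Ck_on k S (F i)"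
  shows "Ck_on k S (\<lambda>x. \<Sum>i\<in>I. F i x)"
  using assms(2,3) by (induction I rule: finite_induct) (auto intro: Ck_on_const Ck_on_add[OF assms(1)])

lemma Ck_on_prod:
  assumes "open S" "finite I" "\<And>i. i \<in> I \<Longrightarrow> Ck_on k S (F i)"
  shows "Ck_on k S (\<lambda>x. \<Prod>i\<in>I. F i x)"
  using assms(2,3) by (induction I rule: finite_induct) (auto intro: Ck_on_const Ck_on_mult[OF assms(1)])

lemma has_derivative_nth: "((\<lambda>x. x $ j) has_derivative (\<lambda>v. v $ j)) (at x within S)"
  by (rule bounded_linear_imp_has_derivative) (rule bounded_linear_vec_nth)

lemma partial_nth: "partial i (\<lambda>x. x $ j) x = (if i = j then 1 else 0)"
  by (subst partial_eqI[OF has_derivative_nth]) (auto simp: axis_def)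

lemma Ck_on_nth:
  fixes S :: "(real^'n::finite) set"
  shows "Ck_on k S (\<lambda>x. x $ j)"
proof (cases k)
  case (Suc k')
  have "partial i (\<lambda>x::real^'n. x $ j) = (\<lambda>x. if i = j then 1 else 0)" for i
    by (rule ext) (rule partial_nth)
  then show ?thesis using Suc has_derivative_nth[of j _ UNIV] by (auto simp: Ck_on_const differentiable_def)
qed (auto intro: continuous_intros)

lemma has_derivative_vec_iff:
  fixes f :: "'a::real_normed_vector \<Rightarrow> real^'k::finite"
  shows "(f has_derivative D) (at a within S) \<longleftrightarrow>
    (\<forall>j. ((\<lambda>x. f x $ j) has_derivative (\<lambda>v. D v $ j)) (at a within S))"
  by (subst has_derivative_componentwise_within)
    (auto simp: Basis_vec_def inner_axis)

lemma has_vector_derivative_vec_iff: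
  fixes f :: "real \<Rightarrow> real^'k::finite"
  shows "(f has_vector_derivative D) (at a within S) \<longleftrightarrow>
    (\<forall>j. ((\<lambda>x. f x $ j) has_real_derivative D $ j) (at a within S))"
proof -
  have "(\<lambda>v. v * D $ j) = (*) (D $ j)" for j by (rule ext) (rule mult.commute)
  then show ?thesis
    by (simp add: has_vector_derivative_def has_derivative_vec_iff has_field_derivative_def)
qed

lemma has_derivative_vec_partial:
  fixes T :: "real^'n::finite \<Rightarrow> real^'k::finite"
  assumes "\<And>j. (\<lambda>x. T x $ j) differentiable (at x)"
  shows "(T has_derivative (\<lambda>v. \<chi> j. \<Sum>i\<in>UNIV. v $ i * partial i (\<lambda>x. T x $ j) x)) (at x)"
proof -
  have "((\<lambda>x. \<chi> j. T x $ j) has_derivative (\<lambda>v. \<chi> j. \<Sum>i\<in>UNIV. v $ i * partial i (\<lambda>x. T x $ j) x)) (at x)"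
    by (simp add: has_derivative_vec_iff has_derivative_partial[OF assms])
  then show ?thesis by simp
qed

lemma partial_compose:
  fixes T :: "real^'n::finite \<Rightarrow> real^'k::finite"
  assumes "\<And>j. (\<lambda>x. T x $ j) differentiable (at x)" "F differentiable (at (T x))"
  shows "partial i (\<lambda>x. F (T x)) x = (\<Sum>j\<in>UNIV. partial j F (T x) * partial i (\<lambda>x. T x $ j) x)"
  by (subst partial_eqI[OF has_derivative_compose[OF has_derivative_vec_partial[OF assms(1)]
      has_derivative_partial[OF assms(2)]]])
   (simp add: axis_def if_distrib[of "\<lambda>a. a * _"] mult.commute cong: if_cong)

lemma Ck_on_compose:
  fixes T :: "real^'n::finite \<Rightarrow> real^'k::finite"
  assumes "open S" "Ck_on k S' F" "\<And>j. Ck_on k S (\<lambda>x. T x $ j)" "T ` S \<subseteq> S'"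
  shows "Ck_on k S (\<lambda>x. F (T x))"
  using assms(2,3)
proof (induction k arbitrary: F)
  case 0
  have "continuous_on S (\<lambda>x. \<chi> j. T x $ j)" using 0 by (intro continuous_on_vec_lambda) simp
  then show ?case using 0 assms(4)
    by (auto intro: continuous_on_compose2[of S' F S T])
next
  case (Suc k)
  have d: "(\<lambda>x. T x $ j) differentiable (at x)" if "x \<in> S" for x j using Suc.prems that by auto
  have dF: "F differentiable (at (T x))" if "x \<in> S" for x using Suc.prems that assms(4) by auto
  have T: "Ck_on k S (\<lambda>x. T x $ j)" for j by (rule Ck_on_Suc_imp) (rule Suc.prems(2))
  have "Ck_on k S (partial i (\<lambda>x. F (T x)))" for i
  proof (rule iffD1[OF Ck_on_cong[OF assms(1)]])
    show "Ck_on k S (\<lambda>x. \<Sum>j\<in>UNIV. partial j F (T x) * partial i (\<lambda>x. T x $ j) x)"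
    proof (rule Ck_on_sum[OF assms(1) finite_class.finite_UNIV], rule Ck_on_mult[OF assms(1)])
      show "Ck_on k S (\<lambda>x. partial j F (T x))" for j
        by (rule Suc.IH[OF _ T]) (use Suc.prems in auto)
      show "Ck_on k S (partial i (\<lambda>x. T x $ j))" for j
        using Suc.prems by auto
    qed
  qed (simp add: partial_compose d dF)
  moreover have "(\<lambda>x. F (T x)) differentiable (at x)" if "x \<in> S" for x
    using has_derivative_compose[OF has_derivative_vec_partial[OF d[OF that]]
      has_derivative_partial[OF dF[OF that]]] by (auto simp: differentiable_def)
  ultimately show ?case by auto
qed

lemma smooth_on_intros:
  assumes "open S"
  shows "smooth_on S (\<lambda>x. c)"
    "smooth_on S (\<lambda>x. x $ j)"
    "smooth_on S F \<Longrightarrow> smooth_on S H \<Longrightarrow> smooth_on S (\<lambda>x. F x + H x)"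
    "smooth_on S F \<Longrightarrow> smooth_on S H \<Longrightarrow> smooth_on S (\<lambda>x. F x * H x)"
    "smooth_on S F \<Longrightarrow> smooth_on S H \<Longrightarrow> smooth_on S (\<lambda>x. F x - H x)"
    "smooth_on S F \<Longrightarrow> (\<And>x. x \<in> S \<Longrightarrow> F x \<noteq> 0) \<Longrightarrow> smooth_on S (\<lambda>x. inverse (F x))"
    "finite I \<Longrightarrow> (\<And>i. i \<in> I \<Longrightarrow> smooth_on S (K i)) \<Longrightarrow> smooth_on S (\<lambda>x. \<Sum>i\<in>I. K i x)"
    "finite I \<Longrightarrow> (\<And>i. i \<in> I \<Longrightarrow> smooth_on S (K i)) \<Longrightarrow> smooth_on S (\<lambda>x. \<Prod>i\<in>I. K i x)"
proof -
  show "smooth_on S F \<Longrightarrow> smooth_on S H \<Longrightarrow> smooth_on S (\<lambda>x. F x - H x)"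
    using Ck_on_add[OF assms, of _ F "\<lambda>x. -1 * H x"] Ck_on_mult[OF assms Ck_on_const[where c="-1"]]
    unfolding smooth_on_def by simp
qed (auto simp: smooth_on_def Ck_on_const Ck_on_nth Ck_on_add[OF assms] Ck_on_mult[OF assms]
      Ck_on_inverse[OF assms] Ck_on_sum[OF assms] Ck_on_prod[OF assms])

lemma smooth_on_compose:
  fixes T :: "real^'n::finite \<Rightarrow> real^'k::finite"
  assumes "open S" "smooth_on S' F" "\<And>j. smooth_on S (\<lambda>x. T x $ j)" "T ` S \<subseteq> S'"
  shows "smooth_on S (\<lambda>x. F (T x))"
  using assms(2,3) unfolding smooth_on_def by (auto intro: Ck_on_compose[OF assms(1) _ _ assms(4)])

lemma smooth_on_det:
  fixes M :: "real^'n::finite \<Rightarrow> real^'k^'k::finite"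
  assumes "open S" "\<And>i j. smooth_on S (\<lambda>x. M x $ i $ j)"
  shows "smooth_on S (\<lambda>x. det (M x))"
  unfolding det_def
  by (intro smooth_on_intros[OF assms(1)] assms(2)) (auto simp: finite_permutations)

lemma matrix_inv_works:
  assumes "invertible M"
  shows "M ** matrix_inv M = mat 1" "matrix_inv M ** M = mat 1"
  using assms someI_ex[of "\<lambda>N. M ** N = mat 1 \<and> N ** M = mat 1"]
  unfolding invertible_def matrix_inv_def by auto

text \<open>By Cramer's rule the entries of the inverse are quotients of determinants, which are
  polynomials in matrix entries.\<close>

lemma smooth_on_matrix_inv:
  fixes M :: "real^'n::finite \<Rightarrow> real^'k^'k::finite"
  assumes "open S" "\<And>i j. smooth_on S (\<lambda>x. M x $ i $ j)" "\<And>x. x \<in> S \<Longrightarrow> invertible (M x)"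
  shows "smooth_on S (\<lambda>x. matrix_inv (M x) $ k $ l)"
proof (rule iffD2[OF smooth_on_cong[OF assms(1)]])
  let ?N = "\<lambda>x. \<chi> i j. if j = k then axis l 1 $ i else M x $ i $ j"
  show "matrix_inv (M x) $ k $ l = det (?N x) * inverse (det (M x))" if "x \<in> S" for x
  proof -
    have inv: "M x ** matrix_inv (M x) = mat 1"
      using assms(3)[OF that] by (rule matrix_inv_works)
    have "M x *v (matrix_inv (M x) *v axis l 1) = axis l 1"
      by (simp add: matrix_vector_mul_assoc inv)
    then have "matrix_inv (M x) *v axis l 1 = (\<chi> k. det (\<chi> i j. if j = k then axis l 1 $ i else M x $ i $ j) / det (M x))"
      using cramer[of "M x"] assms(3)[OF that] invertible_det_nz by blast
    then have "(matrix_inv (M x) *v axis l 1) $ k = det (?N x) / det (M x)"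
      by simp
    moreover have "(matrix_inv (M x) *v axis l 1) $ k = matrix_inv (M x) $ k $ l"
      by (simp add: matrix_vector_mult_def axis_def if_distrib[of "\<lambda>a. _ * a"] cong: if_cong)
    ultimately show ?thesis by (simp add: divide_inverse)
  qed
  show "smooth_on S (\<lambda>x. det (?N x) * inverse (det (M x)))"
  proof (intro smooth_on_intros[OF assms(1)] smooth_on_det[OF assms(1)] assms(2))
    show "smooth_on S (\<lambda>x. ?N x $ i $ j)" for i j
      by (cases "j = k") (auto simp: smooth_on_intros(1)[OF assms(1)] assms(2))
    show "det (M x) \<noteq> 0" if "x \<in> S" for x
      using assms(3)[OF that] invertible_det_nz by blast
  qed
qed

lemma has_real_derivative_along:
  assumes "F differentiable (at (c t))" "(c has_vector_derivative c') (at t within S)"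
  shows "((\<lambda>t. F (c t)) has_real_derivative (\<Sum>i\<in>UNIV. c' $ i * partial i F (c t))) (at t within S)"
proof -
  have "((\<lambda>t. F (c t)) has_derivative (\<lambda>h. \<Sum>i\<in>UNIV. (h *\<^sub>R c') $ i * partial i F (c t))) (at t within S)"
    using has_derivative_compose[OF assms(2)[unfolded has_vector_derivative_def] has_derivative_partial[OF assms(1)]] .
  then show ?thesis
    unfolding has_field_derivative_def
    by (rule has_derivative_eq_rhs) (auto simp: sum_distrib_left mult_ac)
qed

text \<open>Write \<open>F (x + s e\<^sub>i + t e\<^sub>j)\<close> as an integral of \<open>\<partial>\<^sub>j F\<close> and differentiate under the integral.\<close>

lemma partial_commute:
  fixes F :: "real^'n::finite \<Rightarrow> real"
  assumes "open S" "x \<in> S" "Ck_on 2 S F"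
  shows "partial i (partial j F) x = partial j (partial i F) x"
proof -
  obtain r where r: "r > 0" "ball x r \<subseteq> S" using assms(1,2) open_contains_ball by blast
  define \<delta> where "\<delta> = r / 4"
  have \<delta>: "\<delta> > 0" using r by (simp add: \<delta>_def)
  define y where "y s t = x + s *\<^sub>R axis i 1 + t *\<^sub>R axis j (1::real)" for s t
  have yS: "y s t \<in> S" if "\<bar>s\<bar> \<le> \<delta>" "\<bar>t\<bar> \<le> \<delta>" for s t
  proof -
    have "norm (s *\<^sub>R axis i 1 + t *\<^sub>R axis j (1::real)) \<le> \<bar>s\<bar> + \<bar>t\<bar>"
      by (rule order_trans[OF norm_triangle_ineq]) simp
    also have "\<dots> < r" using that \<delta>_def r by simp
    finally show ?thesis using r(2) by (auto simp: y_def dist_norm norm_minus_commute[of x] add.assoc subset_iff)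
  qed
  have F: "F differentiable (at z)" "partial k F differentiable (at z)" if "z \<in> S" for z k
    using assms(3) that by (auto simp: numeral_2_eq_2)
  have cont: "continuous_on S (partial k (partial l F))" "continuous_on S (partial k F)" for k l
    using assms(3) by (auto simp: numeral_2_eq_2 intro!: Ck_on_continuous[of "Suc 0"])
  have ys: "((\<lambda>s. y s t) has_vector_derivative axis i 1) (at s within A)" for s t A
    unfolding y_def by (auto intro!: derivative_eq_intros)
  have yt: "((\<lambda>t. y s t) has_vector_derivative axis j 1) (at t within A)" for s t A
    unfolding y_def by (auto intro!: derivative_eq_intros)
  have ds: "((\<lambda>s. H (y s t)) has_real_derivative partial i H (y s t)) (at s within A)"
    if "H differentiable (at (y s t))" for H s t A
    using has_real_derivative_along[of H "\<lambda>s. y s t", OF that ys, of A]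
    by (simp add: axis_def if_distrib[of "\<lambda>a. a * _"] cong: if_cong)
  have dt: "((\<lambda>t. H (y s t)) has_real_derivative partial j H (y s t)) (at t within A)"
    if "H differentiable (at (y s t))" for H s t A
    using has_real_derivative_along[of H "\<lambda>t. y s t", OF that yt, of A]
    by (simp add: axis_def if_distrib[of "\<lambda>a. a * _"] cong: if_cong)
  let ?I = "{-\<delta>..\<delta>}"
  have ycont: "continuous_on A (\<lambda>(s,t). y s t)" for A
    unfolding y_def case_prod_beta by (intro continuous_intros)
  have ycont1: "continuous_on A (\<lambda>t. y s t)" for A s
    unfolding y_def by (intro continuous_intros)
  \<comment> \<open>\<open>P 0 t\<close> will turn out to be \<open>partial i F (y 0 t)\<close>:
    integrate \<open>partial j F\<close> in \<open>t\<close>, then differentiate in \<open>s\<close>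
    under the integral sign.\<close>
  define P where "P s t = partial i F (y s 0) + integral {0..t} (\<lambda>\<tau>. partial i (partial j F) (y s \<tau>))" for s t
  have eq: "partial i F (y 0 t) = P 0 t" if t: "t \<in> {0..\<delta>}" for t
  proof -
    have "((\<lambda>s. integral (cbox 0 t) (\<lambda>\<tau>. partial j F (y s \<tau>))) has_field_derivative
        integral (cbox 0 t) (\<lambda>\<tau>. partial i (partial j F) (y 0 \<tau>))) (at 0 within ?I)"
    proof (rule leibniz_rule_field_derivative)
      show "((\<lambda>s. partial j F (y s \<tau>)) has_field_derivative partial i (partial j F) (y s \<tau>)) (at s within ?I)"
        if "s \<in> ?I" "\<tau> \<in> cbox 0 t" for s \<tau>
        by (rule ds, rule F, rule yS) (use that t in auto)
      show "(\<lambda>\<tau>. partial j F (y s \<tau>)) integrable_on cbox 0 t" if "s \<in> ?I" for s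
        by (intro integrable_continuous continuous_on_compose2[OF cont(2) ycont1])
          (use that t in \<open>auto intro!: yS\<close>)
      have "continuous_on (?I \<times> cbox 0 t) (\<lambda>z. partial i (partial j F) (case z of (s,\<tau>) \<Rightarrow> y s \<tau>))"
        by (rule continuous_on_compose2[OF cont(1) ycont]) (use t in \<open>auto intro!: yS\<close>)
      then show "continuous_on (?I \<times> cbox 0 t) (\<lambda>(s,\<tau>). partial i (partial j F) (y s \<tau>))"
        by (simp add: case_prod_beta)
    qed (use \<delta> in auto)
    moreover have "integral (cbox 0 t) (\<lambda>\<tau>. partial j F (y s \<tau>)) = F (y s t) - F (y s 0)" if "s \<in> ?I" for s
    proof -
      have "((\<lambda>\<tau>. partial j F (y s \<tau>)) has_integral F (y s t) - F (y s 0)) {0..t}"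
        by (rule fundamental_theorem_of_calculus)
          (use that t in \<open>auto simp: has_real_derivative_iff_has_vector_derivative[symmetric] intro!: dt F yS\<close>)
      then show ?thesis by (simp add: integral_unique)
    qed
    ultimately have "((\<lambda>s. F (y s t) - F (y s 0)) has_field_derivative
        integral (cbox 0 t) (\<lambda>\<tau>. partial i (partial j F) (y 0 \<tau>))) (at 0 within ?I)"
      using \<delta> by (subst has_field_derivative_cong_eventually[where g="\<lambda>s. integral (cbox 0 t) (\<lambda>\<tau>. partial j F (y s \<tau>))"])
        (auto simp: eventually_at_topological)
    moreover have "((\<lambda>s. F (y s t) - F (y s 0)) has_field_derivative
        partial i F (y 0 t) - partial i F (y 0 0)) (at 0 within ?I)"
      by (rule DERIV_diff; rule ds; rule F; rule yS) (use t \<delta> in auto)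
    moreover have "at (0::real) within ?I = at 0"
      using \<delta> by (intro at_within_interior) simp
    ultimately have "partial i F (y 0 t) - partial i F (y 0 0) = integral {0..t} (\<lambda>\<tau>. partial i (partial j F) (y 0 \<tau>))"
      using DERIV_unique by fastforce
    then show ?thesis unfolding P_def by linarith
  qed
  \<comment> \<open>The derivative of \<open>P 0\<close> at 0 is computed once from the integral and
    once from \<open>eq\<close>; a one-sided derivative determines its value.\<close>
  have "((\<lambda>t. P 0 t) has_real_derivative partial i (partial j F) (y 0 0)) (at 0 within {0..\<delta>})"
  proof -
    have "continuous_on {0..\<delta>} (\<lambda>\<tau>. partial i (partial j F) (y 0 \<tau>))"
      by (intro continuous_on_compose2[OF cont(1) ycont1]) (auto intro!: yS)
    from integral_has_vector_derivative[OF this, of 0] show ?thesis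
      unfolding P_def has_real_derivative_iff_has_vector_derivative
      using \<delta> by (auto intro!: derivative_eq_intros)
  qed
  moreover have "((\<lambda>t. P 0 t) has_real_derivative partial j (partial i F) (y 0 0)) (at 0 within {0..\<delta>})"
  proof (rule has_field_derivative_transform_within[OF _ \<delta> _ eq])
    show "((\<lambda>t. partial i F (y 0 t)) has_real_derivative partial j (partial i F) (y 0 0)) (at 0 within {0..\<delta>})"
      by (rule dt, rule F, rule yS) (use \<delta> in auto)
  qed (use \<delta> in auto)
  ultimately have "partial i (partial j F) (y 0 0) = partial j (partial i F) (y 0 0)"
    using vector_derivative_unique_within[of 0 "{0..\<delta>}"] \<delta>
    by (auto simp: has_real_derivative_iff_has_vector_derivative trivial_limit_within islimpt_Icc)
  then show ?thesis by (simp add: y_def)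
qed

section \<open>Multilinear forms\<close>

text \<open>Coefficients are contracted with vectors from the start. Later identities then relate
  vectors and multilinear maps instead of sums over indices, and symmetries of the coefficients
  enter through the swap lemmas.\<close>

definition form1 :: "('n::finite \<Rightarrow> real) \<Rightarrow> real^'n \<Rightarrow> real" where
  "form1 H u = (\<Sum>i\<in>UNIV. u $ i * H i)"

definition form2 :: "('n::finite \<Rightarrow> 'n \<Rightarrow> real) \<Rightarrow> real^'n \<Rightarrow> real^'n \<Rightarrow> real" where
  "form2 H u v = form1 (\<lambda>i. form1 (H i) v) u"

definition form3 :: "('n::finite \<Rightarrow> 'n \<Rightarrow> 'n \<Rightarrow> real) \<Rightarrow> real^'n \<Rightarrow> real^'n \<Rightarrow> real^'n \<Rightarrow> real" where
  "form3 H u v w = form1 (\<lambda>i. form2 (H i) v w) u"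

definition form4 ::
  "('n::finite \<Rightarrow> 'n \<Rightarrow> 'n \<Rightarrow> 'n \<Rightarrow> real) \<Rightarrow> real^'n \<Rightarrow> real^'n \<Rightarrow> real^'n \<Rightarrow> real^'n \<Rightarrow> real" where
  "form4 H u v w z = form1 (\<lambda>i. form3 (H i) v w z) u"

lemma form1_lin:
  "form1 H (u + u') = form1 H u + form1 H u'"
  "form1 H (c *\<^sub>R u) = c * form1 H u"
  "form1 H 0 = 0"
  "form1 (\<lambda>i. K i + L i) u = form1 K u + form1 L u"
  "form1 (\<lambda>i. K i - L i) u = form1 K u - form1 L u"
  "form1 (\<lambda>i. c * K i) u = c * form1 K u"
  "form1 (\<lambda>i. K i / c) u = form1 K u / c"
  "form1 (\<lambda>i. 0) u = 0"
  by (simp_all add: form1_def algebra_simps sum.distrib sum_distrib_left sum_subtractf sum_divide_distrib)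

lemma form1_sum: "form1 (\<lambda>i. \<Sum>k\<in>A. K k i) u = (\<Sum>k\<in>A. form1 (K k) u)"
  unfolding form1_def sum_distrib_left by (rule sum.swap)

lemma form1_swap: "form1 (\<lambda>i. form1 (H i) v) u = form1 (\<lambda>j. form1 (\<lambda>i. H i j) u) v"
  unfolding form1_def sum_distrib_left by (subst sum.swap) (simp add: mult_ac)

lemma form2_lin:
  "form2 H (u + u') v = form2 H u v + form2 H u' v"
  "form2 H v (u + u') = form2 H v u + form2 H v u'"
  "form2 H (c *\<^sub>R u) v = c * form2 H u v"
  "form2 H v (c *\<^sub>R u) = c * form2 H v u"
  "form2 H 0 v = 0"
  "form2 H v 0 = 0"
  by (simp_all add: form2_def form1_lin)

lemma form2_coeff:
  "form2 (\<lambda>i j. K i j + L i j) u v = form2 K u v + form2 L u v"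
  "form2 (\<lambda>i j. K i j - L i j) u v = form2 K u v - form2 L u v"
  "form2 (\<lambda>i j. c * K i j) u v = c * form2 K u v"
  "form2 (\<lambda>i j. K i j / c) u v = form2 K u v / c"
  "form2 (\<lambda>i j. \<Sum>k\<in>A. M k i j) u v = (\<Sum>k\<in>A. form2 (M k) u v)"
  by (simp_all add: form2_def form1_lin form1_sum)

lemma form2_swap: "form2 H u v = form2 (\<lambda>i j. H j i) v u"
  unfolding form2_def by (rule form1_swap)

lemma form3_lin:
  "form3 H (u + u') v w = form3 H u v w + form3 H u' v w"
  "form3 H v (u + u') w = form3 H v u w + form3 H v u' w"
  "form3 H v w (u + u') = form3 H v w u + form3 H v w u'"
  "form3 H (c *\<^sub>R u) v w = c * form3 H u v w"
  "form3 H v (c *\<^sub>R u) w = c * form3 H v u w"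
  "form3 H v w (c *\<^sub>R u) = c * form3 H v w u"
  by (simp_all add: form3_def form2_lin form1_lin)

lemma form3_coeff:
  "form3 (\<lambda>i j k. K i j k + L i j k) u v w = form3 K u v w + form3 L u v w"
  "form3 (\<lambda>i j k. K i j k - L i j k) u v w = form3 K u v w - form3 L u v w"
  "form3 (\<lambda>i j k. K i j k / c) u v w = form3 K u v w / c"
  by (simp_all add: form3_def form2_coeff form1_lin)

lemma form3_form1: "form3 H u v w = form2 (\<lambda>i j. form1 (H i j) w) u v"
  unfolding form3_def form2_def ..

lemma form3_swap12: "form3 H u v w = form3 (\<lambda>i j k. H j i k) v u w"
  unfolding form3_form1 by (rule form2_swap)

lemma form3_swap23: "form3 H u v w = form3 (\<lambda>i j k. H i k j) u w v"
  unfolding form3_def by (subst form2_swap) simp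

lemma form4_form3: "form4 H u v w z = form2 (\<lambda>i j. form2 (H i j) w z) u v"
  unfolding form4_def form3_def form2_def ..

lemma form4_swap12: "form4 H u v w z = form4 (\<lambda>i j k l. H j i k l) v u w z"
  unfolding form4_form3 by (rule form2_swap)

lemma form4_swap34: "form4 H u v w z = form4 (\<lambda>i j k l. H i j l k) u v z w"
  unfolding form4_form3 by (subst (2) form2_swap) simp

lemma form1_axis [simp]: "form1 H (axis i 1) = H i"
  by (simp add: form1_def axis_def if_distrib[of "\<lambda>a. a * _"] cong: if_cong)

lemma form2_axis [simp]: "form2 H (axis i 1) (axis j 1) = H i j"
  by (simp add: form2_def)

lemma form3_axis [simp]: "form3 H (axis i 1) (axis j 1) (axis k 1) = H i j k"
  by (simp add: form3_def)

section \<open>Derivatives and continuity of contracted tensors along a curve\<close>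

lemma form1_deriv:
  assumes "\<And>i. (H i has_real_derivative H' i) (at t within S)"
    "(V has_vector_derivative V') (at t within S)"
  shows "((\<lambda>t. form1 (\<lambda>i. H i t) (V t)) has_real_derivative
    form1 H' (V t) + form1 (\<lambda>i. H i t) V') (at t within S)"
proof -
  have V: "((\<lambda>t. V t $ i) has_real_derivative V' $ i) (at t within S)" for i
    using assms(2) by (simp add: has_vector_derivative_vec_iff)
  show ?thesis
    unfolding form1_def
    by (rule DERIV_cong[OF DERIV_sum[OF DERIV_mult[OF V assms(1)]]])
      (simp add: sum.distrib algebra_simps)
qed

lemma form2_deriv:
  assumes "\<And>i j. (H i j has_real_derivative H' i j) (at t within S)"
    "(V has_vector_derivative V') (at t within S)"
    "(W has_vector_derivative W') (at t within S)"
  shows "((\<lambda>t. form2 (\<lambda>i j. H i j t) (V t) (W t)) has_real_derivative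
    form2 H' (V t) (W t) + form2 (\<lambda>i j. H i j t) V' (W t)
      + form2 (\<lambda>i j. H i j t) (V t) W') (at t within S)"
  unfolding form2_def
  by (rule DERIV_cong[OF form1_deriv[OF form1_deriv[OF assms(1,3)] assms(2)]])
    (simp add: form1_lin)

lemma continuous_on_form1:
  fixes V :: "'a::topological_space \<Rightarrow> real^'n::finite"
  assumes "\<And>i. continuous_on S (H i)" "continuous_on S V"
  shows "continuous_on S (\<lambda>t. form1 (\<lambda>i. H i t) (V t))"
  unfolding form1_def using assms by (intro continuous_intros) auto

lemma continuous_on_form2:
  fixes V :: "'a::topological_space \<Rightarrow> real^'n::finite"
  assumes "\<And>i j. continuous_on S (H i j)" "continuous_on S V" "continuous_on S W"
  shows "continuous_on S (\<lambda>t. form2 (\<lambda>i j. H i j t) (V t) (W t))"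
  unfolding form2_def using assms by (intro continuous_on_form1) auto

lemma continuous_on_form3:
  fixes V :: "'a::topological_space \<Rightarrow> real^'n::finite"
  assumes "\<And>i j k. continuous_on S (H i j k)" "continuous_on S V" "continuous_on S W" "continuous_on S Z"
  shows "continuous_on S (\<lambda>t. form3 (\<lambda>i j k. H i j k t) (V t) (W t) (Z t))"
  unfolding form3_def using assms by (intro continuous_on_form1 continuous_on_form2) auto

lemma continuous_on_form4:
  fixes V :: "'a::topological_space \<Rightarrow> real^'n::finite"
  assumes "\<And>i j k l. continuous_on S (H i j k l)" "continuous_on S V" "continuous_on S W"
    "continuous_on S Z" "continuous_on S Y"
  shows "continuous_on S (\<lambda>t. form4 (\<lambda>i j k l. H i j k l t) (V t) (W t) (Z t) (Y t))"
  unfolding form4_def using assms by (intro continuous_on_form1 continuous_on_form3) auto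

lemma deriv_along:
  assumes "F differentiable (at (c t))" "(c has_vector_derivative c') (at t within S)"
  shows "((\<lambda>t. F (c t)) has_real_derivative form1 (\<lambda>i. partial i F (c t)) c') (at t within S)"
  using has_real_derivative_along[OF assms] by (simp add: form1_def)

lemma form2_along:
  assumes "\<And>i j. H i j differentiable (at (c t))" "(c has_vector_derivative c') (at t within S)"
    "(V has_vector_derivative V') (at t within S)"
    "(W has_vector_derivative W') (at t within S)"
  shows "((\<lambda>t. form2 (\<lambda>i j. H i j (c t)) (V t) (W t)) has_real_derivative
    form3 (\<lambda>l i j. partial l (H i j) (c t)) c' (V t) (W t) + form2 (\<lambda>i j. H i j (c t)) V' (W t)
      + form2 (\<lambda>i j. H i j (c t)) (V t) W') (at t within S)"
proof (rule DERIV_cong[OF form2_deriv[OF deriv_along[OF assms(1,2)] assms(3,4)]])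
  have "form2 (\<lambda>i j. form1 (\<lambda>l. partial l (H i j) (c t)) c') (V t) (W t) =
    form3 (\<lambda>l i j. partial l (H i j) (c t)) c' (V t) (W t)"
    unfolding form3_form1[symmetric]
    by (subst (2) form3_swap12, subst (2) form3_swap23) simp
  then show "form2 (\<lambda>i j. form1 (\<lambda>l. partial l (H i j) (c t)) c') (V t) (W t)
    + form2 (\<lambda>i j. H i j (c t)) V' (W t) + form2 (\<lambda>i j. H i j (c t)) (V t) W' =
    form3 (\<lambda>l i j. partial l (H i j) (c t)) c' (V t) (W t) + form2 (\<lambda>i j. H i j (c t)) V' (W t)
      + form2 (\<lambda>i j. H i j (c t)) (V t) W'" by simp
qed

lemma form3_along:
  assumes "\<And>i j k. H i j k differentiable (at (c t))" "(c has_vector_derivative c') (at t within S)"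
    "(V has_vector_derivative V') (at t within S)"
    "(W has_vector_derivative W') (at t within S)"
    "(Z has_vector_derivative Z') (at t within S)"
  shows "((\<lambda>t. form3 (\<lambda>i j k. H i j k (c t)) (V t) (W t) (Z t)) has_real_derivative
    form4 (\<lambda>l i j k. partial l (H i j k) (c t)) c' (V t) (W t) (Z t) + form3 (\<lambda>i j k. H i j k (c t)) V' (W t) (Z t)
      + form3 (\<lambda>i j k. H i j k (c t)) (V t) W' (Z t) + form3 (\<lambda>i j k. H i j k (c t)) (V t) (W t) Z') (at t within S)"
  unfolding form3_def
proof (rule DERIV_cong[OF form1_deriv[OF form2_along[OF assms(1,2,4,5)] assms(3)]])
  show "form1 (\<lambda>i. form3 (\<lambda>l ia j. partial l (H i ia j) (c t)) c' (W t) (Z t) +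
             form2 (\<lambda>ia j. H i ia j (c t)) W' (Z t) + form2 (\<lambda>ia j. H i ia j (c t)) (W t) Z') (V t) +
    form1 (\<lambda>i. form2 (\<lambda>ia j. H i ia j (c t)) (W t) (Z t)) V' =
    form4 (\<lambda>l i j k. partial l (H i j k) (c t)) c' (V t) (W t) (Z t) +
    form1 (\<lambda>i. form2 (\<lambda>ia j. H i ia j (c t)) (W t) (Z t)) V' +
    form1 (\<lambda>i. form2 (\<lambda>ia j. H i ia j (c t)) W' (Z t)) (V t) +
    form1 (\<lambda>i. form2 (\<lambda>ia j. H i ia j (c t)) (W t) Z') (V t)"
    by (simp add: form1_lin form4_def[symmetric]) (rule form4_swap12)
qed

section \<open>First and second differentials of vector-valued maps\<close>

definition dvec :: "(real^'n::finite \<Rightarrow> real^'k::finite) \<Rightarrow> real^'n \<Rightarrow> real^'n \<Rightarrow> real^'k" where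
  "dvec X x u = (\<chi> k. form1 (\<lambda>l. partial l (\<lambda>y. X y $ k) x) u)"

definition ddvec :: "(real^'n::finite \<Rightarrow> real^'k::finite) \<Rightarrow> real^'n \<Rightarrow> real^'n \<Rightarrow> real^'n \<Rightarrow> real^'k" where
  "ddvec X x u v = (\<chi> k. form2 (\<lambda>m l. partial m (partial l (\<lambda>y. X y $ k)) x) u v)"

lemma dvec_lin:
  "dvec X x (u + v) = dvec X x u + dvec X x v"
  "dvec X x (c *\<^sub>R u) = c *\<^sub>R dvec X x u"
  by (simp_all add: dvec_def vec_eq_iff form1_lin)

lemma ddvec_lin:
  "ddvec X x (u + u') v = ddvec X x u v + ddvec X x u' v"
  "ddvec X x v (u + u') = ddvec X x v u + ddvec X x v u'"
  "ddvec X x (c *\<^sub>R u) v = c *\<^sub>R ddvec X x u v"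
  "ddvec X x v (c *\<^sub>R u) = c *\<^sub>R ddvec X x v u"
  by (simp_all add: ddvec_def vec_eq_iff form2_lin)

lemma ddvec_sym:
  assumes "open S" "x \<in> S" "\<And>k. smooth_on S (\<lambda>y. X y $ k)"
  shows "ddvec X x u v = ddvec X x v u"
proof -
  have "partial m (partial l (\<lambda>y. X y $ k)) x = partial l (partial m (\<lambda>y. X y $ k)) x" for m l k
    using partial_commute[OF assms(1,2)] assms(3) unfolding smooth_on_def by blast
  then show ?thesis
    unfolding ddvec_def vec_eq_iff by (subst form2_swap) (simp only: vec_lambda_beta simp_thms)
qed

lemma dvec_along:
  assumes "\<And>k. (\<lambda>y. X y $ k) differentiable (at (c t))" "(c has_vector_derivative c') (at t within S)"
  shows "((\<lambda>t. X (c t)) has_vector_derivative dvec X (c t) c') (at t within S)"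
  unfolding has_vector_derivative_vec_iff dvec_def
  using deriv_along[of "\<lambda>y. X y $ _" c t, OF assms(1) assms(2)] by simp

lemma ddvec_along:
  assumes "\<And>k l. partial l (\<lambda>y. X y $ k) differentiable (at (c t))" "(c has_vector_derivative c') (at t within S)"
    "(V has_vector_derivative V') (at t within S)"
  shows "((\<lambda>t. dvec X (c t) (V t)) has_vector_derivative ddvec X (c t) c' (V t) + dvec X (c t) V') (at t within S)"
  unfolding has_vector_derivative_vec_iff dvec_def ddvec_def
proof (intro allI)
  fix k
  show "((\<lambda>t. (\<chi> k. form1 (\<lambda>l. partial l (\<lambda>y. X y $ k) (c t)) (V t)) $ k) has_real_derivative
      ((\<chi> k. form2 (\<lambda>m l. partial m (partial l (\<lambda>y. X y $ k)) (c t)) c' (V t)) +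
       (\<chi> k. form1 (\<lambda>l. partial l (\<lambda>y. X y $ k) (c t)) V')) $ k) (at t within S)"
    using form1_deriv[OF deriv_along[OF assms(1)[of _ k] assms(2)] assms(3)]
    by (simp add: form2_def) (subst form1_swap, simp)
qed

section \<open>Riemannian geometry in a chart\<close>

locale chart_metric =
  fixes U :: "(real^'n::finite) set" and G :: "real^'n \<Rightarrow> real^'n^'n"
  assumes open_U: "open U"
    and smooth_G: "\<And>i j. smooth_on U (\<lambda>x. G x $ i $ j)"
    and sym_G: "\<And>x i j. x \<in> U \<Longrightarrow> G x $ i $ j = G x $ j $ i"
    and pos_G: "\<And>x v. x \<in> U \<Longrightarrow> v \<noteq> 0 \<Longrightarrow> form2 (\<lambda>i j. G x $ i $ j) v v > 0"
begin

definition ip where "ip x v w = form2 (\<lambda>i j. G x $ i $ j) v w"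
definition dG where "dG x u v w = form3 (\<lambda>l i j. partial l (\<lambda>y. G y $ i $ j) x) u v w"
definition ddG where
  "ddG x t u v w = form4 (\<lambda>m l i j. partial m (partial l (\<lambda>y. G y $ i $ j)) x) t u v w"
definition Gam :: "real^'n \<Rightarrow> real^'n \<Rightarrow> real^'n \<Rightarrow> real^'n" where
  "Gam x v w = (\<chi> k. form2 (\<lambda>i j. christoffel G k i j x) v w)"
definition dGam :: "real^'n \<Rightarrow> real^'n \<Rightarrow> real^'n \<Rightarrow> real^'n \<Rightarrow> real^'n" where
  "dGam x u v w = (\<chi> k. form3 (\<lambda>l i j. partial l (christoffel G k i j) x) u v w)"

text \<open>Christoffel symbols of the first kind, and their directional derivative.\<close>

definition cc where "cc x v w z = (dG x v w z + dG x w v z - dG x z v w) / 2"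
definition dcc where "dcc x u v w z = (ddG x u v w z + ddG x u w v z - ddG x u z v w) / 2"

text \<open>\<open>R(u,v)w\<close>, computed for constant extensions of the three vectors, whose Lie
  brackets vanish.\<close>

definition Riem where
  "Riem x u v w = dGam x u v w - dGam x v u w + Gam x u (Gam x v w) - Gam x v (Gam x u w)"

lemma ip_lin:
  "ip x (u + u') v = ip x u v + ip x u' v"
  "ip x v (u + u') = ip x v u + ip x v u'"
  "ip x (c *\<^sub>R u) v = c * ip x u v"
  "ip x v (c *\<^sub>R u) = c * ip x v u"
  "ip x 0 v = 0" "ip x v 0 = 0"
  by (simp_all add: ip_def form2_lin)

lemma ip_minus: "ip x (- u) v = - ip x u v" "ip x v (- u) = - ip x v u"
  "ip x (u - u') v = ip x u v - ip x u' v" "ip x v (u - u') = ip x v u - ip x v u'"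
  using ip_lin(3,4)[where c="-1"] ip_lin(1,2)[where u'="-u'"] by simp_all

lemma ip_sum: "ip x (\<Sum>i\<in>A. h i) v = (\<Sum>i\<in>A. ip x (h i) v)"
  by (induction A rule: infinite_finite_induct) (simp_all add: ip_lin)

lemma dG_lin:
  "dG x (u + u') v w = dG x u v w + dG x u' v w"
  "dG x v (u + u') w = dG x v u w + dG x v u' w"
  "dG x v w (u + u') = dG x v w u + dG x v w u'"
  "dG x (c *\<^sub>R u) v w = c * dG x u v w"
  "dG x v (c *\<^sub>R u) w = c * dG x v u w"
  "dG x v w (c *\<^sub>R u) = c * dG x v w u"
  by (simp_all add: dG_def form3_lin)

lemma dG_minus: "dG x (- u) v w = - dG x u v w" "dG x v (- u) w = - dG x v u w"
    "dG x v w (- u) = - dG x v w u"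
  using dG_lin(4-6)[where c="-1"] by simp_all

lemma Gam_lin:
  "Gam x (u + u') v = Gam x u v + Gam x u' v"
  "Gam x v (u + u') = Gam x v u + Gam x v u'"
  "Gam x (c *\<^sub>R u) v = c *\<^sub>R Gam x u v"
  "Gam x v (c *\<^sub>R u) = c *\<^sub>R Gam x v u"
  by (simp_all add: Gam_def form2_lin vec_eq_iff)

lemma dGam_lin:
  "dGam x (u + u') v w = dGam x u v w + dGam x u' v w"
  "dGam x v (u + u') w = dGam x v u w + dGam x v u' w"
  "dGam x v w (u + u') = dGam x v w u + dGam x v w u'"
  "dGam x (c *\<^sub>R u) v w = c *\<^sub>R dGam x u v w"
  "dGam x v (c *\<^sub>R u) w = c *\<^sub>R dGam x v u w"
  "dGam x v w (c *\<^sub>R u) = c *\<^sub>R dGam x v w u"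
  by (simp_all add: dGam_def form3_lin vec_eq_iff)

lemma Riem_lin:
  "Riem x (u + u') v w = Riem x u v w + Riem x u' v w"
  "Riem x (c *\<^sub>R u) v w = c *\<^sub>R Riem x u v w"
  "Riem x v w (c *\<^sub>R u) = c *\<^sub>R Riem x v w u"
  by (simp_all add: Riem_def dGam_lin Gam_lin algebra_simps)

lemma ip_sym: "x \<in> U \<Longrightarrow> ip x v w = ip x w v"
  unfolding ip_def by (subst form2_swap) (simp add: sym_G)

lemma ip_pos: "x \<in> U \<Longrightarrow> v \<noteq> 0 \<Longrightarrow> ip x v v > 0"
  unfolding ip_def by (rule pos_G)

lemma ip_nonneg: "x \<in> U \<Longrightarrow> ip x v v \<ge> 0"
  using ip_pos[of x v] by (cases "v = 0") (auto simp: ip_lin)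

lemma ip_eqI:
  assumes "x \<in> U" "\<And>w. ip x u w = ip x v w" shows "u = v"
proof (rule ccontr)
  assume "u \<noteq> v"
  then have "ip x (u - v) (u - v) > 0" using ip_pos[OF assms(1)] by simp
  then show False using assms(2) by (simp add: ip_minus)
qed

lemma ip_CS_unit:
  assumes "x \<in> U" "ip x e e = 1" shows "(ip x v e)\<^sup>2 \<le> ip x v v"
proof -
  have "0 \<le> ip x (v - ip x v e *\<^sub>R e) (v - ip x v e *\<^sub>R e)"
    by (rule ip_nonneg[OF assms(1)])
  also have "\<dots> = ip x v v - (ip x v e)\<^sup>2"
    using assms ip_sym[OF assms(1), of e v]
    by (simp add: ip_minus ip_lin power2_eq_square algebra_simps)
  finally show ?thesis by simp
qed

lemma partial_sym_G: "x \<in> U \<Longrightarrow> partial l (\<lambda>y. G y $ i $ j) x = partial l (\<lambda>y. G y $ j $ i) x"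
  by (rule partial_cong[OF open_U]) (auto simp: sym_G)

lemma dG_sym: "x \<in> U \<Longrightarrow> dG x u v w = dG x u w v"
  unfolding dG_def by (subst form3_swap23) (simp add: partial_sym_G)

lemma ddG_sym: assumes "x \<in> U" shows "ddG x t u v w = ddG x t u w v" "ddG x t u v w = ddG x u t v w"
proof -
  have "partial m (partial l (\<lambda>y. G y $ i $ j)) x = partial m (partial l (\<lambda>y. G y $ j $ i)) x" for m l i j
    using partial_sym_G by (rule partial_cong[OF open_U assms])
  then show "ddG x t u v w = ddG x t u w v"
    unfolding ddG_def by (subst form4_swap34) simp
  have "partial m (partial l (\<lambda>y. G y $ i $ j)) x = partial l (partial m (\<lambda>y. G y $ i $ j)) x" for m l i j
    using partial_commute[OF open_U assms] smooth_G unfolding smooth_on_def by blast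
  then show "ddG x t u v w = ddG x u t v w"
    unfolding ddG_def by (subst form4_swap12) presburger
qed

lemma invertible_G: assumes "x \<in> U" shows "invertible (G x)"
proof -
  have "v = 0" if "G x *v v = 0" for v
  proof (rule ccontr)
    assume "v \<noteq> 0"
    then have "form2 (\<lambda>i j. G x $ i $ j) v v > 0" by (rule pos_G[OF assms])
    moreover have "form2 (\<lambda>i j. G x $ i $ j) v v = (\<Sum>i\<in>UNIV. v $ i * (G x *v v) $ i)"
      by (simp add: form2_def form1_def matrix_vector_mult_def mult.commute)
    ultimately show False using that by simp
  qed
  then have "inj ((*v) (G x))" using matrix_left_invertible_ker matrix_left_invertible_injective by blast
  then show ?thesis using invertible_left_inverse matrix_left_invertible_injective by blast
qed

lemma smooth_christoffel: "smooth_on U (christoffel G k i j)"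
proof -
  have "smooth_on U (\<lambda>x. 1/2 * (\<Sum>l\<in>UNIV. matrix_inv (G x) $ k $ l *
       (partial i (\<lambda>y. G y $ j $ l) x + partial j (\<lambda>y. G y $ i $ l) x
        - partial l (\<lambda>y. G y $ i $ j) x)))"
    by (intro smooth_on_intros[OF open_U] smooth_on_matrix_inv[OF open_U smooth_G invertible_G]
        smooth_on_partial smooth_G finite_class.finite_UNIV)
  then show ?thesis unfolding christoffel_def[abs_def] .
qed

lemma christoffel_sym: assumes "x \<in> U" shows "christoffel G k i j x = christoffel G k j i x"
  using partial_sym_G[OF assms, of _ i j] unfolding christoffel_def by (simp add: add.commute)

lemma Gam_sym: "x \<in> U \<Longrightarrow> Gam x v w = Gam x w v"
  unfolding Gam_def vec_eq_iff by (subst form2_swap) (simp add: christoffel_sym)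

text \<open>Lowering the index cancels the inverse matrix in \<open>christoffel\<close>. Only first
  derivatives of the metric remain, so later identities reduce to arithmetic with
  \<open>dG\<close>.\<close>

lemma ip_Gam:
  assumes "x \<in> U" shows "ip x (Gam x v w) z = cc x v w z"
proof -
  let ?d = "\<lambda>l i j. partial l (\<lambda>y. G y $ i $ j) x"
  let ?c = "\<lambda>i j m. (?d i j m + ?d j i m - ?d m i j) / 2"
  have G: "(\<Sum>k\<in>UNIV. christoffel G k i j x * G x $ k $ m) = ?c i j m" for i j m
  proof -
    have "(\<Sum>k\<in>UNIV. christoffel G k i j x * G x $ k $ m) =
      (\<Sum>k\<in>UNIV. \<Sum>l\<in>UNIV. ?c i j l * (G x $ m $ k * matrix_inv (G x) $ k $ l))"
      by (simp add: christoffel_def sum_distrib_right sum_distrib_left sym_G[OF assms, of m] field_simps)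
    also have "\<dots> = (\<Sum>l\<in>UNIV. ?c i j l * (\<Sum>k\<in>UNIV. G x $ m $ k * matrix_inv (G x) $ k $ l))"
      by (subst sum.swap) (simp add: sum_distrib_left)
    also have "\<dots> = (\<Sum>l\<in>UNIV. ?c i j l * (G x ** matrix_inv (G x)) $ m $ l)"
      by (simp add: matrix_matrix_mult_def)
    also have "\<dots> = ?c i j m"
      using matrix_inv_works(1)[OF invertible_G[OF assms]]
      by (simp add: mat_def if_distrib[of "\<lambda>a. _ * a"] cong: if_cong)
    finally show ?thesis .
  qed
  have "ip x (Gam x v w) z = (\<Sum>k\<in>UNIV. form2 (\<lambda>i j. christoffel G k i j x) v w * form1 (\<lambda>m. G x $ k $ m) z)"
    unfolding ip_def form2_def[of _ _ z] form1_def[of _ "Gam x v w"] by (simp add: Gam_def)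
  also have "\<dots> = form2 (\<lambda>i j. form1 (\<lambda>m. \<Sum>k\<in>UNIV. christoffel G k i j x * G x $ k $ m) z) v w"
    by (simp add: form1_sum form2_coeff form1_lin mult.commute[of _ "form1 _ z"])
  also have "\<dots> = form3 ?c v w z"
    unfolding G form3_form1 ..
  also have "\<dots> = (form3 ?d v w z + form3 (\<lambda>i j m. ?d j i m) v w z - form3 (\<lambda>i j m. ?d m i j) v w z) / 2"
    by (simp add: form3_coeff)
  also have "form3 (\<lambda>i j m. ?d j i m) v w z = dG x w v z"
    unfolding dG_def by (rule form3_swap12)
  also have "form3 (\<lambda>i j m. ?d m i j) v w z = dG x z v w"
    unfolding dG_def by (subst form3_swap23, subst form3_swap12) simp
  finally show ?thesis unfolding cc_def dG_def .
qed

text \<open>Compatibility of the Levi-Civita connection with the metric: of the six terms that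
  \<open>cc\<close> produces, the symmetry of \<open>G\<close> leaves only the derivative in
  direction \<open>u\<close>.\<close>

lemma dG_Gam: "x \<in> U \<Longrightarrow> dG x u v w = ip x (Gam x u v) w + ip x v (Gam x u w)"
  using dG_sym[of x] by (simp add: ip_Gam ip_sym[of x v] cc_def field_simps)

lemmas smooth_G_diff = smooth_on_differentiable[OF smooth_G]
lemmas smooth_partial_G_diff = smooth_on_differentiable[OF smooth_on_partial[OF smooth_G]]

lemma ip_deriv:
  assumes "c t \<in> U" "(c has_vector_derivative c') (at t within S)"
    "(V has_vector_derivative V') (at t within S)"
    "(W has_vector_derivative W') (at t within S)"
  shows "((\<lambda>t. ip (c t) (V t) (W t)) has_real_derivative
    dG (c t) c' (V t) (W t) + ip (c t) V' (W t) + ip (c t) (V t) W') (at t within S)"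
  unfolding ip_def dG_def
  by (rule form2_along[of "\<lambda>i j y. G y $ i $ j", OF smooth_G_diff[OF assms(1)] assms(2-4)])

text \<open>\<open>V' + Gam (c t) c' (V t)\<close> is the covariant derivative of \<open>V\<close>
  along the curve. In this form the derivative of the metric is absorbed, and for parallel fields
  the right-hand side vanishes.\<close>

lemma ip_deriv_cov:
  assumes "c t \<in> U" "(c has_vector_derivative c') (at t within S)"
    "(V has_vector_derivative V') (at t within S)"
    "(W has_vector_derivative W') (at t within S)"
  shows "((\<lambda>t. ip (c t) (V t) (W t)) has_real_derivative
    ip (c t) (V' + Gam (c t) c' (V t)) (W t) + ip (c t) (V t) (W' + Gam (c t) c' (W t))) (at t within S)"
  by (rule DERIV_cong[OF ip_deriv[OF assms]]) (simp add: dG_Gam[OF assms(1)] ip_lin)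

lemma dG_deriv:
  assumes "c t \<in> U" "(c has_vector_derivative c') (at t within S)"
    "(V has_vector_derivative V') (at t within S)"
    "(W has_vector_derivative W') (at t within S)"
    "(Z has_vector_derivative Z') (at t within S)"
  shows "((\<lambda>t. dG (c t) (V t) (W t) (Z t)) has_real_derivative
    ddG (c t) c' (V t) (W t) (Z t) + dG (c t) V' (W t) (Z t) + dG (c t) (V t) W' (Z t)
     + dG (c t) (V t) (W t) Z') (at t within S)"
  unfolding ddG_def dG_def
  by (rule form3_along[of "\<lambda>l i j. partial l (\<lambda>y. G y $ i $ j)", OF smooth_partial_G_diff[OF assms(1)] assms(2-5)])

lemma cc_deriv:
  assumes "c t \<in> U" "(c has_vector_derivative c') (at t within S)"
    "(V has_vector_derivative V') (at t within S)"
    "(W has_vector_derivative W') (at t within S)"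
    "(Z has_vector_derivative Z') (at t within S)"
  shows "((\<lambda>t. cc (c t) (V t) (W t) (Z t)) has_real_derivative
    dcc (c t) c' (V t) (W t) (Z t) + cc (c t) V' (W t) (Z t) + cc (c t) (V t) W' (Z t)
     + cc (c t) (V t) (W t) Z') (at t within S)"
  unfolding cc_def dcc_def
  by (rule DERIV_cong[OF DERIV_cdivide[OF DERIV_diff[OF DERIV_add[OF dG_deriv[OF assms] dG_deriv[OF assms(1,2,4,3,5)]] dG_deriv[OF assms(1,2,5,3,4)]]]])
    (simp add: field_simps)

lemma Gam_deriv:
  assumes "c t \<in> U" "(c has_vector_derivative c') (at t within S)"
    "(V has_vector_derivative V') (at t within S)"
    "(W has_vector_derivative W') (at t within S)"
  shows "((\<lambda>t. Gam (c t) (V t) (W t)) has_vector_derivative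
    dGam (c t) c' (V t) (W t) + Gam (c t) V' (W t) + Gam (c t) (V t) W') (at t within S)"
  unfolding has_vector_derivative_vec_iff Gam_def dGam_def
  using form2_along[of "christoffel G _", OF smooth_on_differentiable[OF smooth_christoffel assms(1)] assms(2-4)]
  by simp

lemma line_vd: "((\<lambda>s. x + s *\<^sub>R v) has_vector_derivative v) (at s within S)"
  by (auto intro!: derivative_eq_intros)

lemma line_eventually:
  assumes "x \<in> U" shows "eventually (\<lambda>s::real. x + s *\<^sub>R u \<in> U) (nhds 0)"
  by (rule isCont_eventually_in[OF _ open_U]) (use assms in \<open>auto intro!: continuous_intros\<close>)

text \<open>Obtained by differentiating \<open>ip (Gam v w) z = cc v w z\<close> along a line, which avoids
  differentiating the inverse matrix.\<close>

lemma ip_dGam: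
  assumes "x \<in> U"
  shows "ip x (dGam x u v w) z = dcc x u v w z - dG x u (Gam x v w) z"
proof -
  let ?c = "\<lambda>s::real. x + s *\<^sub>R u"
  have c0: "?c 0 \<in> U" using assms by simp
  have k: "((\<lambda>s. v) has_vector_derivative 0) (at (0::real))" for v :: "real^'n" by simp
  have 1: "((\<lambda>s. ip (?c s) (Gam (?c s) v w) z) has_real_derivative
     dG x u (Gam x v w) z + ip x (dGam x u v w) z) (at 0)"
    by (rule DERIV_cong[OF ip_deriv[of ?c, OF c0 line_vd Gam_deriv[of ?c, OF c0 line_vd k k] k]])
      (simp add: ip_lin Gam_lin(3)[where c=0, simplified] Gam_lin(4)[where c=0, simplified])
  have 2: "((\<lambda>s. cc (?c s) v w z) has_real_derivative dcc x u v w z) (at 0)"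
    by (rule DERIV_cong[OF cc_deriv[of ?c, OF c0 line_vd k k k]])
      (simp add: cc_def dG_lin(4-6)[where c=0, simplified])
  have "((\<lambda>s. cc (?c s) v w z) has_real_derivative
     dG x u (Gam x v w) z + ip x (dGam x u v w) z) (at 0)"
    by (rule iffD1[OF DERIV_cong_ev[OF refl _ refl] 1]) (use line_eventually[OF assms, of u] in \<open>eventually_elim, auto simp: ip_Gam\<close>)
  from DERIV_unique[OF this 2] show ?thesis by simp
qed

text \<open>With variation field \<open>v\<close>, its derivative \<open>w\<close> and velocity
  \<open>p\<close>, the left-hand side is half the second derivative of the energy density for a
  variation linear in the parameter. The last bracket is the derivative of \<open>cc x v v p\<close>
  along a geodesic, so next to the index form it contributes only boundary terms after
  integration.\<close>

lemma second_variation_identity: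
  assumes "x \<in> U"
  shows "ddG x v v p p / 2 + 2 * dG x v w p + ip x w w =
    ip x (w + Gam x p v) (w + Gam x p v) - ip x (Riem x v p p) v
    + (dcc x p v v p + 2 * cc x w v p + cc x v v (- Gam x p p))"
proof -
  have g: "Gam x v p = Gam x p v" by (rule Gam_sym[OF assms])
  show ?thesis
    using ddG_sym(1)[OF assms, of v p p v] ddG_sym(1)[OF assms, of p v p v]  ddG_sym(2)[OF assms, of p v p v]
      ddG_sym(1)[OF assms, of v v p v]
      dG_sym[OF assms, of v "Gam x p p" v] dG_sym[OF assms, of p "Gam x p v" v] dG_sym[OF assms, of v w p]
      dG_sym[OF assms, of v p "Gam x p v"] dG_sym[OF assms, of "Gam x p v" p v] dG_sym[OF assms, of w p v]
      dG_sym[OF assms, of p v w] dG_sym[OF assms, of v "Gam x p v" p] dG_sym[OF assms, of v p w]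
      dG_sym[OF assms, of p w v]
      ip_sym[OF assms, of w "Gam x p v"]
    by (simp add: Riem_def ip_minus ip_lin ip_Gam[OF assms] ip_dGam[OF assms] g cc_def dcc_def dG_minus dG_lin
        field_simps)
qed

end

section \<open>Orthonormal frames, traces and the Ricci tensor\<close>

lemma linear_form1:
  fixes h :: "real^'n::finite \<Rightarrow> real"
  assumes "linear h" shows "h v = form1 (\<lambda>i. h (axis i 1)) v"
proof -
  have "h v = h (\<Sum>i\<in>UNIV. v $ i *\<^sub>R axis i 1)"
    by (simp add: basis_expansion flip: scalar_mult_eq_scaleR)
  then show ?thesis by (simp add: linear_sum[OF assms] linear_scale[OF assms] form1_def)
qed

context chart_metric
begin

definition onb :: "real^'n \<Rightarrow> ('n \<Rightarrow> real^'n) \<Rightarrow> bool" where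
  "onb x e \<longleftrightarrow> (\<forall>i j. ip x (e i) (e j) = (if i = j then 1 else 0))"

lemma ip_matrix: "ip x v w = (\<Sum>k\<in>UNIV. v $ k * (G x *v w) $ k)"
  by (simp add: ip_def form2_def form1_def matrix_vector_mult_def mult.commute)

text \<open>Orthonormality says that the matrix \<open>L\<close> of the functionals
  \<open>ip x (e i)\<close> is a left inverse of the matrix \<open>E\<close> with columns
  \<open>e i\<close>. For square matrices it is then a right inverse, which is the
  expansion.\<close>

lemma onb_expand:
  assumes "x \<in> U" "onb x e"
  shows "v = (\<Sum>i\<in>UNIV. ip x (e i) v *\<^sub>R e i)"
proof -
  define E :: "real^'n^'n" where "E = (\<chi> k i. e i $ k)"
  define L :: "real^'n^'n" where "L = (\<chi> i l. (G x *v e i) $ l)"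
  have sym: "(\<Sum>l\<in>UNIV. (G x *v e i) $ l * w $ l) = ip x (e i) w" for i w
    by (subst ip_sym[OF assms(1)], unfold ip_matrix, rule sum.cong[OF refl]) (rule mult.commute)
  have "L ** E = mat 1"
    using assms(2) by (simp add: vec_eq_iff matrix_matrix_mult_def L_def E_def sym mat_def onb_def)
  then have "E ** L = mat 1" by (simp add: matrix_left_right_inverse)
  then have "v = E *v (L *v v)" by (simp add: matrix_vector_mul_assoc)
  moreover have "(L *v v) $ i = ip x (e i) v" for i
    unfolding matrix_vector_mult_def[of L] by (simp add: L_def sym)
  ultimately have vk: "v $ k = (\<Sum>i\<in>UNIV. ip x (e i) v *\<^sub>R e i) $ k" for k
  proof -
    have "v $ k = (E *v (L *v v)) $ k" using \<open>v = E *v (L *v v)\<close> by (rule arg_cong)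
    also have "\<dots> = (\<Sum>i\<in>UNIV. e i $ k * (L *v v) $ i)"
      unfolding matrix_vector_mult_def[of E] by (simp add: E_def)
    finally show ?thesis using \<open>\<And>i. (L *v v) $ i = ip x (e i) v\<close> by (simp add: mult.commute)
  qed
  show ?thesis unfolding vec_eq_iff using vk ..
qed

text \<open>Ricci tensor and Laplacian are defined by traces in coordinates; here they become sums
  over an orthonormal frame, to which inequalities such as Cauchy-Schwarz apply termwise.\<close>

lemma onb_trace:
  assumes "x \<in> U" "onb x e" "linear L"
  shows "(\<Sum>i\<in>UNIV. ip x (L (e i)) (e i)) = (\<Sum>k\<in>UNIV. L (axis k 1) $ k)"
proof -
  have "(\<Sum>k\<in>UNIV. L (axis k 1) $ k) = (\<Sum>k\<in>UNIV. L (\<Sum>i\<in>UNIV. ip x (e i) (axis k 1) *\<^sub>R e i) $ k)"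
    by (subst onb_expand[OF assms(1,2), symmetric]) simp
  also have "\<dots> = (\<Sum>k\<in>UNIV. \<Sum>i\<in>UNIV. ip x (e i) (axis k 1) * L (e i) $ k)"
    by (simp add: linear_sum[OF assms(3)] linear_scale[OF assms(3)])
  also have "\<dots> = (\<Sum>i\<in>UNIV. ip x (\<Sum>k\<in>UNIV. L (e i) $ k *\<^sub>R axis k 1) (e i))"
    by (subst sum.swap) (simp add: ip_sum ip_lin ip_sym[OF assms(1), of "e _"] mult.commute)
  also have "\<dots> = (\<Sum>i\<in>UNIV. ip x (L (e i)) (e i))"
    by (simp add: basis_expansion flip: scalar_mult_eq_scaleR)
  finally show ?thesis ..
qed

lemma Riem_axis: "Riem x (axis i 1) (axis j 1) (axis k 1) $ l = curvature G l k i j x"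
proof -
  have "Gam x (axis i 1) v $ l = (\<Sum>s\<in>UNIV. christoffel G l i s x * v $ s)" for i v
    by (simp add: Gam_def form2_def form1_def[of _ v] mult.commute)
  then show ?thesis
    unfolding Riem_def curvature_def sum_subtractf
    by (simp add: dGam_def) (simp add: Gam_def)
qed

lemma ricci_trace: "(\<Sum>k\<in>UNIV. Riem x (axis k 1) v w $ k) = form2 (\<lambda>j k. ricci G j k x) v w"
proof -
  have l1: "linear (\<lambda>v. \<Sum>k\<in>UNIV. Riem x (axis k 1) v w $ k)" for w
    by (rule linearI)
      (simp_all add: Riem_def dGam_lin Gam_lin sum.distrib sum_subtractf sum_distrib_left algebra_simps)
  have l2: "linear (\<lambda>w. \<Sum>k\<in>UNIV. Riem x (axis k 1) v w $ k)" for v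
    by (rule linearI)
      (simp_all add: Riem_def dGam_lin Gam_lin sum.distrib sum_subtractf sum_distrib_left algebra_simps)
  have "(\<Sum>k\<in>UNIV. Riem x (axis k 1) v w $ k)
     = form1 (\<lambda>j. form1 (\<lambda>l. \<Sum>k\<in>UNIV. Riem x (axis k 1) (axis j 1) (axis l 1) $ k) w) v"
    by (subst linear_form1[OF l1], subst linear_form1[OF l2]) (rule refl)
  then show ?thesis by (simp add: Riem_axis ricci_def form2_def)
qed

text \<open>This removes the non-tensorial commutator of \<open>curvature_commutation\<close> when
  the trace is taken in \<open>trace_DZ\<close>.\<close>

lemma trace_commute:
  fixes A B :: "real^'n \<Rightarrow> real^'n"
  assumes "linear A" "linear B"
  shows "(\<Sum>k\<in>UNIV. A (B (axis k 1)) $ k) = (\<Sum>k\<in>UNIV. B (A (axis k 1)) $ k)"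
proof -
  have ex: "L v $ k = (\<Sum>l\<in>UNIV. v $ l * L (axis l 1) $ k)" if "linear L" for L :: "real^'n \<Rightarrow> real^'n" and v k
  proof -
    have "linear (\<lambda>v. L v $ k)"
      using that by (simp add: linear_iff)
    from linear_form1[OF this, of v] show ?thesis by (simp add: form1_def)
  qed
  show ?thesis
    by (subst ex[OF assms(1)], subst (2) ex[OF assms(2)], subst sum.swap) (simp add: mult.commute)
qed

end

subsection \<open>The Bochner inequality\<close>

locale chart_function = chart_metric U G
  for U :: "(real^'n::finite) set" and G :: "real^'n \<Rightarrow> real^'n^'n" +
  fixes F :: "real^'n \<Rightarrow> real"
  assumes smooth_F: "smooth_on U F"
begin

text \<open>The gradient of \<open>F\<close>: its differential with the index raised by the inverse
  metric.\<close>

definition X :: "real^'n \<Rightarrow> real^'n" where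
  "X x = (\<chi> k. \<Sum>l\<in>UNIV. matrix_inv (G x) $ k $ l * partial l F x)"
definition dF where "dF x u = form1 (\<lambda>l. partial l F x) u"

text \<open>\<open>N x u\<close> is \<open>\<nabla>\<^sub>u \<nabla>F\<close>, \<open>Z\<close> is \<open>\<nabla>\<^bsub>\<nabla>F\<^esub> \<nabla>F = \<nabla> |\<nabla>F|\<^sup>2 / 2\<close>, and \<open>DZ\<close> is its
  covariant derivative.\<close>

definition N where "N x u = dvec X x u + Gam x u (X x)"
definition Z where "Z x = N x (X x)"
text \<open>The coordinate derivative in direction \<open>v\<close> of \<open>N\<close> applied to a
  constant vector. It carries no Christoffel correction, whence the non-tensorial remainder in
  \<open>curvature_commutation\<close>.\<close>

definition dN where
  "dN x v u = ddvec X x v u + dGam x v u (X x) + Gam x u (dvec X x v)"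
definition dZ where "dZ x u = dN x u (X x) + N x (dvec X x u)"
definition DZ where "DZ x u = dZ x u + Gam x u (Z x)"

lemma smooth_X: "smooth_on U (\<lambda>x. X x $ k)"
  unfolding X_def vec_lambda_beta
  by (intro smooth_on_intros[OF open_U] smooth_on_matrix_inv[OF open_U smooth_G invertible_G]
        smooth_on_partial smooth_F finite_class.finite_UNIV)

lemmas X_diff = smooth_on_differentiable[OF smooth_X]
lemmas partial_X_diff = smooth_on_differentiable[OF smooth_on_partial[OF smooth_X]]

lemma G_X:
  assumes "x \<in> U" shows "G x *v X x = (\<chi> l. partial l F x)"
proof -
  have "X x = matrix_inv (G x) *v (\<chi> l. partial l F x)"
    by (simp add: X_def vec_eq_iff matrix_vector_mult_def)
  then show ?thesis
    by (simp add: matrix_vector_mul_assoc matrix_inv_works[OF invertible_G[OF assms]])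
qed

lemma ip_X: assumes "x \<in> U" shows "ip x (X x) w = dF x w"
  using ip_sym[OF assms, of "X x" w]
  by (simp add: ip_matrix[of x w] G_X[OF assms] dF_def form1_def)

lemma N_lin: "N x (u + v) = N x u + N x v" "N x (c *\<^sub>R u) = c *\<^sub>R N x u"
  by (simp_all add: N_def dvec_lin Gam_lin algebra_simps)

text \<open>Differentiating \<open>ip_X\<close> along the line in direction \<open>u\<close>, once
  covariantly and once in coordinates, identifies \<open>N\<close> with the Hessian without touching
  the inverse matrix in \<open>X\<close>.\<close>

lemma ip_N:
  assumes "x \<in> U"
  shows "ip x (N x u) w = form2 (\<lambda>i j. hessian G F i j x) u w"
proof -
  let ?c = "\<lambda>s::real. x + s *\<^sub>R u"
  have c0: "?c 0 \<in> U" using assms by simp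
  have k: "((\<lambda>s. w) has_vector_derivative 0) (at (0::real))" by simp
  have Xd: "((\<lambda>s. X (?c s)) has_vector_derivative dvec X x u) (at 0)"
    using dvec_along[of X ?c 0, OF X_diff[OF c0] line_vd] by simp
  have 1: "((\<lambda>s. ip (?c s) (X (?c s)) w) has_real_derivative
     ip x (N x u) w + ip x (X x) (Gam x u w)) (at 0)"
    by (rule DERIV_cong[OF ip_deriv_cov[of ?c, OF c0 line_vd Xd k]]) (simp add: N_def)
  have 2: "((\<lambda>s. dF (?c s) w) has_real_derivative form2 (\<lambda>i j. partial i (partial j F) x) u w) (at 0)"
    unfolding dF_def
    by (rule DERIV_cong[OF form1_deriv[OF deriv_along[of "partial _ F" ?c 0, OF
        smooth_on_differentiable[OF smooth_on_partial[OF smooth_F] c0] line_vd] k]])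
      (simp add: form1_lin form2_def, subst form1_swap, simp)
  have "((\<lambda>s. dF (?c s) w) has_real_derivative
     ip x (N x u) w + ip x (X x) (Gam x u w)) (at 0)"
    by (rule iffD1[OF DERIV_cong_ev[OF refl _ refl] 1])
      (use line_eventually[OF assms, of u] in \<open>eventually_elim, auto simp: ip_X\<close>)
  from DERIV_unique[OF this 2]
  have "ip x (N x u) w = form2 (\<lambda>i j. partial i (partial j F) x) u w - dF x (Gam x u w)"
    by (simp add: ip_X[OF assms])
  also have "dF x (Gam x u w) = form2 (\<lambda>i j. \<Sum>k\<in>UNIV. christoffel G k i j x * partial k F x) u w"
    unfolding dF_def form1_def[of _ "Gam x u w"] form2_coeff(5)
    by (simp add: Gam_def form2_coeff(3)[symmetric] mult.commute)
  finally show ?thesis by (simp add: hessian_def form2_coeff(2))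
qed

lemma N_sym: assumes "x \<in> U" shows "ip x (N x u) w = ip x (N x w) u"
proof -
  have "hessian G F i j x = hessian G F j i x" for i j
    using partial_commute[OF open_U assms, of F i j] smooth_F christoffel_sym[OF assms]
    unfolding hessian_def smooth_on_def by simp
  then show ?thesis
    unfolding ip_N[OF assms] by (subst form2_swap) presburger
qed

text \<open>The right-hand side is the Laplacian of \<open>F\<close>: contracting the Hessian with
  the inverse metric is taking the trace of the endomorphism obtained by raising an index.\<close>

lemma trace_N:
  assumes "x \<in> U"
  shows "(\<Sum>k\<in>UNIV. N x (axis k 1) $ k)
    = (\<Sum>i\<in>UNIV. \<Sum>j\<in>UNIV. matrix_inv (G x) $ i $ j * hessian G F i j x)"
proof -
  have "N x (axis k 1) $ k = (\<Sum>j\<in>UNIV. matrix_inv (G x) $ k $ j * hessian G F k j x)" for k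
  proof -
    have "(G x *v N x (axis k 1)) $ j = hessian G F k j x" for j
    proof -
      have "ip x (axis j 1) (N x (axis k 1)) = hessian G F k j x"
        by (subst ip_sym[OF assms]) (simp add: ip_N[OF assms])
      then show ?thesis
        by (simp add: ip_matrix axis_def if_distrib[of "\<lambda>a. a * _"] cong: if_cong)
    qed
    then have h: "G x *v N x (axis k 1) = (\<chi> j. hessian G F k j x)" by (simp add: vec_eq_iff)
    have "N x (axis k 1) = matrix_inv (G x) *v (G x *v N x (axis k 1))"
      by (simp add: matrix_vector_mul_assoc matrix_inv_works[OF invertible_G[OF assms]])
    then have "N x (axis k 1) $ k = (matrix_inv (G x) *v (\<chi> j. hessian G F k j x)) $ k"
      unfolding h by (rule arg_cong)
    then show ?thesis by (simp add: matrix_vector_mult_def)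
  qed
  then show ?thesis by simp
qed

lemma N_deriv:
  assumes "c t \<in> U" "(c has_vector_derivative c') (at t within S)" "(V has_vector_derivative V') (at t within S)"
  shows "((\<lambda>t. N (c t) (V t)) has_vector_derivative dN (c t) c' (V t) + N (c t) V') (at t within S)"
  unfolding N_def dN_def
  by (rule has_vector_derivative_eq_rhs[OF has_vector_derivative_add[OF
      ddvec_along[OF partial_X_diff[OF assms(1)] assms(2,3)]
      Gam_deriv[OF assms dvec_along[OF X_diff[OF assms(1)] assms(2)]]]]) simp

lemma Z_deriv:
  assumes "c t \<in> U" "(c has_vector_derivative c') (at t within S)"
  shows "((\<lambda>t. Z (c t)) has_vector_derivative dZ (c t) c') (at t within S)"
  unfolding Z_def dZ_def
  by (rule N_deriv[OF assms dvec_along[OF X_diff[OF assms(1)] assms(2)]])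

text \<open>The second differential of \<open>X\<close> is symmetric, so exchanging the two
  directions costs only the Christoffel terms that make up \<open>Riem\<close>. The last bracket is
  the commutator of the linear maps \<open>dvec X x\<close> and
  \<open>\<lambda>u. Gam x u (X x)\<close>; its trace is zero.\<close>

lemma curvature_commutation:
  assumes "x \<in> U"
  shows "DZ x u = dN x (X x) u + N x (N x u) + Riem x u (X x) (X x)
    + (Gam x (dvec X x u) (X x) - dvec X x (Gam x u (X x)))"
  using ddvec_sym[OF open_U assms smooth_X, where u=u and v="X x"]
    Gam_sym[OF assms, of "Gam x u (X x)" "X x"] Gam_sym[OF assms, of "dvec X x u" "X x"]
  by (simp add: DZ_def dZ_def dN_def Z_def N_def Riem_def dvec_lin Gam_lin algebra_simps)

text \<open>The Bochner formula: the left-hand side is half the Laplacian of the squared norm of the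
  gradient, and the first term on the right is the derivative of the Laplacian of \<open>F\<close>
  along the gradient.\<close>

lemma trace_DZ:
  assumes "x \<in> U" "onb x e"
  shows "(\<Sum>i\<in>UNIV. ip x (DZ x (e i)) (e i)) = (\<Sum>k\<in>UNIV. dN x (X x) (axis k 1) $ k)
     + (\<Sum>i\<in>UNIV. ip x (N x (e i)) (N x (e i))) + form2 (\<lambda>j k. ricci G j k x) (X x) (X x)"
proof -
  have lin: "linear (\<lambda>u. N x (N x u))" "linear (dvec X x)" "linear (\<lambda>u. Gam x u (X x))" "linear (DZ x)"
    by (simp_all add: linear_iff N_lin dvec_lin Gam_lin DZ_def dZ_def dN_def ddvec_lin dGam_lin algebra_simps)
  have "(\<Sum>i\<in>UNIV. ip x (DZ x (e i)) (e i)) = (\<Sum>k\<in>UNIV. DZ x (axis k 1) $ k)"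
    by (rule onb_trace[OF assms lin(4)])
  also have "\<dots> = (\<Sum>k\<in>UNIV. dN x (X x) (axis k 1) $ k) + (\<Sum>k\<in>UNIV. N x (N x (axis k 1)) $ k)
    + (\<Sum>k\<in>UNIV. Riem x (axis k 1) (X x) (X x) $ k)
    + ((\<Sum>k\<in>UNIV. Gam x (dvec X x (axis k 1)) (X x) $ k) - (\<Sum>k\<in>UNIV. dvec X x (Gam x (axis k 1) (X x)) $ k))"
    by (simp add: curvature_commutation[OF assms(1)] sum.distrib sum_subtractf)
  also have "(\<Sum>k\<in>UNIV. Gam x (dvec X x (axis k 1)) (X x) $ k) = (\<Sum>k\<in>UNIV. dvec X x (Gam x (axis k 1) (X x)) $ k)"
    by (rule trace_commute[OF lin(3,2)])
  also have "(\<Sum>k\<in>UNIV. N x (N x (axis k 1)) $ k) = (\<Sum>i\<in>UNIV. ip x (N x (N x (e i))) (e i))"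
    by (rule onb_trace[OF assms lin(1), symmetric])
  also have "\<dots> = (\<Sum>i\<in>UNIV. ip x (N x (e i)) (N x (e i)))"
    by (simp add: N_sym[OF assms(1), of "N x _"])
  finally show ?thesis by (simp add: ricci_trace)
qed

text \<open>The left-hand side is half the weighted Laplacian of u =
  \<open>ip y (X y) (X y)\<close>. The squared Hessian is at least (\<phi> + u)^2 / n. Its cross
  term 2 \<phi> u / n and the \<phi>' u from differentiating the equation add up to something
  nonnegative by the hypothesis on \<phi>, and u^2 / n remains.\<close>

lemma bochner_inequality:
  fixes \<phi> :: "real \<Rightarrow> real"
  assumes y: "y \<in> U" "onb y e" and m: "0 < m"
    and lap: "\<And>x. x \<in> U \<Longrightarrow>
      (\<Sum>i\<in>UNIV. \<Sum>j\<in>UNIV. matrix_inv (G x) $ i $ j * hessian G F i j x) - ip x (X x) (X x) = \<phi> (F x)"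
    and ric: "form2 (\<lambda>i j. ricci G i j y + hessian G F i j y - 1/m * (partial i F y * partial j F y)) (X y) (X y) \<ge> 0"
    and phi: "\<phi> differentiable (at (F y))" "deriv \<phi> (F y) + 2 / real CARD('n) * \<phi> (F y) \<ge> 0"
  shows "(\<Sum>i\<in>UNIV. ip y (DZ y (e i)) (e i)) - ip y (Z y) (X y) \<ge> (ip y (X y) (X y))\<^sup>2 / CARD('n)"
proof -
  let ?n = "real CARD('n)" and ?u = "ip y (X y) (X y)" and ?\<phi> = "\<phi> (F y)"
  let ?c = "\<lambda>s::real. y + s *\<^sub>R X y"
  have c0: "?c 0 \<in> U" using y by simp
  have k: "((\<lambda>s. w) has_vector_derivative 0) (at (0::real))" for w :: "real^'n" by simp
  have Xd: "((\<lambda>s. X (?c s)) has_vector_derivative dvec X y (X y)) (at 0)"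
    using dvec_along[of X ?c 0, OF X_diff[OF c0] line_vd] by simp
  have 1: "((\<lambda>s. \<Sum>k\<in>UNIV. N (?c s) (axis k 1) $ k) has_real_derivative (\<Sum>k\<in>UNIV. dN y (X y) (axis k 1) $ k)) (at 0)"
  proof (rule DERIV_sum)
    fix k
    show "((\<lambda>s. N (?c s) (axis k 1) $ k) has_real_derivative dN y (X y) (axis k 1) $ k) (at 0)"
      using N_deriv[of ?c 0, OF c0 line_vd k, of "axis k 1"] N_lin(2)[where c=0]
      by (simp add: has_vector_derivative_vec_iff)
  qed
  have Fd: "((\<lambda>s. F (?c s)) has_real_derivative ?u) (at 0)"
    by (rule DERIV_cong[OF deriv_along[of F ?c 0, OF smooth_on_differentiable[OF smooth_F c0] line_vd]])
      (simp add: ip_X[OF y(1)] dF_def)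
  have "(\<phi> has_real_derivative deriv \<phi> (F y)) (at (F (?c 0)))"
    using phi(1) by (simp add: DERIV_deriv_iff_real_differentiable)
  note ch = DERIV_chain2[OF this Fd]
  have 2: "((\<lambda>s. \<phi> (F (?c s)) + ip (?c s) (X (?c s)) (X (?c s))) has_real_derivative
      deriv \<phi> (F y) * ?u + 2 * ip y (Z y) (X y)) (at 0)"
    by (rule DERIV_cong[OF DERIV_add[OF ch ip_deriv_cov[of ?c, OF c0 line_vd Xd Xd]]])
      (simp add: Z_def N_def ip_sym[OF y(1), of "X y" "_ + _"])
  \<comment> \<open>The equation holds in a neighbourhood of \<open>y\<close>, so its two sides have
    the same derivative along the gradient.\<close>
  have ev: "eventually (\<lambda>s. (\<Sum>k\<in>UNIV. N (?c s) (axis k 1) $ k) = \<phi> (F (?c s)) + ip (?c s) (X (?c s)) (X (?c s))) (nhds 0)"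
    using line_eventually[OF y(1), of "X y"]
    by eventually_elim (simp add: trace_N lap[symmetric])
  have div: "(\<Sum>k\<in>UNIV. dN y (X y) (axis k 1) $ k) = deriv \<phi> (F y) * ?u + 2 * ip y (Z y) (X y)"
    by (rule DERIV_unique[OF iffD1[OF DERIV_cong_ev[OF refl ev refl] 1] 2])
  have tr: "(\<Sum>i\<in>UNIV. ip y (N y (e i)) (e i)) = ?\<phi> + ?u"
    using onb_trace[OF y, of "N y"] lap[OF y(1)] by (simp add: linear_iff N_lin trace_N[OF y(1)])
  \<comment> \<open>Only the diagonal of the Hessian is kept: its sum is the Laplacian, and
    \<open>ip_CS_unit\<close> bounds its entries by the norms of the
    \<open>N y (e i)\<close>.\<close>
  have "(?\<phi> + ?u)\<^sup>2 \<le> ?n * (\<Sum>i\<in>UNIV. (ip y (N y (e i)) (e i))\<^sup>2)"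
    unfolding tr[symmetric]
    using Cauchy_Schwarz_ineq_sum[of "\<lambda>i. 1" "\<lambda>i. ip y (N y (e i)) (e i)" UNIV] by simp
  also have "\<dots> \<le> ?n * (\<Sum>i\<in>UNIV. ip y (N y (e i)) (N y (e i)))"
    using y(2) by (intro mult_left_mono sum_mono ip_CS_unit[OF y(1)]) (auto simp: onb_def)
  finally have NN: "(\<Sum>i\<in>UNIV. ip y (N y (e i)) (N y (e i))) \<ge> (?\<phi> + ?u)\<^sup>2 / ?n"
    by (simp add: divide_le_eq mult.commute)
  have "form2 (\<lambda>i j. partial i F y * partial j F y) (X y) (X y) = ?u\<^sup>2"
    using form1_lin(6)[of "form1 (\<lambda>l. partial l F y) (X y)" "\<lambda>l. partial l F y" "X y"]
    by (simp add: ip_X[OF y(1)] dF_def form2_def form1_lin power2_eq_square mult.commute)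
  with ric have R: "form2 (\<lambda>j k. ricci G j k y) (X y) (X y) \<ge> ?u\<^sup>2 / m - ip y (Z y) (X y)"
    by (simp add: form2_coeff ip_N[OF y(1)] Z_def)
  have u0: "?u \<ge> 0" by (rule ip_nonneg[OF y(1)])
  have um: "?u\<^sup>2 / m \<ge> 0" using m by simp
  have "?u * (deriv \<phi> (F y) + 2 / ?n * ?\<phi>) \<ge> 0" using u0 phi(2) by simp
  then have p: "deriv \<phi> (F y) * ?u + (2 * ?\<phi> * ?u) / ?n \<ge> 0" by (simp add: algebra_simps)
  have sq: "(?\<phi> + ?u)\<^sup>2 / ?n = ?\<phi>\<^sup>2 / ?n + (2 * ?\<phi> * ?u) / ?n + ?u\<^sup>2 / ?n"
    by (simp add: power2_sum add_divide_distrib)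
  have "?\<phi>\<^sup>2 / ?n \<ge> 0" by simp
  then show ?thesis
    using trace_DZ[OF y] div NN R p sq um by linarith
qed

lemma norm_X_deriv:
  assumes "c t \<in> U" "(c has_vector_derivative c') (at t within S)"
  shows "((\<lambda>t. ip (c t) (X (c t)) (X (c t))) has_real_derivative 2 * ip (c t) (Z (c t)) c') (at t within S)"
proof (rule DERIV_cong[OF ip_deriv_cov[OF assms]])
  show Xd: "((\<lambda>t. X (c t)) has_vector_derivative dvec X (c t) c') (at t within S)"
    "((\<lambda>t. X (c t)) has_vector_derivative dvec X (c t) c') (at t within S)"
    by (rule dvec_along[OF X_diff[OF assms(1)] assms(2)])+
  show "ip (c t) (dvec X (c t) c' + Gam (c t) c' (X (c t))) (X (c t)) +
    ip (c t) (X (c t)) (dvec X (c t) c' + Gam (c t) c' (X (c t))) = 2 * ip (c t) (Z (c t)) c'"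
    using N_sym[OF assms(1), of c' "X (c t)"] ip_sym[OF assms(1), of "X (c t)"]
    by (simp add: Z_def N_def)
qed

text \<open>The covariant acceleration has to vanish at \<open>t\<close> alone, so a quadratic path
  with the right second-order coefficient can take the place of a geodesic.\<close>

lemma norm_X_deriv2:
  assumes "c t \<in> U" "(c has_vector_derivative c' t) (at t within S)"
    "(c' has_vector_derivative - Gam (c t) (c' t) (c' t)) (at t within S)"
  shows "((\<lambda>t. 2 * ip (c t) (Z (c t)) (c' t)) has_real_derivative 2 * ip (c t) (DZ (c t) (c' t)) (c' t)) (at t within S)"
  by (rule DERIV_cong[OF DERIV_cmult[OF ip_deriv_cov[OF assms(1,2) Z_deriv[OF assms(1,2)] assms(3)]]])
    (simp add: DZ_def ip_lin)

end

section \<open>Linear ordinary differential equations\<close>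

text \<open>Banach's fixed point theorem for the integral operator, which is a contraction because
  \<open>K * (b - a) < 1\<close>. Longer intervals are reached by chaining short ones.\<close>

lemma linear_ode_solution:
  fixes M :: "real \<Rightarrow> 'a::euclidean_space \<Rightarrow> 'a" and e :: 'a
  assumes ab: "a \<le> b" and lin: "\<And>t. t \<in> {a..b} \<Longrightarrow> linear (M t)"
    and bound: "\<And>t v. t \<in> {a..b} \<Longrightarrow> norm (M t v) \<le> K * norm v" and K: "K * (b - a) < 1" "0 \<le> K"
    and cont: "\<And>Y. continuous_on {a..b} Y \<Longrightarrow> continuous_on {a..b} (\<lambda>t. M t (Y t))"
  obtains Y where "Y a = e" "\<And>t. t \<in> {a..b} \<Longrightarrow> (Y has_vector_derivative M t (Y t)) (at t within {a..b})"
proof -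
  define \<Phi> where "\<Phi> Y t = e + integral {a..t} (\<lambda>s. M s (Y s))" for Y t
  have der: "(\<Phi> Y has_vector_derivative M t (Y t)) (at t within {a..b})"
    if "continuous_on {a..b} Y" "t \<in> {a..b}" for Y t
    unfolding \<Phi>_def using integral_has_vector_derivative[OF cont[OF that(1)] that(2)]
    by (auto intro!: derivative_eq_intros)
  have cont\<Phi>: "continuous_on (cbox a b) (\<Phi> Y)" if "continuous_on {a..b} Y" for Y
    using continuous_on_vector_derivative[OF der[OF that]] by simp
  \<comment> \<open>Bounded continuous functions live on the whole line, so the integral operator is
    extended by clamping its argument to \<open>{a..b}\<close>.\<close>
  have "\<exists>g :: real \<Rightarrow>\<^sub>C 'a. \<forall>t. g t = \<Phi> Y (clamp a b t)" if "continuous_on {a..b} Y" for Y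
    using continuous_on_cbox_bcontfunE[OF cont\<Phi>[OF that]] by metis
  then have "\<forall>y :: real \<Rightarrow>\<^sub>C 'a. \<exists>g :: real \<Rightarrow>\<^sub>C 'a. \<forall>t. g t = \<Phi> y (clamp a b t)"
    by simp
  then obtain T :: "(real \<Rightarrow>\<^sub>C 'a) \<Rightarrow> (real \<Rightarrow>\<^sub>C 'a)" where T: "T y t = \<Phi> y (clamp a b t)" for y t
    using choice by metis
  have "dist (T y) (T z) \<le> K * (b - a) * dist y z" for y z
  proof (rule dist_bound)
    fix t
    define s where "s = clamp a b t"
    have s: "s \<in> {a..b}" using clamp_in_interval[of a b t] ab by (simp add: s_def)
    then have sub: "{a..s} \<subseteq> {a..b}" by auto
    have int: "(\<lambda>r. M r (apply_bcontfun w r)) integrable_on {a..s}" for w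
      by (rule integrable_continuous_real, rule continuous_on_subset[OF cont sub]) simp
    have "dist (T y t) (T z t) = norm (integral {a..s} (\<lambda>r. M r (y r)) - integral {a..s} (\<lambda>r. M r (z r)))"
      by (simp add: T s_def[symmetric] \<Phi>_def dist_norm)
    also have "\<dots> = norm (integral {a..s} (\<lambda>r. M r (y r) - M r (z r)))"
      by (simp add: integral_diff int)
    also have "\<dots> \<le> K * dist y z * (s - a)"
    proof (rule integral_bound)
      show "continuous_on {a..s} (\<lambda>r. M r (y r) - M r (z r))"
        by (intro continuous_on_diff continuous_on_subset[OF cont sub]) simp_all
      show "norm (M r (y r) - M r (z r)) \<le> K * dist y z" if "r \<in> {a..s}" for r
      proof -
        have r: "r \<in> {a..b}" using that sub by auto
        have "norm (M r (y r) - M r (z r)) = norm (M r (y r - z r))"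
          by (simp add: linear_diff[OF lin[OF r]])
        also have "\<dots> \<le> K * norm (y r - z r)" by (rule bound[OF r])
        also have "\<dots> \<le> K * dist y z"
          using dist_bounded[of y r z] K(2) by (simp add: dist_norm mult_left_mono)
        finally show ?thesis .
      qed
    qed (use s in auto)
    also have "\<dots> \<le> K * dist y z * (b - a)"
      using s K(2) by (intro mult_left_mono) auto
    finally show "dist (T y t) (T z t) \<le> K * (b - a) * dist y z" by (simp add: mult_ac)
  qed
  then have "\<exists>!y. T y = y"
    using K ab by (intro banach_fix_type[of "K * (b - a)" T]) simp_all
  then obtain y where y: "T y = y" by blast
  have eq: "y t = \<Phi> y t" if "t \<in> {a..b}" for t
    using T[of y t] that by (simp add: y)
  show ?thesis
  proof (rule that[of y])
    show "y a = e" using eq[of a] ab by (simp add: \<Phi>_def)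
    show "(y has_vector_derivative M t (y t)) (at t within {a..b})" if "t \<in> {a..b}" for t
      using der[of y t] that by (auto intro!: has_vector_derivative_transform[OF that eq])
  qed
qed

section \<open>The second variation of energy\<close>

text \<open>The compact image of \<open>x\<close> has balls of one common radius inside
  \<open>U\<close>. The factor \<open>l\<close> stands for the weight (t - a) / (b - a) with which
  \<open>R\<close> enters the variation below.\<close>

lemma interval_perturbation:
  fixes x :: "real \<Rightarrow> 'a::euclidean_space" and V :: "real \<Rightarrow> 'a" and R :: "real \<Rightarrow> 'a"
  assumes "continuous_on {a..b} x" "x ` {a..b} \<subseteq> U" "open U" "continuous_on {a..b} V"
    "continuous (at 0) R" "R 0 = 0" "0 < \<eta>"
  obtains \<delta> where "0 < \<delta>" "\<delta> < \<eta>"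
    "\<And>s t l. \<bar>s\<bar> \<le> \<delta> \<Longrightarrow> t \<in> {a..b} \<Longrightarrow> \<bar>l\<bar> \<le> 1 \<Longrightarrow> x t + s *\<^sub>R V t + l *\<^sub>R R s \<in> U"
proof (cases "{a..b} = {}")
  case True
  show ?thesis by (rule that[of "\<eta>/2"]) (use True assms(7) in auto)
next
  case False
  obtain \<epsilon> where \<epsilon>: "\<epsilon> > 0" "(\<Union>y\<in>x ` {a..b}. ball y \<epsilon>) \<subseteq> U"
    using compact_subset_open_imp_ball_epsilon_subset[of "x ` {a..b}" U]
      compact_continuous_image[OF assms(1)] assms(2,3) by auto
  obtain B where B: "\<And>t. t \<in> {a..b} \<Longrightarrow> norm (V t) \<le> B"
    using compact_imp_bounded[OF compact_continuous_image[OF assms(4) compact_Icc]]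
    unfolding bounded_iff by (metis imageI)
  have B0: "0 \<le> B" using False B order_trans[OF norm_ge_zero] by blast
  obtain \<delta>1 where \<delta>1: "\<delta>1 > 0" "\<And>s. \<bar>s\<bar> < \<delta>1 \<Longrightarrow> norm (R s) < \<epsilon> / 2"
    using assms(5,6) \<epsilon>(1) unfolding continuous_at_eps_delta
    by (metis dist_0_norm dist_commute half_gt_zero real_norm_def)
  \<comment> \<open>The first bound keeps \<open>R s\<close> below \<epsilon> / 2, the third keeps
    \<open>s *\<^sub>R V t\<close> within \<epsilon> / 4.\<close>
  define \<delta> where "\<delta> = min (min (\<delta>1/2) (\<eta>/2)) (\<epsilon> / (4 * (B + 1)))"
  show ?thesis
  proof (rule that[of \<delta>])
    show "0 < \<delta>" using \<delta>1 \<epsilon> assms(7) B0 by (simp add: \<delta>_def)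
    show "\<delta> < \<eta>" using assms(7) by (simp add: \<delta>_def)
    fix s t l assume st: "\<bar>s\<bar> \<le> \<delta>" "t \<in> {a..b}" "\<bar>l\<bar> \<le> (1::real)"
    have "norm (s *\<^sub>R V t + l *\<^sub>R R s) \<le> \<bar>s\<bar> * norm (V t) + \<bar>l\<bar> * norm (R s)"
      by (rule order_trans[OF norm_triangle_ineq]) simp
    also have "\<dots> \<le> \<epsilon> / (4 * (B + 1)) * (B + 1) + 1 * norm (R s)"
      using st B[OF st(2)] B0 \<epsilon> by (intro add_mono mult_mono) (auto simp: \<delta>_def)
    also have "\<epsilon> / (4 * (B + 1)) * (B + 1) = \<epsilon> / 4" using B0 by (simp add: field_simps)
    also have "\<epsilon> / 4 + 1 * norm (R s) < \<epsilon>"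
      using \<delta>1(2)[of s] st \<delta>1(1) \<epsilon>(1) by (simp add: \<delta>_def)
    finally have "x t + s *\<^sub>R V t + l *\<^sub>R R s \<in> ball (x t) \<epsilon>"
      by (subst mem_ball, subst dist_commute) (simp add: dist_norm add.assoc)
    then show "x t + s *\<^sub>R V t + l *\<^sub>R R s \<in> U" using \<epsilon>(2) st(2) by blast
  qed
qed

context chart_metric
begin

lemma continuous_on_coeff:
  assumes "smooth_on U H" "continuous_on S Y" "Y ` S \<subseteq> U"
  shows "continuous_on S (\<lambda>t. H (Y t))"
  by (rule continuous_on_compose2[OF smooth_on_continuous[OF assms(1)] assms(2,3)])

lemma continuous_on_ip:
  assumes "continuous_on S Y" "Y ` S \<subseteq> U" "continuous_on S V" "continuous_on S W"
  shows "continuous_on S (\<lambda>t. ip (Y t) (V t) (W t))"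
  unfolding ip_def by (intro continuous_on_form2 continuous_on_coeff[OF smooth_G] assms)

lemma continuous_on_dG:
  assumes "continuous_on S Y" "Y ` S \<subseteq> U" "continuous_on S V" "continuous_on S W" "continuous_on S Z"
  shows "continuous_on S (\<lambda>t. dG (Y t) (V t) (W t) (Z t))"
  unfolding dG_def by (intro continuous_on_form3 continuous_on_coeff[OF smooth_on_partial[OF smooth_G]] assms)

lemma continuous_on_ddG:
  assumes "continuous_on S Y" "Y ` S \<subseteq> U" "continuous_on S V" "continuous_on S W" "continuous_on S Z"
    "continuous_on S T"
  shows "continuous_on S (\<lambda>t. ddG (Y t) (V t) (W t) (Z t) (T t))"
  unfolding ddG_def
  by (intro continuous_on_form4 continuous_on_coeff[OF smooth_on_partial[OF smooth_on_partial[OF smooth_G]]] assms)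

lemma continuous_on_Gam:
  assumes "continuous_on S Y" "Y ` S \<subseteq> U" "continuous_on S V" "continuous_on S W"
  shows "continuous_on S (\<lambda>t. Gam (Y t) (V t) (W t))"
  unfolding Gam_def
  by (intro continuous_on_vec_lambda continuous_on_form2 continuous_on_coeff[OF smooth_christoffel] assms)

lemma continuous_on_dGam:
  assumes "continuous_on S Y" "Y ` S \<subseteq> U" "continuous_on S V" "continuous_on S W" "continuous_on S Z"
  shows "continuous_on S (\<lambda>t. dGam (Y t) (V t) (W t) (Z t))"
  unfolding dGam_def
  by (intro continuous_on_vec_lambda continuous_on_form3
      continuous_on_coeff[OF smooth_on_partial[OF smooth_christoffel]] assms)

lemma continuous_on_Riem:
  assumes "continuous_on S Y" "Y ` S \<subseteq> U" "continuous_on S V" "continuous_on S W" "continuous_on S Z"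
  shows "continuous_on S (\<lambda>t. Riem (Y t) (V t) (W t) (Z t))"
  unfolding Riem_def
  by (intro continuous_intros continuous_on_Gam continuous_on_dGam assms)

text \<open>At \<open>a\<close> the varied curves start on the coordinate line with direction
  \<open>V a\<close>; at \<open>b\<close> the remainder \<open>R\<close> lets them end on any
  prescribed path with velocity \<open>V b\<close>, as is required for attaching pieces and for
  choosing the final path. Since \<open>R\<close> vanishes to first order, it enters through
  \<open>R2 0\<close> only, in the boundary term at \<open>b\<close>.\<close>

lemma second_variation:
  fixes x V p w :: "real \<Rightarrow> real^'n" and R R1 R2 :: "real \<Rightarrow> real^'n"
  assumes ab: "a < b"
    and x: "\<And>t. t \<in> {a..b} \<Longrightarrow> (x has_vector_derivative p t) (at t within {a..b})"
    and xU: "x ` {a..b} \<subseteq> U"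
    and p: "\<And>t. t \<in> {a..b} \<Longrightarrow> (p has_vector_derivative - Gam (x t) (p t) (p t)) (at t within {a..b})"
    and V: "\<And>t. t \<in> {a..b} \<Longrightarrow> (V has_vector_derivative w t) (at t within {a..b})"
    and w: "continuous_on {a..b} w"
    and \<eta>: "0 < \<eta>"
    and R: "\<And>s. \<bar>s\<bar> < \<eta> \<Longrightarrow> (R has_vector_derivative R1 s) (at s)"
      "\<And>s. \<bar>s\<bar> < \<eta> \<Longrightarrow> (R1 has_vector_derivative R2 s) (at s)"
      "continuous_on {-\<eta><..<\<eta>} R2"
    and R0: "R 0 = 0" "R1 0 = 0"
  defines "c \<equiv> 1 / (b - a)"
  defines "y \<equiv> \<lambda>s t. x t + s *\<^sub>R V t + ((t - a) * c) *\<^sub>R R s"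
    and "z \<equiv> \<lambda>s t. p t + s *\<^sub>R w t + c *\<^sub>R R s"
  obtains \<delta> e1 where "0 < \<delta>" "\<delta> < \<eta>"
    "\<And>s t. \<bar>s\<bar> \<le> \<delta> \<Longrightarrow> t \<in> {a..b} \<Longrightarrow> y s t \<in> U"
    "\<And>s. \<bar>s\<bar> < \<delta> \<Longrightarrow> ((\<lambda>s. integral {a..b} (\<lambda>t. ip (y s t) (z s t) (z s t))) has_real_derivative e1 s) (at s)"
    "e1 0 = 2 * (ip (x b) (V b) (p b) - ip (x a) (V a) (p a))"
    "(e1 has_real_derivative 2 * (integral {a..b} (\<lambda>t. ip (x t) (w t + Gam (x t) (p t) (V t)) (w t + Gam (x t) (p t) (V t))
         - ip (x t) (Riem (x t) (V t) (p t) (p t)) (V t))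
       + (ip (x b) (R2 0 + Gam (x b) (V b) (V b)) (p b) - ip (x a) (Gam (x a) (V a) (V a)) (p a)))) (at 0)"
proof -
  have xc: "continuous_on {a..b} x" and pc: "continuous_on {a..b} p" and Vc: "continuous_on {a..b} V"
    using continuous_on_vector_derivative[OF x] continuous_on_vector_derivative[OF p] continuous_on_vector_derivative[OF V] by auto
  have Rc0: "continuous (at 0) R" using R(1)[of 0] \<eta> by (simp add: has_vector_derivative_continuous)
  obtain \<delta> where \<delta>: "0 < \<delta>" "\<delta> < \<eta>"
    and pert: "\<And>s t l. \<bar>s\<bar> \<le> \<delta> \<Longrightarrow> t \<in> {a..b} \<Longrightarrow> \<bar>l\<bar> \<le> 1 \<Longrightarrow> x t + s *\<^sub>R V t + l *\<^sub>R R s \<in> U"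
    using interval_perturbation[OF xc xU open_U Vc Rc0 R0(1) \<eta>] by blast
  have yU: "y s t \<in> U" if "\<bar>s\<bar> \<le> \<delta>" "t \<in> {a..b}" for s t
    unfolding y_def using that ab by (intro pert) (auto simp: c_def field_simps abs_le_iff)
  let ?I = "{-\<delta>..\<delta>}"
  let ?D = "?I \<times> {a..b}"
  define ys where "ys s t = V t + ((t - a) * c) *\<^sub>R R1 s" for s t
  define zs where "zs s t = w t + c *\<^sub>R R1 s" for s t
  define yss where "yss s t = ((t - a) * c) *\<^sub>R R2 s" for s t :: real
  define zss where "zss s t = c *\<^sub>R R2 s" for s t :: real
  have R': "(R has_vector_derivative R1 s) (at s within A)" "(R1 has_vector_derivative R2 s) (at s within A)"
    if "s \<in> ?I" for s A
  proof -
    have "\<bar>s\<bar> < \<eta>" using that \<delta>(2) by auto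
    from R(1,2)[OF this] show "(R has_vector_derivative R1 s) (at s within A)"
      "(R1 has_vector_derivative R2 s) (at s within A)"
      by (auto intro: has_vector_derivative_at_within)
  qed
  have dy: "((\<lambda>s. y s t) has_vector_derivative ys s t) (at s within ?I)"
    and dz: "((\<lambda>s. z s t) has_vector_derivative zs s t) (at s within ?I)"
    and dys: "((\<lambda>s. ys s t) has_vector_derivative yss s t) (at s within ?I)"
    and dzs: "((\<lambda>s. zs s t) has_vector_derivative zss s t) (at s within ?I)" if "s \<in> ?I" for s t
    unfolding y_def z_def ys_def zs_def yss_def zss_def
    by (auto intro!: derivative_eq_intros R'[OF that])
  have Rc: "continuous_on ?I R" "continuous_on ?I R1"
    by (rule continuous_on_vector_derivative, erule R')+
  have R2c: "continuous_on ?I R2" by (rule continuous_on_subset[OF R(3)]) (use \<delta> in auto)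
  have c1: "continuous_on ?D (\<lambda>q. h (fst q))" if "continuous_on ?I h" for h :: "real \<Rightarrow> real^'n"
    by (rule continuous_on_compose2[OF that continuous_on_fst[OF continuous_on_id]]) auto
  have c2: "continuous_on ?D (\<lambda>q. h (snd q))" if "continuous_on {a..b} h" for h :: "real \<Rightarrow> real^'n"
    by (rule continuous_on_compose2[OF that continuous_on_snd[OF continuous_on_id]]) auto
  have cy: "continuous_on ?D (\<lambda>q. y (fst q) (snd q))" "continuous_on ?D (\<lambda>q. z (fst q) (snd q))"
    "continuous_on ?D (\<lambda>q. ys (fst q) (snd q))" "continuous_on ?D (\<lambda>q. zs (fst q) (snd q))"
    "continuous_on ?D (\<lambda>q. yss (fst q) (snd q))" "continuous_on ?D (\<lambda>q. zss (fst q) (snd q))"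
    unfolding y_def z_def ys_def zs_def yss_def zss_def
    by (intro continuous_intros c1 c2 xc pc Vc w Rc R2c)+
  have yD: "(\<lambda>q. y (fst q) (snd q)) ` ?D \<subseteq> U" using yU by auto
  define q where "q s t = ip (y s t) (z s t) (z s t)" for s t
  define q1 where "q1 s t = dG (y s t) (ys s t) (z s t) (z s t) + 2 * ip (y s t) (zs s t) (z s t)" for s t
  define q2 where "q2 s t = ddG (y s t) (ys s t) (ys s t) (z s t) (z s t) + dG (y s t) (yss s t) (z s t) (z s t)
     + 4 * dG (y s t) (ys s t) (zs s t) (z s t) + 2 * ip (y s t) (zss s t) (z s t) + 2 * ip (y s t) (zs s t) (zs s t)" for s t
  have dq: "((\<lambda>s. q s t) has_real_derivative q1 s t) (at s within ?I)" if "s \<in> ?I" "t \<in> {a..b}" for s t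
    unfolding q_def q1_def
    by (rule DERIV_cong[OF ip_deriv[OF _ dy dz dz]])
      (use that yU in \<open>auto simp: ip_sym[of "y s t" "z s t" "zs s t"]\<close>)
  have dq1: "((\<lambda>s. q1 s t) has_real_derivative q2 s t) (at s within ?I)" if "s \<in> ?I" "t \<in> {a..b}" for s t
  proof -
    have U: "y s t \<in> U" using that yU by auto
    show ?thesis
      unfolding q1_def q2_def
      by (rule DERIV_cong[OF DERIV_add[OF dG_deriv[where c="\<lambda>s. y s t", OF U dy dys dz dz]
          DERIV_cmult[OF ip_deriv[where c="\<lambda>s. y s t", OF U dy dzs dz]]]])
        (use that dG_sym[OF U, of "ys s t" "z s t" "zs s t"] in \<open>auto simp: algebra_simps\<close>)
  qed
  have cq: "continuous_on ?D (\<lambda>(s,t). q s t)" "continuous_on ?D (\<lambda>(s,t). q1 s t)" "continuous_on ?D (\<lambda>(s,t). q2 s t)"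
    unfolding q_def q1_def q2_def case_prod_beta
    by (intro continuous_intros continuous_on_ip continuous_on_dG continuous_on_ddG cy yD)+
  have ct: "continuous_on {a..b} (\<lambda>t. h s t)" if "continuous_on ?D (\<lambda>(s,t). h s t)" "s \<in> ?I" for h :: "real \<Rightarrow> real \<Rightarrow> real" and s
  proof -
    have "continuous_on {a..b} (\<lambda>t. case (s,t) of (s,t) \<Rightarrow> h s t)"
      by (rule continuous_on_compose2[OF that(1), where f="\<lambda>t. (s,t)"]) (use that(2) in \<open>auto intro!: continuous_intros\<close>)
    then show ?thesis by simp
  qed
  define e1 where "e1 s = integral {a..b} (q1 s)" for s
  have int: "at s within ?I = at s" if "\<bar>s\<bar> < \<delta>" for s
    using that by (intro at_within_interior) (auto simp: abs_less_iff)
  have de: "((\<lambda>s. integral {a..b} (q s)) has_real_derivative e1 s) (at s)" if "\<bar>s\<bar> < \<delta>" for s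
  proof -
    have "((\<lambda>s. integral (cbox a b) (q s)) has_real_derivative integral (cbox a b) (q1 s)) (at s within ?I)"
    proof (rule leibniz_rule_field_derivative)
      show "q s integrable_on cbox a b" if "s \<in> ?I" for s
        using ct[OF cq(1) that] by (simp add: integrable_continuous_real)
    qed (use that dq cq in auto)
    then show ?thesis by (simp add: int[OF that] e1_def)
  qed
  have de1: "(e1 has_real_derivative integral {a..b} (q2 0)) (at 0)"
  proof -
    have "((\<lambda>s. integral (cbox a b) (q1 s)) has_real_derivative integral (cbox a b) (q2 0)) (at 0 within ?I)"
    proof (rule leibniz_rule_field_derivative)
      show "q1 s integrable_on cbox a b" if "s \<in> ?I" for s
        using ct[OF cq(2) that] by (simp add: integrable_continuous_real)
    qed (use \<delta> dq1 cq in auto)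
    then show ?thesis using int[of 0] \<delta> by (simp add: e1_def[abs_def])
  qed
  have at0: "y 0 t = x t" "z 0 t = p t" "ys 0 t = V t" "zs 0 t = w t" for t
    by (simp_all add: y_def z_def ys_def zs_def R0)
  have xt: "x t \<in> U" if "t \<in> {a..b}" for t using xU that by auto
  have "e1 0 = 2 * ip (x b) (V b) (p b) - 2 * ip (x a) (V a) (p a)"
    unfolding e1_def
  proof (rule integral_unique, rule fundamental_theorem_of_calculus)
    show "((\<lambda>t. 2 * ip (x t) (V t) (p t)) has_vector_derivative q1 0 t) (at t within {a..b})" if t: "t \<in> {a..b}" for t
      unfolding has_real_derivative_iff_has_vector_derivative[symmetric]
      by (rule DERIV_cong[OF DERIV_cmult[OF ip_deriv_cov[OF xt[OF t] x[OF t] V[OF t] p[OF t]]]])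
        (use dG_sym[OF xt[OF t], of "p t" "V t" "p t"] in
          \<open>simp add: q1_def at0 ip_lin ip_Gam[OF xt[OF t]] cc_def\<close>)
  qed (use ab in auto)
  then have e10: "e1 0 = 2 * (ip (x b) (V b) (p b) - ip (x a) (V a) (p a))" by simp
  \<comment> \<open>\<open>J\<close> is the density of the index form. By
    \<open>second_variation_identity\<close> the rest of half the second derivative is the
    derivative of \<open>H\<close>, whose second summand accounts for \<open>R\<close>.\<close>
  define J where "J t = ip (x t) (w t + Gam (x t) (p t) (V t)) (w t + Gam (x t) (p t) (V t))
         - ip (x t) (Riem (x t) (V t) (p t) (p t)) (V t)" for t
  define H where "H t = cc (x t) (V t) (V t) (p t) + ip (x t) (((t - a) * c) *\<^sub>R R2 0) (p t)" for t
  have "continuous_on {a..b} J"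
    unfolding J_def by (intro continuous_intros continuous_on_ip continuous_on_Gam continuous_on_Riem xc xU pc Vc w)
  then have J: "(J has_integral integral {a..b} J) {a..b}"
    by (simp add: integrable_continuous_real integrable_integral)
  have HJ: "((\<lambda>t. q2 0 t / 2 - J t) has_integral H b - H a) {a..b}"
  proof (rule fundamental_theorem_of_calculus)
    fix t assume t: "t \<in> {a..b}"
    note xt = xt[OF t]
    have l: "((\<lambda>t. ((t - a) * c) *\<^sub>R R2 0) has_vector_derivative c *\<^sub>R R2 0) (at t within {a..b})"
      by (auto intro!: derivative_eq_intros)
    have 1: "((\<lambda>t. cc (x t) (V t) (V t) (p t)) has_real_derivative
      dcc (x t) (p t) (V t) (V t) (p t) + 2 * cc (x t) (w t) (V t) (p t) + cc (x t) (V t) (V t) (- Gam (x t) (p t) (p t)))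
      (at t within {a..b})"
      by (rule DERIV_cong[OF cc_deriv[OF xt x[OF t] V[OF t] V[OF t] p[OF t]]])
        (use dG_sym[OF xt, of "p t" "w t" "V t"] in \<open>simp add: cc_def field_simps\<close>)
    have 2: "((\<lambda>t. ip (x t) (((t - a) * c) *\<^sub>R R2 0) (p t)) has_real_derivative
       ip (x t) (zss 0 t) (p t) + dG (x t) (yss 0 t) (p t) (p t) / 2) (at t within {a..b})"
      by (rule DERIV_cong[OF ip_deriv_cov[OF xt x[OF t] l p[OF t]]])
        (use dG_sym[OF xt, of "p t" "yss 0 t" "p t"] in
          \<open>simp add: yss_def zss_def ip_lin ip_Gam[OF xt] cc_def\<close>)
    show "(H has_vector_derivative q2 0 t / 2 - J t) (at t within {a..b})"
      unfolding has_real_derivative_iff_has_vector_derivative[symmetric] H_def[abs_def]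
      by (rule DERIV_cong[OF DERIV_add[OF 1 2]])
        (use second_variation_identity[OF xt, of "V t" "p t" "w t"] in \<open>simp add: q2_def at0 J_def field_simps\<close>)
  qed (use ab in simp)
  have "((\<lambda>t. 2 * (J t + (q2 0 t / 2 - J t))) has_integral 2 * (integral {a..b} J + (H b - H a))) {a..b}"
    by (rule has_integral_mult_right[OF has_integral_add[OF J HJ]])
  then have e2: "integral {a..b} (q2 0) = 2 * (integral {a..b} J + (H b - H a))"
    by (auto simp: integral_unique)
  have H: "H b = ip (x b) (R2 0 + Gam (x b) (V b) (V b)) (p b)" "H a = ip (x a) (Gam (x a) (V a) (V a)) (p a)"
    using ab xt[of a] xt[of b] by (auto simp: H_def c_def ip_lin ip_Gam)
  show ?thesis
    by (rule that[of \<delta> e1]) (use \<delta> yU de e10 de1[unfolded e2 H J_def[abs_def]] q_def[abs_def] in auto)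
qed

text \<open>By homogeneity in \<open>v\<close> it is enough to bound \<open>Gam\<close> on unit
  vectors, where the domain is compact.\<close>

lemma Gam_bound:
  fixes x p :: "real \<Rightarrow> real^'n"
  assumes "continuous_on {a..b} x" "x ` {a..b} \<subseteq> U" "continuous_on {a..b} p"
  obtains K where "0 \<le> K" "\<And>t v. t \<in> {a..b} \<Longrightarrow> norm (Gam (x t) (p t) v) \<le> K * norm v"
proof -
  let ?S = "{a..b} \<times> sphere (0::real^'n) 1"
  have "continuous_on ?S (\<lambda>q. Gam (x (fst q)) (p (fst q)) (snd q))"
  proof (rule continuous_on_Gam)
    show "continuous_on ?S (\<lambda>q. x (fst q))" "continuous_on ?S (\<lambda>q. p (fst q))"
      by (rule continuous_on_compose2[OF assms(1)] continuous_on_compose2[OF assms(3)];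
          auto intro!: continuous_intros)+
  qed (use assms(2) in \<open>auto intro!: continuous_intros\<close>)
  then have "compact ((\<lambda>q. Gam (x (fst q)) (p (fst q)) (snd q)) ` ?S)"
    by (intro compact_continuous_image compact_Times compact_Icc compact_sphere)
  from compact_imp_bounded[OF this]
  obtain K where K: "norm (Gam (x t) (p t) v) \<le> K" if "t \<in> {a..b}" "norm v = 1" for t v
    unfolding bounded_iff by fastforce
  show ?thesis
  proof (rule that[of "max K 0"])
    fix t v assume t: "t \<in> {a..b}"
    show "norm (Gam (x t) (p t) v) \<le> max K 0 * norm v"
    proof (cases "v = 0")
      case True
      then show ?thesis using Gam_lin(4)[of "x t" "p t" 0 0] by simp
    next
      case False
      have "norm (Gam (x t) (p t) (v /\<^sub>R norm v)) \<le> max K 0"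
        using K[OF t, of "v /\<^sub>R norm v"] False by simp
      then show ?thesis using False by (simp add: Gam_lin field_simps)
    qed
  qed simp
qed

text \<open>The step size \<open>d\<close> depends on neither the starting time nor the frame, so
  that steps can be chained. Orthonormality persists because inner products of parallel fields have
  derivative zero.\<close>

lemma parallel_frame:
  assumes xc: "continuous_on {\<alpha>..\<beta>} x" and xU: "x ` {\<alpha>..\<beta>} \<subseteq> U" and pc: "continuous_on {\<alpha>..\<beta>} p"
    and x: "\<And>t. t \<in> {\<alpha>..\<beta>} \<Longrightarrow> (x has_vector_derivative p t) (at t within {\<alpha>..\<beta>})"
  obtains d where "0 < d"
    "\<And>a b e. \<alpha> \<le> a \<Longrightarrow> a \<le> b \<Longrightarrow> b \<le> \<beta> \<Longrightarrow> b - a < d \<Longrightarrow> onb (x a) e \<Longrightarrow>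
      \<exists>E. (\<forall>i. E i a = e i) \<and> (\<forall>t\<in>{a..b}. onb (x t) (\<lambda>i. E i t)) \<and>
        (\<forall>i. \<forall>t\<in>{a..b}. (E i has_vector_derivative - Gam (x t) (p t) (E i t)) (at t within {a..b}))"
proof -
  obtain K where K: "0 \<le> K" "\<And>t v. t \<in> {\<alpha>..\<beta>} \<Longrightarrow> norm (Gam (x t) (p t) v) \<le> K * norm v"
    using Gam_bound[OF xc xU pc] by blast
  show ?thesis
  \<comment> \<open>At this length the contraction condition \<open>K * (b - a) < 1\<close> holds,
    also for \<open>K = 0\<close>.\<close>
  proof (rule that[of "1 / (K + 1)"])
    show "0 < 1 / (K + 1)" using K by simp
    fix a b e
    assume ab: "\<alpha> \<le> a" "a \<le> b" "b \<le> \<beta>" "b - a < 1 / (K + 1)" and e: "onb (x a) e"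
    have sub: "{a..b} \<subseteq> {\<alpha>..\<beta>}" using ab by auto
    have "(K + 1) * (b - a) < 1" using ab(4) K(1) by (simp add: field_simps)
    then have Kb: "K * (b - a) < 1" using ab by (simp add: algebra_simps)
    have "\<exists>Y. Y a = e i \<and> (\<forall>t\<in>{a..b}. (Y has_vector_derivative - Gam (x t) (p t) (Y t)) (at t within {a..b}))" for i
    proof (rule linear_ode_solution[OF ab(2) _ _ Kb K(1)])
      show "linear (\<lambda>v. - Gam (x t) (p t) v)" for t by (simp add: linear_iff Gam_lin)
      show "norm (- Gam (x t) (p t) v) \<le> K * norm v" if "t \<in> {a..b}" for t v
        using K(2) that sub by auto
      show "continuous_on {a..b} (\<lambda>t. - Gam (x t) (p t) (Y t))" if "continuous_on {a..b} Y" for Y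
        by (intro continuous_intros continuous_on_Gam continuous_on_subset[OF xc sub]
            continuous_on_subset[OF pc sub] that) (use xU sub in auto)
    qed blast
    then obtain E where E: "\<And>i. E i a = e i"
      "\<And>i t. t \<in> {a..b} \<Longrightarrow> (E i has_vector_derivative - Gam (x t) (p t) (E i t)) (at t within {a..b})"
      by metis
    have "ip (x t) (E i t) (E j t) = (if i = j then 1 else 0)" if t: "t \<in> {a..b}" for i j t
    proof -
      have "ip (x t) (E i t) (E j t) = ip (x a) (E i a) (E j a)"
      proof (rule has_derivative_zero_unique[of "{a..b}" "\<lambda>t. ip (x t) (E i t) (E j t)"])
        fix s assume s: "s \<in> {a..b}"
        have xs: "(x has_vector_derivative p s) (at s within {a..b})"
          using x sub s by (blast intro: has_vector_derivative_within_subset)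
        have "((\<lambda>t. ip (x t) (E i t) (E j t)) has_real_derivative 0) (at s within {a..b})"
          by (rule DERIV_cong[OF ip_deriv_cov[OF _ xs E(2)[OF s] E(2)[OF s]]]) (use xU s sub in \<open>auto simp: ip_lin\<close>)
        then show "((\<lambda>t. ip (x t) (E i t) (E j t)) has_derivative (\<lambda>h. 0)) (at s within {a..b})"
          by (simp add: has_field_derivative_def lambda_zero)
      qed (use t ab in auto)
      then show ?thesis using e by (simp add: E(1) onb_def)
    qed
    then show "\<exists>E. (\<forall>i. E i a = e i) \<and> (\<forall>t\<in>{a..b}. onb (x t) (\<lambda>i. E i t)) \<and>
        (\<forall>i. \<forall>t\<in>{a..b}. (E i has_vector_derivative - Gam (x t) (p t) (E i t)) (at t within {a..b}))"
      using E unfolding onb_def by (intro exI[of _ E]) auto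
  qed
qed

end

section \<open>Hadamard's lemma\<close>

text \<open>The weight \<open>t ^ k\<close> keeps the family closed under partial derivatives: each
  of them raises \<open>k\<close> by one, and the induction for smoothness runs on this.\<close>

definition ray_mean :: "real^'n::finite \<Rightarrow> nat \<Rightarrow> (real^'n \<Rightarrow> real) \<Rightarrow> real^'n \<Rightarrow> real" where
  "ray_mean x0 k F x = integral {0..1} (\<lambda>t. t ^ k * F (x0 + t *\<^sub>R (x - x0)))"

lemma ray_in_ball:
  fixes x x0 :: "'a::real_normed_vector"
  assumes "x \<in> ball x0 r" "t \<in> {0..1}" shows "x0 + t *\<^sub>R (x - x0) \<in> ball x0 r"
proof -
  have "norm (t *\<^sub>R (x - x0)) \<le> 1 * norm (x - x0)"
    unfolding norm_scaleR using assms(2) by (intro mult_right_mono) auto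
  then show ?thesis using assms(1) by (simp add: dist_norm norm_minus_commute)
qed

lemma ray_mean_derivative:
  fixes F :: "real^'n::finite \<Rightarrow> real"
  assumes F: "smooth_on (ball x0 r) F" and x: "x \<in> ball x0 r"
  shows "(ray_mean x0 k F has_derivative (\<lambda>v. \<Sum>i\<in>UNIV. v $ i * ray_mean x0 (Suc k) (partial i F) x)) (at x)"
proof -
  let ?B = "ball x0 r"
  let ?c = "\<lambda>i x t. t ^ Suc k * partial i F (x0 + t *\<^sub>R (x - x0))"
  \<comment> \<open>\<open>leibniz_rule\<close> expects the derivative as a bounded linear function,
    so it is written as a combination of the coordinate functionals.\<close>
  define E :: "'n \<Rightarrow> (real^'n) \<Rightarrow>\<^sub>L real" where "E i = Blinfun (\<lambda>v. v $ i)" for i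
  have E: "blinfun_apply (E i) v = v $ i" for i v
    unfolding E_def by (simp add: bounded_linear_Blinfun_apply bounded_linear_vec_nth)
  define fx where "fx x t = (\<Sum>i\<in>UNIV. ?c i x t *\<^sub>R E i)" for x t
  have app: "blinfun_apply (fx x t) v = (\<Sum>i\<in>UNIV. v $ i * ?c i x t)" for x t v
    unfolding fx_def by (simp add: blinfun.sum_left blinfun.scaleR_left E mult.commute)
  have contG: "continuous_on (?B \<times> cbox 0 1) (\<lambda>q. H (x0 + snd q *\<^sub>R (fst q - x0)))"
    if "smooth_on ?B H" for H :: "real^'n \<Rightarrow> real"
    by (rule continuous_on_compose2[OF smooth_on_continuous[OF that]])
      (auto simp del: mem_ball intro!: continuous_intros ray_in_ball)
  have cont: "continuous_on (?B \<times> cbox 0 1) (\<lambda>(x, t). fx x t)"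
    unfolding fx_def case_prod_beta
    by (intro continuous_intros contG smooth_on_partial F)
  have contt: "continuous_on (cbox 0 1) (\<lambda>t. H (x0 + t *\<^sub>R (y - x0)))"
    if "smooth_on ?B H" "y \<in> ?B" for H :: "real^'n \<Rightarrow> real" and y
    by (rule continuous_on_compose2[OF smooth_on_continuous[OF that(1)]])
      (use that in \<open>auto simp del: mem_ball intro!: continuous_intros ray_in_ball\<close>)
  have "((\<lambda>x. integral (cbox 0 1) (\<lambda>t. t ^ k * F (x0 + t *\<^sub>R (x - x0)))) has_derivative
      blinfun_apply (integral (cbox 0 1) (fx x))) (at x within ?B)"
  proof (rule leibniz_rule[OF _ _ cont x convex_ball])
    fix y t assume y: "y \<in> ?B" "t \<in> cbox (0::real) 1"
    have "F differentiable (at (x0 + t *\<^sub>R (y - x0)))"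
      using smooth_on_differentiable[OF F] ray_in_ball[OF y(1)] y(2) by auto
    note d = has_derivative_partial[OF this]
    have "((\<lambda>x. x0 + t *\<^sub>R (x - x0)) has_derivative (\<lambda>v. t *\<^sub>R v)) (at y within ?B)"
      by (auto intro!: derivative_eq_intros)
    from has_derivative_compose[OF this d]
    have "((\<lambda>x. t ^ k * F (x0 + t *\<^sub>R (x - x0))) has_derivative
      (\<lambda>v. t ^ k * (\<Sum>i\<in>UNIV. (t *\<^sub>R v) $ i * partial i F (x0 + t *\<^sub>R (y - x0))))) (at y within ?B)"
      by (rule has_derivative_mult_right)
    then show "((\<lambda>x. t ^ k * F (x0 + t *\<^sub>R (x - x0))) has_derivative blinfun_apply (fx y t)) (at y within ?B)"
      by (rule has_derivative_eq_rhs) (auto simp: fun_eq_iff app sum_distrib_left mult_ac)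
  next
    show "(\<lambda>t. t ^ k * F (x0 + t *\<^sub>R (y - x0))) integrable_on cbox 0 1" if "y \<in> ?B" for y
      by (intro integrable_continuous continuous_intros contt F that)
  qed
  moreover have "blinfun_apply (integral (cbox 0 1) (fx x)) = (\<lambda>v. \<Sum>i\<in>UNIV. v $ i * ray_mean x0 (Suc k) (partial i F) x)"
  proof
    fix v
    have ci: "?c i x integrable_on cbox 0 1" for i
      by (intro integrable_continuous continuous_intros contt smooth_on_partial F x)
    have "fx x integrable_on cbox 0 1"
      unfolding fx_def by (intro integrable_continuous continuous_intros contt smooth_on_partial F x)
    then have "blinfun_apply (integral (cbox 0 1) (fx x)) v = integral (cbox 0 1) (\<lambda>t. \<Sum>i\<in>UNIV. v $ i * ?c i x t)"
      by (simp add: blinfun_apply_integral app)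
    also have "\<dots> = (\<Sum>i\<in>UNIV. v $ i * integral (cbox 0 1) (?c i x))"
      using ci by (subst integral_sum) (auto intro!: integrable_on_mult_right simp del: power_Suc)
    finally show "blinfun_apply (integral (cbox 0 1) (fx x)) v = (\<Sum>i\<in>UNIV. v $ i * ray_mean x0 (Suc k) (partial i F) x)"
      by (simp add: ray_mean_def)
  qed
  ultimately show ?thesis
    using x by (simp add: ray_mean_def[abs_def] at_within_open[OF x open_ball])
qed

lemma Ck_on_ray_mean:
  assumes "smooth_on (ball x0 r) F"
  shows "Ck_on n (ball x0 r) (ray_mean x0 k F)"
  using assms
proof (induction n arbitrary: k F)
  case 0
  have "ray_mean x0 k F differentiable (at x)" if "x \<in> ball x0 r" for x
    using ray_mean_derivative[OF 0 that] by (auto simp: differentiable_def)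
  then have "continuous_on (ball x0 r) (ray_mean x0 k F)"
    using differentiable_imp_continuous_within by (intro continuous_at_imp_continuous_on) blast
  then show ?case by simp
next
  case (Suc n)
  have "partial i (ray_mean x0 k F) x = ray_mean x0 (Suc k) (partial i F) x" if "x \<in> ball x0 r" for x i
    by (subst partial_eqI[OF ray_mean_derivative[OF Suc.prems that]])
      (simp add: axis_def if_distrib[of "\<lambda>a. a * _"] cong: if_cong)
  then have "Ck_on n (ball x0 r) (partial i (ray_mean x0 k F))" for i
    using Ck_on_cong[OF open_ball] Suc.IH[OF smooth_on_partial[OF Suc.prems]] by metis
  moreover have "ray_mean x0 k F differentiable (at x)" if "x \<in> ball x0 r" for x
    using ray_mean_derivative[OF Suc.prems that] by (auto simp: differentiable_def)
  ultimately show ?case by simp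
qed

text \<open>The fundamental theorem of calculus along the ray from \<open>x0\<close> to
  \<open>x\<close>. The factors \<open>K i\<close> are smooth, so a derivation can be applied to
  each product.\<close>

lemma hadamard:
  fixes F :: "real^'n::finite \<Rightarrow> real"
  assumes F: "smooth_on (ball x0 r) F" and r: "0 < r"
  obtains K where "\<And>i. smooth_on (ball x0 r) (K i)" "\<And>i. K i x0 = partial i F x0"
    "\<And>x. x \<in> ball x0 r \<Longrightarrow> F x = F x0 + (\<Sum>i\<in>UNIV. (x $ i - x0 $ i) * K i x)"
proof (rule that[of "\<lambda>i. ray_mean x0 0 (partial i F)"])
  show "smooth_on (ball x0 r) (ray_mean x0 0 (partial i F))" for i
    unfolding smooth_on_def using Ck_on_ray_mean[OF smooth_on_partial[OF F]] by blast
  show "ray_mean x0 0 (partial i F) x0 = partial i F x0" for i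
    by (simp add: ray_mean_def)
  fix x assume x: "x \<in> ball x0 r"
  have c: "continuous_on {0..1} (\<lambda>t. partial i F (x0 + t *\<^sub>R (x - x0)))" for i
    by (rule continuous_on_compose2[OF smooth_on_continuous[OF smooth_on_partial[OF F]]])
      (use x in \<open>auto simp del: mem_ball intro!: continuous_intros ray_in_ball\<close>)
  have "((\<lambda>t. \<Sum>i\<in>UNIV. (x - x0) $ i * partial i F (x0 + t *\<^sub>R (x - x0))) has_integral
      F (x0 + 1 *\<^sub>R (x - x0)) - F (x0 + 0 *\<^sub>R (x - x0))) {0..1}"
  proof (rule fundamental_theorem_of_calculus)
    fix t :: real assume t: "t \<in> {0..1}"
    show "((\<lambda>t. F (x0 + t *\<^sub>R (x - x0))) has_vector_derivative
        (\<Sum>i\<in>UNIV. (x - x0) $ i * partial i F (x0 + t *\<^sub>R (x - x0)))) (at t within {0..1})"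
      unfolding has_real_derivative_iff_has_vector_derivative[symmetric]
      by (rule has_real_derivative_along[of F "\<lambda>t. x0 + t *\<^sub>R (x - x0)" t, OF smooth_on_differentiable[OF F ray_in_ball[OF x t]]])
        (auto intro!: derivative_eq_intros)
  qed simp
  then have "F x - F x0 = integral {0..1} (\<lambda>t. \<Sum>i\<in>UNIV. (x - x0) $ i * partial i F (x0 + t *\<^sub>R (x - x0)))"
    by (simp add: integral_unique)
  also have "\<dots> = (\<Sum>i\<in>UNIV. (x - x0) $ i * ray_mean x0 0 (partial i F) x)"
    using c by (subst integral_sum)
      (auto simp: ray_mean_def intro!: integrable_continuous_real continuous_intros)
  finally show "F x = F x0 + (\<Sum>i\<in>UNIV. (x $ i - x0 $ i) * ray_mean x0 0 (partial i F) x)"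
    by simp
qed

section \<open>Charts and tangent vectors\<close>

lemma riemannian_manifoldD:
  assumes "riemannian_manifold A g"
  shows "smooth_atlas A" "riemannian_metric A g"
  using assms by (auto simp: riemannian_manifold_def)

locale atlas =
  fixes A :: "('a::{t2_space, second_countable_topology}, 'n::finite) chart set"
  assumes atlas: "smooth_atlas A"
begin

lemma chart_exists: obtains c where "c \<in> A" "p \<in> fst c"
  using atlas unfolding smooth_atlas_def by blast

lemma chart_homeo: "c \<in> A \<Longrightarrow> homeomorphism (fst c) (chart_image c) (snd c) (chart_inv c)"
  using atlas by (simp add: smooth_atlas_def)

lemma open_chart: "c \<in> A \<Longrightarrow> open (fst c)" "c \<in> A \<Longrightarrow> open (chart_image c)"
  using atlas by (simp_all add: smooth_atlas_def)

lemma chart_simps [simp]: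
  "c \<in> A \<Longrightarrow> p \<in> fst c \<Longrightarrow> chart_inv c (snd c p) = p"
  "c \<in> A \<Longrightarrow> p \<in> fst c \<Longrightarrow> snd c p \<in> chart_image c"
  "c \<in> A \<Longrightarrow> x \<in> chart_image c \<Longrightarrow> snd c (chart_inv c x) = x"
  "c \<in> A \<Longrightarrow> x \<in> chart_image c \<Longrightarrow> chart_inv c x \<in> fst c"
  using chart_homeo unfolding homeomorphism_def by fastforce+

lemma continuous_chart: "c \<in> A \<Longrightarrow> continuous_on (fst c) (snd c)"
  and continuous_chart_inv: "c \<in> A \<Longrightarrow> continuous_on (chart_image c) (chart_inv c)"
  using chart_homeo unfolding homeomorphism_def by blast+

lemma chart_set_eq: "c \<in> A \<Longrightarrow> snd c ` (fst c \<inter> W) = chart_image c \<inter> chart_inv c -` W"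
  by (auto simp: image_iff intro: chart_simps(4)) (metis chart_simps(3,4) IntI)

lemma open_chart_set: "c \<in> A \<Longrightarrow> open W \<Longrightarrow> open (snd c ` (fst c \<inter> W))"
  unfolding chart_set_eq
  by (rule continuous_open_preimage[OF continuous_chart_inv open_chart(2)])

lemma open_chart_inv_image:
  assumes "c \<in> A" "open O'" "O' \<subseteq> chart_image c" shows "open (chart_inv c ` O')"
proof -
  have "chart_inv c ` O' = fst c \<inter> snd c -` O'"
    using assms by (auto simp: image_iff subset_iff) (metis chart_simps(1))
  then show ?thesis
    using continuous_open_preimage[OF continuous_chart[OF assms(1)] open_chart(1)[OF assms(1)] assms(2)] by simp
qed

section \<open>Transition maps and smoothness near a point\<close>

definition transition :: "('a, 'n) chart \<Rightarrow> ('a, 'n) chart \<Rightarrow> real^'n \<Rightarrow> real^'n" where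
  "transition c d x = snd d (chart_inv c x)"

definition overlap :: "('a, 'n) chart \<Rightarrow> ('a, 'n) chart \<Rightarrow> (real^'n) set" where
  "overlap c d = snd c ` (fst c \<inter> fst d)"

lemma overlap_iff: "c \<in> A \<Longrightarrow> x \<in> overlap c d \<longleftrightarrow> x \<in> chart_image c \<and> chart_inv c x \<in> fst d"
  unfolding overlap_def by (subst chart_set_eq) auto

lemma open_overlap: "c \<in> A \<Longrightarrow> d \<in> A \<Longrightarrow> open (overlap c d)"
  unfolding overlap_def by (rule open_chart_set) (auto intro: open_chart)

lemma smooth_trans: "c \<in> A \<Longrightarrow> d \<in> A \<Longrightarrow> smooth_on (overlap c d) (\<lambda>x. transition c d x $ i)"
  using atlas unfolding smooth_atlas_def transition_def overlap_def by blast

lemma trans_simps: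
  assumes "c \<in> A" "d \<in> A" "x \<in> overlap c d"
  shows "chart_inv d (transition c d x) = chart_inv c x" "transition c d x \<in> chart_image d"
    "transition c d x \<in> overlap d c" "transition d c (transition c d x) = x"
  using assms by (auto simp: overlap_iff transition_def)

text \<open>Smoothness in one chart passes to every other chart by composition with the smooth
  transition map.\<close>

lemma smooth_near_chartI:
  assumes c: "c \<in> A" "p \<in> fst c" and O': "open O'" "snd c p \<in> O'" "O' \<subseteq> chart_image c"
    and h: "smooth_on O' (h \<circ> chart_inv c)"
  shows "smooth_near A p h"
  unfolding smooth_near_def smooth_fun_on_def
proof (intro exI conjI ballI)
  show "open (chart_inv c ` O')" by (rule open_chart_inv_image[OF c(1) O'(1,3)])
  show "p \<in> chart_inv c ` O'" using c O' by (metis chart_simps(1) imageI)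
  fix d assume d: "d \<in> A"
  let ?S = "snd d ` (fst d \<inter> chart_inv c ` O')"
  have oS: "open ?S" by (rule open_chart_set[OF d open_chart_inv_image[OF c(1) O'(1,3)]])
  have S: "x \<in> overlap d c \<and> transition d c x \<in> O'" if "x \<in> ?S" for x
    using that c d O'(3) by (auto simp: overlap_iff transition_def subset_iff)
  have "smooth_on ?S (\<lambda>x. (h \<circ> chart_inv c) (transition d c x))"
    by (rule smooth_on_compose[OF oS h smooth_on_subset[OF smooth_trans[OF d c(1)]]]) (use S in auto)
  then show "smooth_on ?S (h \<circ> chart_inv d)"
    by (rule iffD1[OF smooth_on_cong[OF oS], rotated]) (use S d c trans_simps(1) in auto)
qed

lemma smooth_near_chartD:
  assumes "c \<in> A" "p \<in> fst c" "smooth_near A p h"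
  obtains O' where "open O'" "snd c p \<in> O'" "O' \<subseteq> chart_image c" "smooth_on O' (h \<circ> chart_inv c)"
proof -
  obtain W where W: "open W" "p \<in> W" "smooth_fun_on A W h"
    using assms(3) unfolding smooth_near_def by blast
  show ?thesis
  proof (rule that[of "snd c ` (fst c \<inter> W)"])
    show "smooth_on (snd c ` (fst c \<inter> W)) (h \<circ> chart_inv c)"
      using W(3) assms(1) by (simp add: smooth_fun_on_def)
  qed (use open_chart_set[OF assms(1) W(1)] assms(2) W(2) in \<open>auto simp: chart_image_def\<close>)
qed

lemma smooth_near_partial_diff:
  assumes "c \<in> A" "p \<in> fst c" "smooth_near A p h"
  shows "(h \<circ> chart_inv c) differentiable (at (snd c p))"
  using smooth_near_chartD[OF assms] smooth_on_differentiable by metis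

lemma smooth_near_coord: "c \<in> A \<Longrightarrow> p \<in> fst c \<Longrightarrow> smooth_near A p (\<lambda>q. snd c q $ i)"
proof (rule smooth_near_chartI[where O'="chart_image c"])
  assume c: "c \<in> A" "p \<in> fst c"
  show "smooth_on (chart_image c) ((\<lambda>q. snd c q $ i) \<circ> chart_inv c)"
    by (rule iffD1[OF smooth_on_cong smooth_on_intros(2)]) (use c open_chart in auto)
qed (auto simp: open_chart)

lemma smooth_near_ops:
  assumes "smooth_near A p h" "smooth_near A p k"
  shows "smooth_near A p (\<lambda>q. a * h q + k q)" "smooth_near A p (\<lambda>q. h q * k q)"
proof -
  obtain c where c: "c \<in> A" "p \<in> fst c" by (rule chart_exists)
  obtain O1 where O1: "open O1" "snd c p \<in> O1" "O1 \<subseteq> chart_image c" "smooth_on O1 (h \<circ> chart_inv c)"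
    using smooth_near_chartD[OF c assms(1)] .
  obtain O2 where O2: "open O2" "snd c p \<in> O2" "O2 \<subseteq> chart_image c" "smooth_on O2 (k \<circ> chart_inv c)"
    using smooth_near_chartD[OF c assms(2)] .
  have o: "open (O1 \<inter> O2)" using O1 O2 by auto
  have s: "smooth_on (O1 \<inter> O2) (\<lambda>x. h (chart_inv c x))" "smooth_on (O1 \<inter> O2) (\<lambda>x. k (chart_inv c x))"
    using smooth_on_subset[OF O1(4), of "O1 \<inter> O2"] smooth_on_subset[OF O2(4), of "O1 \<inter> O2"] by (auto simp: o_def)
  have "smooth_on (O1 \<inter> O2) (\<lambda>x. a * h (chart_inv c x) + k (chart_inv c x))"
    "smooth_on (O1 \<inter> O2) (\<lambda>x. h (chart_inv c x) * k (chart_inv c x))"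
    by (rule smooth_on_intros(3)[OF o smooth_on_intros(4)[OF o smooth_on_intros(1)[OF o] s(1)] s(2)],
        rule smooth_on_intros(4)[OF o s])
  then show "smooth_near A p (\<lambda>q. a * h q + k q)" "smooth_near A p (\<lambda>q. h q * k q)"
    using O1 O2 o by (auto intro!: smooth_near_chartI[OF c, of "O1 \<inter> O2"] simp: o_def)
qed

lemma smooth_near_const: "smooth_near A p (\<lambda>q. a)"
proof -
  obtain c where c: "c \<in> A" "p \<in> fst c" by (rule chart_exists)
  show ?thesis
    by (rule smooth_near_chartI[OF c, of "chart_image c"])
      (use c in \<open>auto simp: o_def open_chart smooth_on_intros(1)\<close>)
qed

section \<open>Tangent vectors and their components\<close>

definition tv :: "('a, 'n) chart \<Rightarrow> 'a \<Rightarrow> real^'n \<Rightarrow> 'a tangent" where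
  "tv c p a = (\<lambda>h. \<Sum>i\<in>UNIV. a $ i * coord_vector A c i p h)"

lemma tv_apply:
  "tv c p a h = (if smooth_near A p h then form1 (\<lambda>i. partial i (h \<circ> chart_inv c) (snd c p)) a else 0)"
  by (simp add: tv_def coord_vector_def form1_def)

lemma coord_vector_tv: "coord_vector A c i p = tv c p (axis i 1)"
  by (rule ext) (simp add: tv_apply coord_vector_def)

lemma tv_tangent:
  assumes c: "c \<in> A" "p \<in> fst c"
  shows "tv c p a \<in> tangent_space A p"
proof -
  let ?x = "snd c p"
  have 1: "tv c p a (\<lambda>q. b * h q + k q) = b * tv c p a h + tv c p a k"
    if h: "smooth_near A p h" "smooth_near A p k" for h k b
  proof -
    define H K where HK: "H = h \<circ> chart_inv c" "K = k \<circ> chart_inv c"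
    have d: "H differentiable (at ?x)" "K differentiable (at ?x)"
      using smooth_near_partial_diff[OF c] h by (auto simp: HK)
    have "partial i (\<lambda>x. b * H x + K x) ?x = b * partial i H ?x + partial i K ?x" for i
      using d by (simp add: partial_add partial_mult partial_eqI[where D="\<lambda>v. 0"])
    moreover have "(\<lambda>q. b * h q + k q) \<circ> chart_inv c = (\<lambda>x. b * H x + K x)" by (auto simp: HK)
    ultimately show ?thesis using h smooth_near_ops(1)[OF h]
      by (simp add: tv_apply form1_lin flip: HK)
  qed
  have 2: "tv c p a (\<lambda>q. h q * k q) = h p * tv c p a k + k p * tv c p a h"
    if h: "smooth_near A p h" "smooth_near A p k" for h k
  proof -
    define H K where HK: "H = h \<circ> chart_inv c" "K = k \<circ> chart_inv c"
    have d: "H differentiable (at ?x)" "K differentiable (at ?x)"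
      using smooth_near_partial_diff[OF c] h by (auto simp: HK)
    have "H ?x = h p" "K ?x = k p" using c by (auto simp: HK)
    then have "partial i (\<lambda>x. H x * K x) ?x = h p * partial i K ?x + k p * partial i H ?x" for i
      using d by (simp add: partial_mult)
    moreover have "(\<lambda>q. h q * k q) \<circ> chart_inv c = (\<lambda>x. H x * K x)" by (auto simp: HK)
    ultimately show ?thesis using h smooth_near_ops(2)[OF h]
      by (simp add: tv_apply form1_lin flip: HK)
  qed
  show ?thesis
    unfolding tangent_space_def using 1 2 by (auto simp: tv_apply)
qed

lemma component_tv: assumes "c \<in> A" "p \<in> fst c" shows "component c (tv c p a) i = a $ i"
proof -
  have "partial j ((\<lambda>q. snd c q $ i) \<circ> chart_inv c) (snd c p) = partial j (\<lambda>x. x $ i) (snd c p)" for j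
    by (rule partial_cong[OF open_chart(2)[OF assms(1)]]) (use assms in auto)
  then show ?thesis
    using smooth_near_coord[OF assms, of i]
    by (simp add: component_def tv_apply partial_nth form1_def if_distrib[of "\<lambda>a. _ * a"] cong: if_cong)
qed

text \<open>A derivation kills constants and depends only on the germ, so by \<open>hadamard\<close>
  its value on \<open>h\<close> is determined by its values on the coordinate functions.\<close>

lemma tangent_tv:
  assumes c: "c \<in> A" "p \<in> fst c" and v: "v \<in> tangent_space A p"
  shows "v = tv c p (\<chi> i. component c v i)"
proof
  fix h
  have lin: "v (\<lambda>q. a * h q + k q) = a * v h + v k" and leib: "v (\<lambda>q. h q * k q) = h p * v k + k p * v h"
    if "smooth_near A p h" "smooth_near A p k" for h k a
    using v that unfolding tangent_space_def by auto
  have const: "v (\<lambda>q. a) = 0" for a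
  proof -
    have 1: "v (\<lambda>q. 1) = 0" using leib[OF smooth_near_const smooth_near_const, of 1 1] by simp
    have 0: "v (\<lambda>q. 0) = 0" using leib[OF smooth_near_const smooth_near_const, of 0 0] by simp
    show ?thesis using lin[OF smooth_near_const smooth_near_const, of a 1 0] 0 1 by simp
  qed
  have germ: "v h = v k" if hk: "smooth_near A p h" "smooth_near A p k" and W: "open W" "p \<in> W" "\<And>q. q \<in> W \<Longrightarrow> h q = k q" for h k W
  proof -
    let ?d = "\<lambda>q. -1 * k q + h q" and ?b = "\<lambda>q. if q \<in> W then 0 else 1"
    have O': "open (snd c ` (fst c \<inter> W))" "snd c p \<in> snd c ` (fst c \<inter> W)" "snd c ` (fst c \<inter> W) \<subseteq> chart_image c"
      using open_chart_set[OF c(1) W(1)] c W(2) by (auto simp: chart_image_def)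
    have "smooth_near A p ?b"
      by (rule smooth_near_chartI[OF c O'], rule iffD1[OF smooth_on_cong[OF O'(1)] smooth_on_intros(1)[OF O'(1), of 0]])
        (use c in auto)
    moreover have "smooth_near A p ?d" by (rule smooth_near_ops[OF hk(2,1)])
    ultimately have "v (\<lambda>q. ?d q * ?b q) = ?d p * v ?b + ?b p * v ?d" by (rule leib[rotated])
    moreover have "(\<lambda>q. ?d q * ?b q) = ?d" using W(3) by auto
    ultimately have "v ?d = 0" using W by simp
    then show ?thesis using lin[OF hk(2,1), of "-1"] by simp
  qed
  show "v h = tv c p (\<chi> i. component c v i) h"
  proof (cases "smooth_near A p h")
    case False
    then show ?thesis using v by (simp add: tangent_space_def tv_apply)
  next
    case True
    let ?x = "snd c p"
    obtain O' where O': "open O'" "?x \<in> O'" "O' \<subseteq> chart_image c" "smooth_on O' (h \<circ> chart_inv c)"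
      using smooth_near_chartD[OF c True] .
    obtain r where r: "r > 0" "ball ?x r \<subseteq> O'" using O' open_contains_ball by blast
    obtain K where K: "\<And>i. smooth_on (ball ?x r) (K i)" "\<And>i. K i ?x = partial i (h \<circ> chart_inv c) ?x"
       "\<And>x. x \<in> ball ?x r \<Longrightarrow> (h \<circ> chart_inv c) x = (h \<circ> chart_inv c) ?x + (\<Sum>i\<in>UNIV. (x $ i - ?x $ i) * K i x)"
      using hadamard[OF smooth_on_subset[OF O'(4) r(2)] r(1)] by blast
    have B: "open (ball ?x r)" "?x \<in> ball ?x r" "ball ?x r \<subseteq> chart_image c" using r O'(3) by auto
    have sK: "smooth_near A p (\<lambda>q. K i (snd c q))" for i
      by (rule smooth_near_chartI[OF c B], rule iffD1[OF smooth_on_cong[OF B(1)] K(1)[of i]])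
        (use c B(3) in auto)
    \<comment> \<open>\<open>Y i\<close> vanishes at \<open>p\<close>, so the Leibniz rule leaves
      only \<open>v (Y i)\<close> times the value of \<open>K i\<close> at \<open>p\<close>, which
      is a partial derivative of \<open>h\<close>.\<close>
    define Y where "Y i q = - ?x $ i + snd c q $ i" for i q
    have sy: "smooth_near A p (Y i)" for i
      using smooth_near_ops(1)[OF smooth_near_const smooth_near_coord[OF c], of 1 "- ?x $ i"] by (simp add: Y_def[abs_def])
    have vy: "v (Y i) = component c v i" for i
      using lin[OF smooth_near_const smooth_near_coord[OF c], of 1 "- ?x $ i" i] const by (simp add: component_def Y_def[abs_def])
    define D where "D i = partial i (h \<circ> chart_inv c) ?x" for i
    have summand: "v (\<lambda>q. Y i q * K i (snd c q)) = component c v i * D i" for i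
      using leib[OF sy sK, of i i] by (simp add: vy K(2) D_def) (simp add: Y_def)
    have vsum: "smooth_near A p (\<lambda>q. \<Sum>i\<in>I. Y i q * K i (snd c q)) \<and>
        v (\<lambda>q. \<Sum>i\<in>I. Y i q * K i (snd c q)) = (\<Sum>i\<in>I. component c v i * D i)"
      if "finite I" for I
      using that
    proof (induction I rule: finite_induct)
      case empty
      then show ?case by (simp add: const smooth_near_const)
    next
      case (insert j I)
      have "smooth_near A p (\<lambda>q. Y j q * K j (snd c q))" by (rule smooth_near_ops[OF sy sK])
      note * = this conjunct1[OF insert.IH]
      show ?case
        using smooth_near_ops(1)[OF *, of 1] lin[OF *, of 1] insert summand[of j] by simp
    qed
    let ?k = "\<lambda>q. h p + (\<Sum>i\<in>UNIV. Y i q * K i (snd c q))"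
    have k: "smooth_near A p ?k" "v ?k = (\<Sum>i\<in>UNIV. component c v i * D i)"
      using smooth_near_ops(1)[OF smooth_near_const conjunct1[OF vsum], of UNIV 1 "h p"]
        lin[OF smooth_near_const conjunct1[OF vsum], of UNIV 1 "h p"] vsum[of UNIV] const by simp_all
    have "v h = v ?k"
    proof (rule germ[OF True k(1)])
      show "open (chart_inv c ` ball ?x r)" by (rule open_chart_inv_image[OF c(1) B(1,3)])
      show "p \<in> chart_inv c ` ball ?x r" using B(2) c by (metis chart_simps(1) imageI)
      show "h q = ?k q" if "q \<in> chart_inv c ` ball ?x r" for q
        using that K(3) B(3) c by (auto simp: Y_def)
    qed
    then show ?thesis using k(2) True by (simp add: tv_apply form1_def D_def)
  qed
qed

lemma tv_trans:
  assumes c: "c \<in> A" "p \<in> fst c" and d: "d \<in> A" "p \<in> fst d"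
  shows "tv c p a = tv d p (dvec (transition c d) (snd c p) a)"
proof
  fix h
  let ?x = "snd c p"
  show "tv c p a h = tv d p (dvec (transition c d) ?x a) h"
  proof (cases "smooth_near A p h")
    case True
    have x: "?x \<in> overlap c d" using c d by (simp add: overlap_iff)
    have T: "(\<lambda>y. transition c d y $ j) differentiable (at ?x)" for j
      by (rule smooth_on_differentiable[OF smooth_trans[OF c(1) d(1)] x])
    have Tx: "transition c d ?x = snd d p" using c by (simp add: transition_def)
    have "(h \<circ> chart_inv d) differentiable (at (transition c d ?x))"
      using smooth_near_partial_diff[OF d True] by (simp add: Tx)
    note pc = partial_compose[OF T this]
    have "partial i (h \<circ> chart_inv c) ?x = partial i (\<lambda>y. (h \<circ> chart_inv d) (transition c d y)) ?x" for i
      by (rule partial_cong[OF open_overlap[OF c(1) d(1)] x]) (simp add: trans_simps c d)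
    note this[unfolded pc Tx]
    then have "form1 (\<lambda>i. partial i (h \<circ> chart_inv c) ?x) a
      = (\<Sum>j\<in>UNIV. partial j (h \<circ> chart_inv d) (snd d p) * form1 (\<lambda>i. partial i (\<lambda>x. transition c d x $ j) ?x) a)"
      by (simp only: form1_sum form1_lin)
    then show ?thesis
      using True unfolding tv_apply form1_def[of _ "dvec _ _ _"] by (simp add: dvec_def mult.commute)
  qed (simp add: tv_apply)
qed

end

section \<open>The metric in a chart\<close>

locale riem = atlas A for A :: "('a::{t2_space, second_countable_topology}, 'n::finite) chart set" +
  fixes g :: "'a metric"
  assumes metric: "riemannian_metric A g"
begin

lemma g_lin:
  assumes "u \<in> tangent_space A p" "v \<in> tangent_space A p" "w \<in> tangent_space A p"
  shows "g p u v = g p v u" "g p (\<lambda>h. a * u h + v h) w = a * g p u w + g p v w"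
  using metric assms unfolding riemannian_metric_def by blast+

lemma g_pos: "v \<in> tangent_space A p \<Longrightarrow> v \<noteq> (\<lambda>h. 0) \<Longrightarrow> g p v v > 0"
  using metric unfolding riemannian_metric_def by blast

lemma tv_lin: "tv c p (a *\<^sub>R u + v) = (\<lambda>h. a * tv c p u h + tv c p v h)"
  by (rule ext) (simp add: tv_apply form1_lin)

lemma tv_0: "tv c p 0 = (\<lambda>h. 0)"
  by (rule ext) (simp add: tv_apply form1_lin)

lemma g_zero:
  assumes "c \<in> A" "p \<in> fst c" "w \<in> tangent_space A p" shows "g p (\<lambda>h. 0) w = 0"
  using g_lin(2)[OF tv_tangent[OF assms(1,2), of 0] tv_tangent[OF assms(1,2), of 0] assms(3), of 1]
  by (simp add: tv_0)

lemma g_nonneg: assumes "v \<in> tangent_space A p" shows "g p v v \<ge> 0"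
proof (cases "v = (\<lambda>h. 0)")
  case True
  obtain c where "c \<in> A" "p \<in> fst c" by (rule chart_exists)
  then show ?thesis using g_zero assms True by simp
qed (use g_pos[OF assms] in simp)

abbreviation G where "G c \<equiv> metric_matrix A g c"

lemma g_tv:
  assumes c: "c \<in> A" "p \<in> fst c"
  shows "g p (tv c p a) (tv c p b) = form2 (\<lambda>i j. G c (snd c p) $ i $ j) a b"
proof -
  note t = tv_tangent[OF c]
  have l: "linear (\<lambda>a. g p (tv c p a) w)" if w: "w \<in> tangent_space A p" for w
  proof (rule linearI)
    show "g p (tv c p (a + b)) w = g p (tv c p a) w + g p (tv c p b) w" for a b
      using tv_lin[of c p 1 a b] g_lin(2)[OF t t w, of 1 a b] by simp
    show "g p (tv c p (r *\<^sub>R a)) w = r *\<^sub>R g p (tv c p a) w" for r a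
      using tv_lin[of c p r a 0] g_lin(2)[OF t t w, of r a 0] by (simp add: tv_0 g_zero[OF c w])
  qed
  have "linear (\<lambda>b. g p w (tv c p b))" if w: "w \<in> tangent_space A p" for w
    using l[OF w] by (simp add: g_lin(1)[OF w t w])
  note l2 = linear_form1[OF this]
  have "g p (tv c p a) (tv c p b) = form1 (\<lambda>i. form1 (\<lambda>j. g p (tv c p (axis i 1)) (tv c p (axis j 1))) b) a"
    by (subst linear_form1[OF l[OF t]], subst l2[OF t]) (rule refl)
  then show ?thesis
    using c by (simp add: form2_def metric_matrix_def coord_vector_tv)
qed

lemma chart_metric_chart:
  assumes c: "c \<in> A" shows "chart_metric (chart_image c) (G c)"
proof
  show "open (chart_image c)" by (rule open_chart[OF c])
  show "smooth_on (chart_image c) (\<lambda>x. G c x $ i $ j)" for i j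
    using metric c unfolding riemannian_metric_def by blast
  fix x assume x: "x \<in> chart_image c"
  then have p: "chart_inv c x \<in> fst c" "snd c (chart_inv c x) = x" using c by auto
  show "G c x $ i $ j = G c x $ j $ i" for i j
    using g_lin(1)[OF tv_tangent tv_tangent tv_tangent, OF c p(1) c p(1) c p(1)]
    by (simp add: metric_matrix_def Let_def coord_vector_tv)
  fix v :: "real^'n" assume "v \<noteq> 0"
  then obtain i where "v $ i \<noteq> 0" by (auto simp: vec_eq_iff)
  then have "tv c (chart_inv c x) v \<noteq> tv c (chart_inv c x) 0"
    using component_tv[OF c p(1), of v i] component_tv[OF c p(1), of 0 i] by auto
  from g_pos[OF tv_tangent[OF c p(1)] this[unfolded tv_0]]
  show "0 < form2 (\<lambda>i j. G c x $ i $ j) v v" using g_tv[OF c p(1)] p(2) by simp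
qed

abbreviation ip where "ip c \<equiv> chart_metric.ip (G c)"
abbreviation Gam where "Gam c \<equiv> chart_metric.Gam (G c)"
abbreviation cc where "cc c \<equiv> chart_metric.cc (G c)"

lemma g_tv_ip: "c \<in> A \<Longrightarrow> p \<in> fst c \<Longrightarrow> g p (tv c p a) (tv c p b) = ip c (snd c p) a b"
  by (simp add: g_tv chart_metric.ip_def[OF chart_metric_chart])

subsection \<open>Change of charts\<close>

lemma ip_trans:
  assumes "c \<in> A" "d \<in> A" "x \<in> overlap c d"
  shows "ip c x a b = ip d (transition c d x) (dvec (transition c d) x a) (dvec (transition c d) x b)"
proof -
  let ?p = "chart_inv c x"
  have p: "?p \<in> fst c" "?p \<in> fst d" "snd c ?p = x" "snd d ?p = transition c d x"
    using assms by (auto simp: overlap_iff transition_def)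
  have "ip c x a b = g ?p (tv c ?p a) (tv c ?p b)" using g_tv_ip[OF assms(1) p(1)] p by simp
  also have "\<dots> = ip d (transition c d x) (dvec (transition c d) x a) (dvec (transition c d) x b)"
    using tv_trans[OF assms(1) p(1) assms(2) p(2)] g_tv_ip[OF assms(2) p(2)] p by simp
  finally show ?thesis .
qed

lemma trans_diff:
  assumes "c \<in> A" "d \<in> A" "x \<in> overlap c d"
  shows "(\<lambda>y. transition c d y $ k) differentiable (at x)"
    "partial l (\<lambda>y. transition c d y $ k) differentiable (at x)"
  using smooth_on_differentiable[OF smooth_trans[OF assms(1,2)] assms(3)]
    smooth_on_differentiable[OF smooth_on_partial[OF smooth_trans[OF assms(1,2)]] assms(3)] by auto

text \<open>The transformation law of the Christoffel symbols with lowered index. Differentiating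
  \<open>ip_trans\<close> along lines gives a law for \<open>dG\<close>; in the combination
  \<open>cc\<close> the symmetry of the second differential of the transition map cancels all of its
  contributions but one.\<close>

lemma cc_trans:
  assumes c: "c \<in> A" and d: "d \<in> A" and x: "x \<in> overlap c d"
  defines "T \<equiv> transition c d"
  defines "J \<equiv> dvec T x"
  shows "cc c x v v z = ip d (T x) (ddvec T x v v) (J z) + cc d (T x) (J v) (J v) (J z)"
proof -
  interpret M: chart_metric "chart_image c" "G c" by (rule chart_metric_chart[OF c])
  interpret N: chart_metric "chart_image d" "G d" by (rule chart_metric_chart[OF d])
  have xU: "x \<in> chart_image c" and Tx: "T x \<in> chart_image d"
    using x trans_simps(2)[OF c d x] by (auto simp: overlap_iff[OF c] T_def)
  have dG: "M.dG x u a b = N.dG (T x) (J u) (J a) (J b) + ip d (T x) (ddvec T x u a) (J b)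
      + ip d (T x) (J a) (ddvec T x u b)" for u a b
  proof -
    let ?c = "\<lambda>s::real. x + s *\<^sub>R u"
    have k: "((\<lambda>s. w) has_vector_derivative 0) (at (0::real))" for w :: "real^'n" by simp
    have l: "(?c has_vector_derivative u) (at 0)" by (auto intro!: derivative_eq_intros)
    have Td: "((\<lambda>s. T (?c s)) has_vector_derivative J u) (at 0)"
      using dvec_along[of T ?c 0 u UNIV] trans_diff(1)[OF c d x] l by (simp add: T_def J_def)
    have Jd: "((\<lambda>s. dvec T (?c s) w) has_vector_derivative ddvec T x u w) (at 0)" for w
      using ddvec_along[of T ?c 0 u UNIV "\<lambda>_. w" 0] trans_diff(2)[OF c d x] l dvec_lin(2)[of T x 0 0]
      by (simp add: T_def)
    have 1: "((\<lambda>s. ip c (?c s) a b) has_real_derivative M.dG x u a b) (at 0)"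
      by (rule DERIV_cong[OF M.ip_deriv[of ?c, OF _ l k k]]) (use xU in \<open>auto simp: M.ip_lin\<close>)
    have 2: "((\<lambda>s. ip d (T (?c s)) (dvec T (?c s) a) (dvec T (?c s) b)) has_real_derivative
       N.dG (T x) (J u) (J a) (J b) + ip d (T x) (ddvec T x u a) (J b)
        + ip d (T x) (J a) (ddvec T x u b)) (at 0)"
      using N.ip_deriv[of "\<lambda>s. T (?c s)", OF _ Td Jd Jd] Tx by (simp add: J_def)
    have "eventually (\<lambda>s. ?c s \<in> overlap c d) (nhds 0)"
      by (rule isCont_eventually_in[OF _ open_overlap[OF c d]]) (use x in \<open>auto intro!: continuous_intros\<close>)
    then have "eventually (\<lambda>s. ip c (?c s) a b = ip d (T (?c s)) (dvec T (?c s) a) (dvec T (?c s) b)) (nhds 0)"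
      by eventually_elim (simp add: T_def ip_trans[OF c d])
    from DERIV_unique[OF iffD1[OF DERIV_cong_ev[OF refl this refl] 1] 2] show ?thesis .
  qed
  have "ddvec T x v z = ddvec T x z v"
    using ddvec_sym[OF open_overlap[OF c d] x smooth_trans[OF c d]] by (simp add: T_def)
  then show ?thesis
    using N.ip_sym[OF Tx, of "J v"]  N.ip_sym[OF Tx, of "J z"]
    by (simp add: M.cc_def N.cc_def dG field_simps)
qed

section \<open>Curves and the Riemannian distance\<close>

lemma velocity_cong:
  assumes "open T" "t \<in> T" "\<And>s. s \<in> T \<Longrightarrow> \<gamma> s = \<gamma>' s"
  shows "velocity A \<gamma> t = velocity A \<gamma>' t"
proof -
  have "eventually (\<lambda>s. (h \<circ> \<gamma>) s = (h \<circ> \<gamma>') s) (nhds t)" for h :: "'a \<Rightarrow> real"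
    using eventually_nhds_in_open[OF assms(1,2)] by eventually_elim (simp add: assms(3))
  then have "deriv (h \<circ> \<gamma>) t = deriv (h \<circ> \<gamma>') t" for h :: "'a \<Rightarrow> real"
    by (rule deriv_cong_ev) simp
  then show ?thesis unfolding velocity_def by (simp only: assms(3)[OF assms(2)])
qed

lemma velocity_tv:
  assumes c: "c \<in> A" "\<gamma> t \<in> fst c" and \<gamma>: "isCont \<gamma> t"
    and v: "((snd c \<circ> \<gamma>) has_vector_derivative v) (at t)"
  shows "velocity A \<gamma> t = tv c (\<gamma> t) v"
proof
  fix h
  show "velocity A \<gamma> t h = tv c (\<gamma> t) v h"
  proof (cases "smooth_near A (\<gamma> t) h")
    case True
    have "eventually (\<lambda>s. \<gamma> s \<in> fst c) (nhds t)"
      by (rule isCont_eventually_in[OF \<gamma> open_chart(1)[OF c(1)] c(2)])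
    then have ev: "eventually (\<lambda>s. (h \<circ> chart_inv c) ((snd c \<circ> \<gamma>) s) = (h \<circ> \<gamma>) s) (nhds t)"
      by eventually_elim (simp add: c(1))
    have "((\<lambda>s. (h \<circ> chart_inv c) ((snd c \<circ> \<gamma>) s)) has_real_derivative
        form1 (\<lambda>i. partial i (h \<circ> chart_inv c) ((snd c \<circ> \<gamma>) t)) v) (at t)"
      by (rule deriv_along[OF _ v]) (simp only: o_apply[of "snd c" \<gamma>] smooth_near_partial_diff[OF c True])
    from iffD1[OF DERIV_cong_ev[OF refl ev refl] this]
    have "((h \<circ> \<gamma>) has_real_derivative form1 (\<lambda>i. partial i (h \<circ> chart_inv c) (snd c (\<gamma> t))) v) (at t)"
      by (simp only: o_apply[of "snd c" \<gamma>])
    then show ?thesis using True by (simp add: velocity_def tv_apply DERIV_imp_deriv)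
  qed (simp add: velocity_def tv_apply)
qed

lemma velocity_tangent:
  assumes "C1_curve_on A a b \<gamma>" "a < t" "t < b"
  shows "velocity A \<gamma> t \<in> tangent_space A (\<gamma> t)"
proof -
  obtain c where c: "c \<in> A" "\<gamma> t \<in> fst c" by (rule chart_exists)
  have i: "at t within {a..b} = at t" using assms(2,3) by (intro at_within_interior) simp
  have "(snd c \<circ> \<gamma>) differentiable (at t within {a..b})"
    using assms c unfolding C1_curve_on_def by auto
  then have "((snd c \<circ> \<gamma>) has_vector_derivative vector_derivative (snd c \<circ> \<gamma>) (at t)) (at t)"
    unfolding i by (simp add: vector_derivative_works)
  moreover have "isCont \<gamma> t"
    using assms continuous_on_interior[of "{a..b}" \<gamma> t] unfolding C1_curve_on_def by simp
  ultimately show ?thesis using velocity_tv[of c \<gamma> t] c tv_tangent by metis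
qed

lemma C1_curve_on_cong:
  assumes "C1_curve_on A a b \<gamma>" "\<And>t. t \<in> {a..b} \<Longrightarrow> \<gamma> t = \<gamma>' t"
  shows "C1_curve_on A a b \<gamma>'"
proof -
  have d: "((snd c \<circ> \<gamma>) has_vector_derivative v) (at t within {a..b}) \<longleftrightarrow>
      ((snd c \<circ> \<gamma>') has_vector_derivative v) (at t within {a..b})" if "t \<in> {a..b}" for t v c
    using has_vector_derivative_transform[OF that, of "snd c \<circ> \<gamma>'" "snd c \<circ> \<gamma>" v]
      has_vector_derivative_transform[OF that, of "snd c \<circ> \<gamma>" "snd c \<circ> \<gamma>'" v] assms(2) by auto
  have s: "{t \<in> {a..b}. \<gamma> t \<in> X} = {t \<in> {a..b}. \<gamma>' t \<in> X}" for X using assms(2) by auto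
  have v: "vector_derivative (snd c \<circ> \<gamma>) (at t within {a..b}) = vector_derivative (snd c \<circ> \<gamma>') (at t within {a..b})"
    if "t \<in> {a..b}" for t c
    unfolding vector_derivative_def by (simp only: d[OF that])
  have "continuous_on {t \<in> {a..b}. \<gamma> t \<in> fst c} (\<lambda>t. vector_derivative (snd c \<circ> \<gamma>) (at t within {a..b})) \<longleftrightarrow>
    continuous_on {t \<in> {a..b}. \<gamma>' t \<in> fst c} (\<lambda>t. vector_derivative (snd c \<circ> \<gamma>') (at t within {a..b}))" for c
    unfolding s by (rule continuous_on_cong) (auto simp: v)
  note vc = this
  have df: "(snd c \<circ> \<gamma>) differentiable (at t within {a..b}) \<longleftrightarrow> (snd c \<circ> \<gamma>') differentiable (at t within {a..b})"
    if "t \<in> {a..b}" for t c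
    using d[OF that] by (metis vector_derivative_works differentiableI_vector)
  show ?thesis
    unfolding C1_curve_on_def
  proof (intro conjI ballI)
    have "continuous_on {a..b} \<gamma>" using assms(1) by (simp add: C1_curve_on_def)
    then show "continuous_on {a..b} \<gamma>'"
      by (rule iffD1[OF continuous_on_cong, rotated 2]) (auto simp: assms(2))
    fix c assume c: "c \<in> A"
    show "(snd c \<circ> \<gamma>') differentiable (at t within {a..b})" if "t \<in> {t \<in> {a..b}. \<gamma>' t \<in> fst c}" for t
      using assms c that df[of t c] unfolding C1_curve_on_def by auto
    show "continuous_on {t \<in> {a..b}. \<gamma>' t \<in> fst c} (\<lambda>t. vector_derivative (snd c \<circ> \<gamma>') (at t within {a..b}))"
      using assms(1) c vc[of c] unfolding C1_curve_on_def by blast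
  qed
qed

lemma C1_chart_curve:
  assumes c: "c \<in> A" and ab: "a < b"
    and \<xi>: "\<And>t. t \<in> {a..b} \<Longrightarrow> (\<xi> has_vector_derivative \<xi>' t) (at t within {a..b})"
    and \<xi>': "continuous_on {a..b} \<xi>'" and im: "\<xi> ` {a..b} \<subseteq> chart_image c"
  shows "C1_curve_on A a b (\<lambda>t. chart_inv c (\<xi> t))"
  unfolding C1_curve_on_def
proof (intro conjI ballI)
  have \<xi>c: "continuous_on {a..b} \<xi>" by (rule continuous_on_vector_derivative[OF \<xi>])
  then show "continuous_on {a..b} (\<lambda>t. chart_inv c (\<xi> t))"
    using continuous_on_compose2[OF continuous_chart_inv[OF c] _ im] by simp
  fix d assume d: "d \<in> A"
  let ?D = "{t \<in> {a..b}. chart_inv c (\<xi> t) \<in> fst d}"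
  have D: "\<xi> t \<in> overlap c d" if "t \<in> ?D" for t
    using that im by (auto simp: overlap_iff[OF c])
  have T: "snd d \<circ> (\<lambda>t. chart_inv c (\<xi> t)) = (\<lambda>t. transition c d (\<xi> t))"
    by (auto simp: transition_def)
  have der: "((snd d \<circ> (\<lambda>t. chart_inv c (\<xi> t))) has_vector_derivative dvec (transition c d) (\<xi> t) (\<xi>' t)) (at t within {a..b})"
    if "t \<in> ?D" for t
    unfolding T by (rule dvec_along[OF trans_diff(1)[OF c d D[OF that]] \<xi>]) (use that in auto)
  then show "(snd d \<circ> (\<lambda>t. chart_inv c (\<xi> t))) differentiable (at t within {a..b})" if "t \<in> ?D" for t
    using that differentiableI_vector by blast
  have "vector_derivative (snd d \<circ> (\<lambda>t. chart_inv c (\<xi> t))) (at t within {a..b}) = dvec (transition c d) (\<xi> t) (\<xi>' t)"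
    if "t \<in> ?D" for t
    using vector_derivative_within_cbox[of a b t] ab der[OF that] that by auto
  note vd = this
  have vc: "continuous_on ?D (\<lambda>t. dvec (transition c d) (\<xi> t) (\<xi>' t))"
    unfolding dvec_def
  proof (intro continuous_on_vec_lambda continuous_on_form1)
    show "continuous_on ?D (\<lambda>t. partial l (\<lambda>y. transition c d y $ k) (\<xi> t))" for l k
      by (rule continuous_on_compose2[OF smooth_on_continuous[OF smooth_on_partial[OF smooth_trans[OF c d]]]
        continuous_on_subset[OF \<xi>c]]) (use D in auto)
  qed (rule continuous_on_subset[OF \<xi>'], auto)
  show "continuous_on ?D (\<lambda>t. vector_derivative (snd d \<circ> (\<lambda>t. chart_inv c (\<xi> t))) (at t within {a..b}))"
    by (rule iffD1[OF continuous_on_cong[OF refl vd[symmetric]] vc])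
qed

text \<open>\<open>reach x t p e\<close>: some curve from \<open>x\<close> to \<open>p\<close> on \<open>[0,t]\<close>, continuously differentiable inside each
  of finitely many charts, has energy \<open>e\<close>.\<close>

inductive reach :: "'a \<Rightarrow> real \<Rightarrow> 'a \<Rightarrow> real \<Rightarrow> bool" for x where
  reach_start: "reach x 0 x 0"
| reach_step: "reach x t p e \<Longrightarrow> c \<in> A \<Longrightarrow> t < t' \<Longrightarrow>
    (\<And>\<tau>. \<tau> \<in> {t..t'} \<Longrightarrow> (\<xi> has_vector_derivative \<xi>' \<tau>) (at \<tau> within {t..t'})) \<Longrightarrow>
    continuous_on {t..t'} \<xi>' \<Longrightarrow> \<xi> ` {t..t'} \<subseteq> chart_image c \<Longrightarrow> chart_inv c (\<xi> t) = p \<Longrightarrow>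
    reach x t' (chart_inv c (\<xi> t')) (e + integral {t..t'} (\<lambda>\<tau>. ip c (\<xi> \<tau>) (\<xi>' \<tau>) (\<xi>' \<tau>)))"

abbreviation speed2 where "speed2 \<gamma> t \<equiv> g (\<gamma> t) (velocity A \<gamma> t) (velocity A \<gamma> t)"

lemma speed2_cong:
  assumes "open T" "t \<in> T" "\<And>s. s \<in> T \<Longrightarrow> \<gamma> s = \<gamma>' s"
  shows "speed2 \<gamma> t = speed2 \<gamma>' t"
  using velocity_cong[OF assms, of "\<lambda>s. s"] assms by simp

lemma speed2_chart:
  assumes c: "c \<in> A" and t: "a < t" "t < b"
    and \<xi>: "(\<xi> has_vector_derivative v) (at t within {a..b})"
    and im: "\<xi> ` {a..b} \<subseteq> chart_image c" and cont: "continuous_on {a..b} \<xi>"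
    and \<gamma>: "\<And>s. s \<in> {a..b} \<Longrightarrow> \<gamma> s = chart_inv c (\<xi> s)"
  shows "speed2 \<gamma> t = ip c (\<xi> t) v v"
proof -
  have \<xi>t: "\<xi> t \<in> chart_image c" using im t by auto
  let ?\<gamma> = "\<lambda>s. chart_inv c (\<xi> s)"
  have i: "at t within {a..b} = at t" using t by (intro at_within_interior) simp
  have "((snd c \<circ> ?\<gamma>) has_vector_derivative v) (at t)"
  proof (rule has_vector_derivative_transform_within_open[OF \<xi>[unfolded i] open_greaterThanLessThan])
    show "t \<in> {a<..<b}" using t by simp
    show "\<xi> s = (snd c \<circ> ?\<gamma>) s" if "s \<in> {a<..<b}" for s
      using c im that by (auto simp: image_subset_iff)
  qed
  moreover have "isCont ?\<gamma> t"
    using continuous_on_interior[OF continuous_on_compose2[OF continuous_chart_inv[OF c] cont im], of t] t by simp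
  ultimately have "velocity A ?\<gamma> t = tv c (?\<gamma> t) v"
    using c \<xi>t by (intro velocity_tv) auto
  then have "speed2 ?\<gamma> t = ip c (\<xi> t) v v"
    using g_tv_ip[OF c, of "?\<gamma> t" v v] c \<xi>t by simp
  then show ?thesis
    using speed2_cong[of "{a<..<b}" t \<gamma> ?\<gamma>] \<gamma> t by simp
qed

lemma reach_curve:
  assumes "reach x T p e"
  shows "0 \<le> T \<and> (\<exists>\<gamma> S. continuous_on {0..T} \<gamma> \<and> finite S \<and>
     (\<forall>a b. 0 \<le> a \<and> a < b \<and> b \<le> T \<and> {a<..<b} \<inter> S = {} \<longrightarrow> C1_curve_on A a b \<gamma>) \<and>
     \<gamma> 0 = x \<and> \<gamma> T = p \<and> (speed2 \<gamma> has_integral e) {0..T})"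
  using assms
proof (induction rule: reach.induct)
  case reach_start
  show ?case by (intro conjI exI[of _ "\<lambda>_. x"] exI[of _ "{}"]) auto
next
  case (reach_step T p e c T' \<xi> \<xi>')
  then obtain \<gamma> S where \<gamma>: "0 \<le> T" "continuous_on {0..T} \<gamma>" "finite S"
     "\<And>a b. 0 \<le> a \<Longrightarrow> a < b \<Longrightarrow> b \<le> T \<Longrightarrow> {a<..<b} \<inter> S = {} \<Longrightarrow> C1_curve_on A a b \<gamma>"
     "\<gamma> 0 = x" "\<gamma> T = p" "(speed2 \<gamma> has_integral e) {0..T}"
    by blast
  note c = reach_step.hyps(2) and TT' = reach_step.hyps(3) and \<xi> = reach_step.hyps(4)
    and \<xi>' = reach_step.hyps(5) and im = reach_step.hyps(6) and p = reach_step.hyps(7)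
  interpret M: chart_metric "chart_image c" "G c" by (rule chart_metric_chart[OF c])
  define \<delta> where "\<delta> t = (if t \<le> T then \<gamma> t else chart_inv c (\<xi> t))" for t
  have \<delta>1: "\<delta> t = \<gamma> t" if "t \<in> {0..T}" for t using that by (simp add: \<delta>_def)
  have \<delta>2: "\<delta> t = chart_inv c (\<xi> t)" if "t \<in> {T..T'}" for t
    using that p \<gamma>(6) by (cases "t = T") (auto simp: \<delta>_def)
  have \<xi>c: "continuous_on {T..T'} \<xi>" by (rule continuous_on_vector_derivative[OF \<xi>])
  have 1: "continuous_on {0..T} \<delta>" using \<gamma>(2) by (rule iffD1[OF continuous_on_cong, rotated 2]) (auto simp: \<delta>1)
  have 2: "continuous_on {T..T'} \<delta>"
    by (rule iffD1[OF continuous_on_cong, rotated 2,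
       OF continuous_on_compose2[OF continuous_chart_inv[OF c] \<xi>c im]]) (auto simp: \<delta>2)
  have U: "{0..T} \<union> {T..T'} = {0..T'}" using \<gamma>(1) TT' by auto
  show ?case
  proof (intro conjI exI[of _ \<delta>] exI[of _ "insert T S"] allI impI)
    show "0 \<le> T'" using \<gamma>(1) TT' by simp
    show "continuous_on {0..T'} \<delta>"
      using continuous_on_closed_Un[OF _ _ 1 2] by (simp add: U)
    show "finite (insert T S)" using \<gamma>(3) by simp
    show "\<delta> 0 = x" using \<delta>1[of 0] \<gamma>(1,5) by simp
    show "\<delta> T' = chart_inv c (\<xi> T')" using \<delta>2[of T'] TT' by simp
    fix a b assume ab: "0 \<le> a \<and> a < b \<and> b \<le> T' \<and> {a<..<b} \<inter> insert T S = {}"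
    then consider "b \<le> T" | "T \<le> a" by force
    then show "C1_curve_on A a b \<delta>"
    proof cases
      case 1
      show ?thesis
        by (rule C1_curve_on_cong[OF \<gamma>(4)]) (use ab 1 \<delta>1 in auto)
    next
      case 2
      have sub: "{a..b} \<subseteq> {T..T'}" using ab 2 by auto
      have "C1_curve_on A a b (\<lambda>t. chart_inv c (\<xi> t))"
      proof (rule C1_chart_curve[OF c])
        show "(\<xi> has_vector_derivative \<xi>' t) (at t within {a..b})" if "t \<in> {a..b}" for t
          by (rule has_vector_derivative_within_subset[OF \<xi> sub]) (use that sub in auto)
        show "continuous_on {a..b} \<xi>'" by (rule continuous_on_subset[OF \<xi>' sub])
      qed (use ab sub im in auto)
      then show ?thesis by (rule C1_curve_on_cong) (use sub \<delta>2 in auto)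
    qed
  next
    \<comment> \<open>\<open>velocity\<close> is defined by a two-sided derivative, which says
      nothing at a corner or at an end of the interval; these points are discarded as a finite
      set.\<close>
    have "(speed2 \<delta> has_integral e) {0..T}"
    proof (rule has_integral_spike_finite[OF _ _ \<gamma>(7)])
      show "finite {0, T}" by simp
      show "speed2 \<delta> t = speed2 \<gamma> t" if "t \<in> {0..T} - {0, T}" for t
        by (rule speed2_cong[of "{0<..<T}"]) (use that \<delta>1 in auto)
    qed
    moreover have "(speed2 \<delta> has_integral integral {T..T'} (\<lambda>\<tau>. ip c (\<xi> \<tau>) (\<xi>' \<tau>) (\<xi>' \<tau>))) {T..T'}"
    proof (rule has_integral_spike_finite)
      show "((\<lambda>\<tau>. ip c (\<xi> \<tau>) (\<xi>' \<tau>) (\<xi>' \<tau>)) has_integral integral {T..T'} (\<lambda>\<tau>. ip c (\<xi> \<tau>) (\<xi>' \<tau>) (\<xi>' \<tau>))) {T..T'}"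
        by (intro integrable_integral integrable_continuous_real M.continuous_on_ip \<xi>c \<xi>' im)
      show "finite {T, T'}" by simp
      show "speed2 \<delta> t = ip c (\<xi> t) (\<xi>' t) (\<xi>' t)" if "t \<in> {T..T'} - {T, T'}" for t
        by (rule speed2_chart[OF c _ _ \<xi> im \<xi>c \<delta>2]) (use that in auto)
    qed
    ultimately show "(speed2 \<delta> has_integral e + integral {T..T'} (\<lambda>\<tau>. ip c (\<xi> \<tau>) (\<xi>' \<tau>) (\<xi>' \<tau>))) {0..T'}"
      using has_integral_combine[OF \<gamma>(1) less_imp_le[OF TT']] by blast
  qed
qed

text \<open>A whole interval around \<open>t\<close> avoids the break points, so the velocity is a
  genuine tangent vector there and the positivity of the metric applies.\<close>

lemma piecewise_speed2_nonneg:
  assumes S: "finite S" "\<And>a b. 0 \<le> a \<Longrightarrow> a < b \<Longrightarrow> b \<le> 1 \<Longrightarrow> {a<..<b} \<inter> S = {} \<Longrightarrow> C1_curve_on A a b \<gamma>"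
    and t: "t \<in> {0..1} - insert 0 (insert 1 S)"
  shows "speed2 \<gamma> t \<ge> 0"
proof -
  have "open ({0<..<1} - S)" using S(1) by (intro open_Diff finite_imp_closed) auto
  moreover have "t \<in> {0<..<1} - S" using t by auto
  ultimately obtain r where r: "r > 0" "cball t r \<subseteq> {0<..<1} - S"
    using open_contains_cball by blast
  then have "{t - r..t + r} \<subseteq> {0<..<1} - S" by (simp add: cball_eq_atLeastAtMost)
  note sub = this
  have e: "t - r \<in> {t - r..t + r}" "t + r \<in> {t - r..t + r}" using r(1) by auto
  have "C1_curve_on A (t - r) (t + r) \<gamma>"
  proof (rule S(2))
    show "0 \<le> t - r" "t + r \<le> 1" using subsetD[OF sub e(1)] subsetD[OF sub e(2)] by auto
    show "{t - r<..<t + r} \<inter> S = {}" using sub by (auto simp: subset_iff)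
  qed (use r(1) in simp)
  then show ?thesis using velocity_tangent[of "t - r" "t + r" \<gamma> t] r(1) g_nonneg by simp
qed

text \<open>This bounds from below the set of lengths whose infimum is the distance.\<close>

lemma curve_length_nonneg:
  assumes "piecewise_C1_curve A \<gamma>" shows "curve_length A g \<gamma> \<ge> 0"
proof -
  obtain S where S: "finite S" "\<And>a b. 0 \<le> a \<Longrightarrow> a < b \<Longrightarrow> b \<le> 1 \<Longrightarrow> {a<..<b} \<inter> S = {} \<Longrightarrow> C1_curve_on A a b \<gamma>"
    using assms unfolding piecewise_C1_curve_def by blast
  let ?S = "insert 0 (insert 1 S)"
  have nn: "speed2 \<gamma> t \<ge> 0" if "t \<in> {0..1} - ?S" for t
    by (rule piecewise_speed2_nonneg[OF S(1) _ that]) (rule S(2))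
  let ?f = "\<lambda>t. if t \<in> ?S then 0 else sqrt (speed2 \<gamma> t)"
  have "curve_length A g \<gamma> = integral {0..1} ?f"
    unfolding curve_length_def using S(1) by (intro integral_spike[of ?S] negligible_finite) auto
  also have "\<dots> \<ge> 0"
  \<comment> \<open>A function that is not integrable has integral 0 by convention, which agrees
    with the bound.\<close>
  proof (cases "?f integrable_on {0..1}")
    case True
    have "0 \<le> ?f t" if "t \<in> {0..1}" for t
    proof (cases "t \<in> ?S")
      case False
      with that have "t \<in> {0..1} - ?S" by (rule DiffI)
      then show ?thesis unfolding if_not_P[OF False] by (simp only: real_sqrt_ge_zero nn)
    qed simp
    with True show ?thesis by (rule integral_nonneg)
  qed (simp add: not_integrable_integral)
  finally show ?thesis .
qed

lemma dist_le_length: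
  assumes "piecewise_C1_curve A \<gamma>" "\<gamma> 0 = p" "\<gamma> 1 = q"
  shows "riemannian_dist A g p q \<le> curve_length A g \<gamma>"
  unfolding riemannian_dist_def
  by (rule cInf_lower) (use assms curve_length_nonneg in \<open>auto simp: bdd_below_def\<close>)

text \<open>Length is bounded by the root of the energy through sqrt q <= (q / k + k) / 2 with k =
  sqrt e. For the lower bound the infimum must be over a nonempty set, which the curve
  guarantees.\<close>

lemma reach_dist:
  assumes "reach x 1 p e"
  shows "riemannian_dist A g x p \<le> sqrt e" "0 \<le> e" "0 \<le> riemannian_dist A g x p"
proof -
  obtain \<gamma> S where \<gamma>: "continuous_on {0..1} \<gamma>" "finite S"
     "\<And>a b. 0 \<le> a \<Longrightarrow> a < b \<Longrightarrow> b \<le> 1 \<Longrightarrow> {a<..<b} \<inter> S = {} \<Longrightarrow> C1_curve_on A a b \<gamma>"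
     "\<gamma> 0 = x" "\<gamma> 1 = p" "(speed2 \<gamma> has_integral e) {0..1}"
    using reach_curve[OF assms] by blast
  have pw: "piecewise_C1_curve A \<gamma>" unfolding piecewise_C1_curve_def using \<gamma> by blast
  show "0 \<le> riemannian_dist A g x p"
    unfolding riemannian_dist_def
    by (rule cInf_greatest) (use pw \<gamma>(4,5) curve_length_nonneg in auto)
  let ?S = "insert 0 (insert 1 S)"
  define q where "q t = (if t \<in> ?S then 0 else speed2 \<gamma> t)" for t
  have q0: "q t \<ge> 0" if "t \<in> {0..1}" for t
  proof (cases "t \<in> ?S")
    case False
    with that have "t \<in> {0..1} - ?S" by (rule DiffI)
    then have "speed2 \<gamma> t \<ge> 0"
      by (rule piecewise_speed2_nonneg[OF \<gamma>(2), rotated]) (rule \<gamma>(3))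
    then show ?thesis by (simp add: q_def)
  qed (simp add: q_def)
  have q: "(q has_integral e) {0..1}"
    by (rule has_integral_spike_finite[OF _ _ \<gamma>(6), of ?S]) (use \<gamma>(2) in \<open>auto simp: q_def\<close>)
  show e0: "0 \<le> e" by (rule has_integral_nonneg[OF q q0])
  let ?L = "integral {0..1} (\<lambda>t. sqrt (q t))"
  have L: "curve_length A g \<gamma> = ?L"
    unfolding curve_length_def using \<gamma>(2) by (intro integral_spike[of ?S] negligible_finite) (auto simp: q_def)
  have bound: "?L \<le> (e / k + k) / 2" if k: "k > 0" for k
  proof (cases "(\<lambda>t. sqrt (q t)) integrable_on {0..1}")
    case True
    have i: "((\<lambda>t. (q t / k + k) / 2) has_integral (e / k + k * (1 - 0)) / 2) {0..1}"
      using q by (intro has_integral_divide has_integral_add has_integral_const_real)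
        (auto intro: has_integral_eq_rhs[OF has_integral_const_real])
    have le: "sqrt (q t) \<le> (q t / k + k) / 2" if "t \<in> {0..1}" for t
    proof -
      have "0 \<le> (sqrt (q t) - k)\<^sup>2" by simp
      also have "\<dots> = q t + k\<^sup>2 - 2 * sqrt (q t) * k" using q0[OF that] by (simp add: power2_diff)
      finally show ?thesis using k by (simp add: field_simps power2_eq_square)
    qed
    show ?thesis using has_integral_le[OF integrable_integral[OF True] i le] by simp
  next
    case False
    then show ?thesis using e0 k by (simp add: not_integrable_integral)
  qed
  have "?L \<le> sqrt e"
  \<comment> \<open>For \<open>e = 0\<close> the optimal \<open>k\<close> is not positive, so
    \<open>k\<close> tends to 0 instead.\<close>
  proof (cases "e = 0")
    case True
    have "?L \<le> 0"
    proof (rule field_le_epsilon)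
      show "?L \<le> 0 + k" if "0 < k" for k using bound[OF that] True that by simp
    qed
    then show ?thesis using True by simp
  next
    case False
    then have "sqrt e > 0" using e0 by simp
    moreover from this have "e / sqrt e = sqrt e" by (simp add: real_div_sqrt e0)
    ultimately show ?thesis using bound[of "sqrt e"] by simp
  qed
  then show "riemannian_dist A g x p \<le> sqrt e"
    using dist_le_length[OF pw \<gamma>(4,5)] L by simp
qed

end

text \<open>Gram-Schmidt by induction over sets of indices: fewer than n vectors do not span the
  space, and a vector outside their span minus its projection gives the next direction.\<close>

lemma (in chart_metric) onb_exists:
  assumes x: "x \<in> U" obtains e where "onb x e"
proof -
  have "\<exists>e. \<forall>i\<in>I. \<forall>j\<in>I. ip x (e i) (e j) = (if i = j then 1 else 0)" for I :: "'n set"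
  proof (induction I rule: finite_induct[OF finite_class.finite])
    case 1
    then show ?case by simp
  next
    case (2 k I)
    then obtain e where e: "\<And>i j. i \<in> I \<Longrightarrow> j \<in> I \<Longrightarrow> ip x (e i) (e j) = (if i = j then 1 else 0)"
      by blast
    have "dim (span (e ` I)) \<le> card I"
      using dim_le_card'[of "e ` I"] card_image_le[of I e] by simp
    also have "\<dots> < CARD('n)" using 2 by (intro psubset_card_mono) auto
    finally have "span (e ` I) \<noteq> (UNIV :: (real^'n) set)" by (metis dim_UNIV DIM_cart DIM_real mult.right_neutral less_irrefl)
    then obtain v where v: "v \<notin> span (e ` I)" by blast
    define w where "w = v - (\<Sum>i\<in>I. ip x v (e i) *\<^sub>R e i)"
    have "w \<noteq> 0"
    proof
      assume "w = 0"
      then have "v = (\<Sum>i\<in>I. ip x v (e i) *\<^sub>R e i)" by (simp add: w_def)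
      also have "\<dots> \<in> span (e ` I)" by (intro span_sum span_scale span_base) auto
      finally show False using v by simp
    qed
    then have pos: "ip x w w > 0" by (rule ip_pos[OF x])
    have w: "ip x w (e j) = 0" if "j \<in> I" for j
    proof -
      have "(\<Sum>i\<in>I. ip x v (e i) * ip x (e i) (e j)) = (\<Sum>i\<in>I. if i = j then ip x v (e j) else 0)"
        by (rule sum.cong[OF refl]) (use e that in auto)
      then show ?thesis using that by (simp add: w_def ip_minus ip_sum ip_lin)
    qed
    define e' where "e' = e(k := (1 / sqrt (ip x w w)) *\<^sub>R w)"
    have "ip x (e' i) (e' j) = (if i = j then 1 else 0)" if "i \<in> insert k I" "j \<in> insert k I" for i j
      using that e w pos 2 ip_sym[OF x, of "e i" w] by (auto simp: e'_def ip_lin)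
    then show ?case by blast
  qed
  from this[of UNIV] obtain e :: "'n \<Rightarrow> real^'n" where e: "\<forall>i\<in>UNIV. \<forall>j\<in>UNIV. ip x (e i) (e j) = (if i = j then 1 else 0)" ..
  show ?thesis by (rule that[of e]) (use e in \<open>simp add: onb_def\<close>)
qed

section \<open>The gradient in a chart\<close>

context riem
begin

lemma smooth_fun_chart:
  assumes "smooth_fun_on A UNIV f" "c \<in> A"
  shows "smooth_on (chart_image c) (f \<circ> chart_inv c)"
  using assms unfolding smooth_fun_on_def chart_image_def by force

lemma chart_function_chart:
  assumes "smooth_fun_on A UNIV f" "c \<in> A"
  shows "chart_function (chart_image c) (G c) (f \<circ> chart_inv c)"
  by (intro chart_function.intro chart_metric_chart chart_function_axioms.intro smooth_fun_chart assms)

abbreviation gradX where "gradX f c \<equiv> chart_function.X (G c) (f \<circ> chart_inv c)"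

text \<open>\<open>ip_X\<close> shows that the chart gradient satisfies the description in
  \<open>gradient\<close>, and positive definiteness makes it the only such vector.\<close>

lemma gradient_eq:
  assumes f: "smooth_fun_on A UNIV f" and c: "c \<in> A" "p \<in> fst c"
  shows "gradient A g f p = tv c p (gradX f c (snd c p))"
proof -
  interpret F: chart_function "chart_image c" "G c" "f \<circ> chart_inv c"
    by (rule chart_function_chart[OF f c(1)])
  have x: "snd c p \<in> chart_image c" using c by simp
  have sf: "smooth_near A p f" using f unfolding smooth_near_def by blast
  let ?v = "tv c p (F.X (snd c p))"
  have v: "?v \<in> tangent_space A p" by (rule tv_tangent[OF c])
  have vw: "g p ?v w = w f" if "w \<in> tangent_space A p" for w
  proof -
    have "g p ?v w = g p ?v (tv c p (\<chi> i. component c w i))" using tangent_tv[OF c that] by simp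
    also have "\<dots> = tv c p (\<chi> i. component c w i) f"
      using sf by (simp add: g_tv_ip[OF c] F.ip_X[OF x] tv_apply F.dF_def)
    finally show ?thesis using tangent_tv[OF c that] by simp
  qed
  show ?thesis
    unfolding gradient_def
  proof (rule the_equality)
    fix u assume u: "u \<in> tangent_space A p \<and> (\<forall>w\<in>tangent_space A p. g p u w = w f)"
    obtain a where a: "u = tv c p a" using tangent_tv[OF c, of u] u by blast
    have "a = F.X (snd c p)"
    proof (rule F.ip_eqI[OF x])
      fix w
      have "g p u (tv c p w) = g p ?v (tv c p w)"
        using u vw tv_tangent[OF c] by simp
      then show "ip c (snd c p) a w = ip c (snd c p) (F.X (snd c p)) w"
        by (simp add: a g_tv_ip[OF c])
    qed
    then show "u = ?v" by (simp add: a)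
  qed (use v vw in blast)
qed

lemma f_laplacian_chart:
  assumes f: "smooth_fun_on A UNIV f" and c: "c \<in> A" "x \<in> chart_image c"
  shows "f_laplacian A g f c f (chart_inv c x) =
    (\<Sum>i\<in>UNIV. \<Sum>j\<in>UNIV. matrix_inv (G c x) $ i $ j * hessian (G c) (f \<circ> chart_inv c) i j x)
     - ip c x (gradX f c x) (gradX f c x)"
  using c by (simp add: Let_def f_laplacian_def laplacian_def gradient_eq[OF f, of c] g_tv_ip)

lemma ricci_chart:
  assumes "bakry_emery_ricci_nonneg A g f m" and c: "c \<in> A" "x \<in> chart_image c"
  shows "form2 (\<lambda>i j. ricci (G c) i j x + hessian (G c) (f \<circ> chart_inv c) i j x
    - 1/m * (partial i (f \<circ> chart_inv c) x * partial j (f \<circ> chart_inv c) x)) v v \<ge> 0"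
proof -
  let ?p = "chart_inv c x"
  have p: "?p \<in> fst c" using c by simp
  have "0 \<le> bakry_emery_ricci A g f m c ?p (tv c ?p v) (tv c ?p v)"
    using assms(1) c(1) p tv_tangent[OF c(1) p] unfolding bakry_emery_ricci_nonneg_def by blast
  then show ?thesis
    using c by (simp add: bakry_emery_ricci_def Let_def component_tv[OF c(1) p] form2_def form1_def
       sum_distrib_left mult_ac)
qed

text \<open>Passing from \<open>c\<close> to \<open>d\<close> and back does not change the tangent
  vector, and its components in \<open>c\<close> are unique; this takes the place of the chain rule
  for the two transition maps.\<close>

lemma trans_inverse:
  assumes c: "c \<in> A" "p \<in> fst c" and d: "d \<in> A" "p \<in> fst d"
  shows "dvec (transition d c) (snd d p) (dvec (transition c d) (snd c p) a) = a"
proof -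
  have "tv c p a = tv c p (dvec (transition d c) (snd d p) (dvec (transition c d) (snd c p) a))"
    by (subst tv_trans[OF c d], subst tv_trans[OF d c]) simp
  then have "a $ i = dvec (transition d c) (snd d p) (dvec (transition c d) (snd c p) a) $ i" for i
    using component_tv[OF c] by metis
  then show ?thesis by (simp add: vec_eq_iff)
qed

end

section \<open>Geodesics\<close>

locale geodesic_curve = riem A g for A :: "('a::{t2_space, second_countable_topology}, 'n::finite) chart set"
    and g :: "'a metric" +
  fixes \<gamma> :: "real \<Rightarrow> 'a"
  assumes geo: "geodesic A g \<gamma>"
begin

definition xc where "xc c t = snd c (\<gamma> t)"
definition pc where "pc c t = vector_derivative (snd c \<circ> \<gamma>) (at t within {0..1})"

lemma xc_mem: "c \<in> A \<Longrightarrow> \<gamma> t \<in> fst c \<Longrightarrow> xc c t \<in> chart_image c"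
  by (simp add: xc_def)

lemma \<gamma>_continuous: "continuous_on {0..1} \<gamma>"
  using geo by (simp add: geodesic_def)

lemma xc_deriv:
  assumes "c \<in> A" "t \<in> {0..1}" "\<gamma> t \<in> fst c"
  shows "(xc c has_vector_derivative pc c t) (at t within {0..1})"
    "(pc c has_vector_derivative - Gam c (xc c t) (pc c t) (pc c t)) (at t within {0..1})"
proof -
  interpret M: chart_metric "chart_image c" "G c" by (rule chart_metric_chart[OF assms(1)])
  have "(snd c \<circ> \<gamma>) differentiable (at t within {0..1})"
    using geo assms unfolding geodesic_def Let_def by blast
  then show "(xc c has_vector_derivative pc c t) (at t within {0..1})"
    by (simp add: vector_derivative_works pc_def xc_def[abs_def] o_def)
  have "((\<lambda>s. vector_derivative (snd c \<circ> \<gamma>) (at s within {0..1})) has_vector_derivative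
      (\<chi> k. - (\<Sum>i\<in>UNIV. \<Sum>j\<in>UNIV. christoffel (G c) k i j ((snd c \<circ> \<gamma>) t) *
         vector_derivative (snd c \<circ> \<gamma>) (at t within {0..1}) $ i *
         vector_derivative (snd c \<circ> \<gamma>) (at t within {0..1}) $ j))) (at t within {0..1})"
    using geo assms unfolding geodesic_def Let_def by blast
  moreover have "(\<chi> k. - (\<Sum>i\<in>UNIV. \<Sum>j\<in>UNIV. christoffel (G c) k i j (xc c t) * pc c t $ i * pc c t $ j))
     = - M.Gam (xc c t) (pc c t) (pc c t)"
    by (simp add: vec_eq_iff M.Gam_def form2_def form1_def sum_distrib_left mult_ac)
  ultimately show "(pc c has_vector_derivative - M.Gam (xc c t) (pc c t) (pc c t)) (at t within {0..1})"
    by (simp add: pc_def[abs_def] xc_def)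
qed

lemma xc_deriv_sub:
  assumes "c \<in> A" "{a..b} \<subseteq> {0..1}" "\<gamma> ` {a..b} \<subseteq> fst c" "t \<in> {a..b}"
  shows "(xc c has_vector_derivative pc c t) (at t within {a..b})"
    "(pc c has_vector_derivative - Gam c (xc c t) (pc c t) (pc c t)) (at t within {a..b})"
  using xc_deriv[OF assms(1), of t] assms has_vector_derivative_within_subset[OF _ assms(2)] by (auto simp: subset_iff image_subset_iff)

lemma nearby_chart:
  assumes "c \<in> A" "t \<in> {0..1}" "\<gamma> t \<in> fst c"
  obtains r where "0 < r" "\<And>s. s \<in> {0..1} \<Longrightarrow> \<bar>s - t\<bar> < r \<Longrightarrow> \<gamma> s \<in> fst c"
proof -
  have "openin (top_of_set {0..1}) ({0..1} \<inter> \<gamma> -` fst c)"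
    using continuous_openin_preimage_gen[OF \<gamma>_continuous open_chart(1)[OF assms(1)]] .
  moreover have "t \<in> {0..1} \<inter> \<gamma> -` fst c" using assms by auto
  ultimately obtain r where "r > 0" "ball t r \<inter> {0..1} \<subseteq> {0..1} \<inter> \<gamma> -` fst c"
    using openin_contains_ball by metis
  then show ?thesis using that[of r] by (auto simp: dist_real_def abs_minus_commute subset_iff)
qed

lemma pc_trans:
  assumes c: "c \<in> A" "\<gamma> t \<in> fst c" and d: "d \<in> A" "\<gamma> t \<in> fst d" and t: "t \<in> {0..1}"
  shows "pc d t = dvec (transition c d) (xc c t) (pc c t)"
proof -
  obtain r where r: "0 < r" "\<And>s. s \<in> {0..1} \<Longrightarrow> \<bar>s - t\<bar> < r \<Longrightarrow> \<gamma> s \<in> fst c"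
    using nearby_chart[OF c(1) t c(2)] by blast
  have o: "xc c t \<in> overlap c d" using c d by (simp add: overlap_iff xc_def)
  have "((\<lambda>s. transition c d (xc c s)) has_vector_derivative dvec (transition c d) (xc c t) (pc c t)) (at t within {0..1})"
    by (rule dvec_along[OF trans_diff(1)[OF c(1) d(1) o] xc_deriv(1)[OF c(1) t c(2)]])
  then have "((snd d \<circ> \<gamma>) has_vector_derivative dvec (transition c d) (xc c t) (pc c t)) (at t within {0..1})"
    by (rule has_vector_derivative_transform_within[OF _ r(1) t])
      (use r(2) c in \<open>simp add: transition_def xc_def dist_real_def\<close>)
  then show ?thesis
    unfolding pc_def[of d] using vector_derivative_within_cbox[of 0 1 t] t by auto
qed

lemma ip_pc_trans:
  assumes c: "c \<in> A" "\<gamma> t \<in> fst c" and d: "d \<in> A" "\<gamma> t \<in> fst d" and t: "t \<in> {0..1}"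
  shows "ip c (xc c t) a (pc c t) = ip d (xc d t) (dvec (transition c d) (xc c t) a) (pc d t)"
proof -
  have o: "xc c t \<in> overlap c d" using c d by (simp add: overlap_iff xc_def)
  have "transition c d (xc c t) = xc d t" using c by (simp add: transition_def xc_def)
  then show ?thesis using ip_trans[OF c(1) d(1) o] pc_trans[OF assms] by simp
qed

lemma speed_constant:
  obtains L2 where "\<And>c t. c \<in> A \<Longrightarrow> t \<in> {0..1} \<Longrightarrow> \<gamma> t \<in> fst c \<Longrightarrow> ip c (xc c t) (pc c t) (pc c t) = L2"
proof -
  \<comment> \<open>One chart may not cover the geodesic. A choice of charts gives a single function
    \<open>sp\<close> on \<open>{0..1}\<close>, which by \<open>ip_pc_trans\<close> agrees with the
    squared speed in every chart, so a local computation shows that its derivative is zero.\<close>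
  define ch where "ch t = (SOME c. c \<in> A \<and> \<gamma> t \<in> fst c)" for t
  have ch: "ch t \<in> A" "\<gamma> t \<in> fst (ch t)" for t
  proof -
    obtain c where "c \<in> A" "\<gamma> t \<in> fst c" by (rule chart_exists)
    then have "\<exists>c. c \<in> A \<and> \<gamma> t \<in> fst c" by blast
    from someI_ex[OF this] show "ch t \<in> A" "\<gamma> t \<in> fst (ch t)" unfolding ch_def by auto
  qed
  define sp where "sp t = ip (ch t) (xc (ch t) t) (pc (ch t) t) (pc (ch t) t)" for t
  have sp: "sp t = ip c (xc c t) (pc c t) (pc c t)" if "c \<in> A" "\<gamma> t \<in> fst c" "t \<in> {0..1}" for c t
    using ip_pc_trans[OF ch that(1,2,3), of "pc (ch t) t"] pc_trans[OF ch that(1,2,3)] by (simp add: sp_def)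
  have "(sp has_derivative (\<lambda>h. 0)) (at t within {0..1})" if t: "t \<in> {0..1}" for t
  proof -
    obtain c where c: "c \<in> A" "\<gamma> t \<in> fst c" by (rule chart_exists)
    interpret M: chart_metric "chart_image c" "G c" by (rule chart_metric_chart[OF c(1)])
    obtain r where r: "0 < r" "\<And>s. s \<in> {0..1} \<Longrightarrow> \<bar>s - t\<bar> < r \<Longrightarrow> \<gamma> s \<in> fst c"
      using nearby_chart[OF c(1) t c(2)] by blast
    note x = xc_deriv[OF c(1) t c(2)]
    have "((\<lambda>s. ip c (xc c s) (pc c s) (pc c s)) has_real_derivative 0) (at t within {0..1})"
      by (rule DERIV_cong[OF M.ip_deriv_cov[OF xc_mem[OF c] x(1) x(2) x(2)]]) (simp add: M.ip_lin)
    then have "(sp has_real_derivative 0) (at t within {0..1})"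
      by (rule has_field_derivative_transform_within[OF _ r(1) t])
        (use r(2) c in \<open>simp add: sp dist_real_def\<close>)
    then show ?thesis by (simp add: has_field_derivative_def lambda_zero)
  qed
  then have "sp t = sp 0" if "t \<in> {0..1}" for t
    using has_derivative_zero_unique[of "{0..1}" sp t 0] that by auto
  then show ?thesis using that[of "sp 0"] sp by metis
qed

lemma minimal_geodesic_dist:
  assumes L2: "\<And>c t. c \<in> A \<Longrightarrow> t \<in> {0..1} \<Longrightarrow> \<gamma> t \<in> fst c \<Longrightarrow> ip c (xc c t) (pc c t) (pc c t) = L2"
    and min: "curve_length A g \<gamma> = riemannian_dist A g p q"
  shows "riemannian_dist A g p q = sqrt L2" "0 \<le> L2"
proof -
  have sp: "speed2 \<gamma> t = L2" if t: "t \<in> {0<..<1}" for t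
  proof -
    obtain c where c: "c \<in> A" "\<gamma> t \<in> fst c" by (rule chart_exists)
    have t': "t \<in> {0..1}" using t by auto
    have i: "at t within {0..1} = at t" using t by (intro at_within_interior) simp
    have "isCont \<gamma> t" using continuous_on_interior[OF \<gamma>_continuous, of t] t by simp
    then have "velocity A \<gamma> t = tv c (\<gamma> t) (pc c t)"
      using xc_deriv(1)[OF c(1) t' c(2)] by (intro velocity_tv[where \<gamma>=\<gamma>, OF c]) (simp_all add: i xc_def[abs_def] o_def)
    then show ?thesis using L2[OF c(1) t' c(2)] g_tv_ip[OF c] by (simp add: xc_def)
  qed
  have "curve_length A g \<gamma> = integral {0..1} (\<lambda>t::real. sqrt L2)"
    unfolding curve_length_def
    by (rule integral_spike[of "{0,1}"]) (auto simp: sp)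
  then show "riemannian_dist A g p q = sqrt L2" using min by simp
  obtain c where c: "c \<in> A" "\<gamma> 0 \<in> fst c" by (rule chart_exists)
  interpret M: chart_metric "chart_image c" "G c" by (rule chart_metric_chart[OF c(1)])
  show "0 \<le> L2" using L2[OF c(1) _ c(2)] M.ip_nonneg[OF xc_mem[OF c]] by (metis atLeastAtMost_iff order_refl zero_le_one)
qed

end

section \<open>Variations of a geodesic\<close>

definition C2_path :: "real \<Rightarrow> (real \<Rightarrow> real^'n::finite) \<Rightarrow> (real \<Rightarrow> real^'n) \<Rightarrow> (real \<Rightarrow> real^'n) \<Rightarrow> bool" where
  "C2_path \<eta> q q1 q2 \<longleftrightarrow> 0 < \<eta> \<and>
    (\<forall>s. \<bar>s\<bar> < \<eta> \<longrightarrow> (q has_vector_derivative q1 s) (at s) \<and> (q1 has_vector_derivative q2 s) (at s)) \<and>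
    continuous_on {-\<eta><..<\<eta>} q2"

locale bakry_emery_geodesic = geodesic_curve A g \<gamma>
  for A :: "('a::{t2_space, second_countable_topology}, 'n::finite) chart set"
    and g :: "'a metric" and \<gamma> :: "real \<Rightarrow> 'a" +
  fixes f :: "'a \<Rightarrow> real" and m L2 :: real
  assumes f: "smooth_fun_on A UNIV f"
    and m: "0 < m"
    and ric: "bakry_emery_ricci_nonneg A g f m"
    and L2: "\<And>c t. c \<in> A \<Longrightarrow> t \<in> {0..1} \<Longrightarrow> \<gamma> t \<in> fst c \<Longrightarrow> ip c (xc c t) (pc c t) (pc c t) = L2"
begin

text \<open>\<open>variation c t v B\<close>: curves from \<open>\<gamma> 0\<close> to the points of a path through \<open>\<gamma> t\<close> with velocity \<open>v\<close>
  can be chosen such that their energy on \<open>[0,t]\<close> has second derivative \<open>B\<close>, up to the boundary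
  term coming from the covariant acceleration of the path.\<close>

definition variation where
  "variation c t v B \<longleftrightarrow> (\<forall>\<eta> q q1 q2. C2_path \<eta> q q1 q2 \<longrightarrow> q 0 = xc c t \<longrightarrow> q1 0 = v \<longrightarrow>
    (t = 0 \<longrightarrow> (\<forall>s. q s = xc c t)) \<longrightarrow>
    (\<exists>\<delta> \<epsilon> \<epsilon>1. 0 < \<delta> \<and> (\<forall>s. \<bar>s\<bar> < \<delta> \<longrightarrow> reach (\<gamma> 0) t (chart_inv c (q s)) (\<epsilon> s)) \<and>
      (\<forall>s. \<bar>s\<bar> < \<delta> \<longrightarrow> (\<epsilon> has_real_derivative \<epsilon>1 s) (at s)) \<and>
      (\<epsilon>1 has_real_derivative B + 2 * ip c (xc c t) (q2 0 + Gam c (xc c t) v v) (pc c t)) (at 0) \<and>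
      \<epsilon> 0 = t * L2 \<and> \<epsilon>1 0 = 2 * ip c (xc c t) v (pc c t)))"

lemma variationD:
  assumes "variation c t v B" "C2_path \<eta> q q1 q2" "q 0 = xc c t" "q1 0 = v" "t = 0 \<longrightarrow> (\<forall>s. q s = xc c t)"
  shows "\<exists>\<delta> \<epsilon> \<epsilon>1. 0 < \<delta> \<and> (\<forall>s. \<bar>s\<bar> < \<delta> \<longrightarrow> reach (\<gamma> 0) t (chart_inv c (q s)) (\<epsilon> s)) \<and>
      (\<forall>s. \<bar>s\<bar> < \<delta> \<longrightarrow> (\<epsilon> has_real_derivative \<epsilon>1 s) (at s)) \<and>
      (\<epsilon>1 has_real_derivative B + 2 * ip c (xc c t) (q2 0 + Gam c (xc c t) v v) (pc c t)) (at 0) \<and>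
      \<epsilon> 0 = t * L2 \<and> \<epsilon>1 0 = 2 * ip c (xc c t) v (pc c t)"
  by (rule assms(1)[unfolded variation_def, THEN spec, THEN spec, THEN spec, THEN spec,
      THEN mp, THEN mp, THEN mp, THEN mp, OF assms(2-5)])

text \<open>At time 0 only the trivial curve \<open>reach_start\<close> is at hand, so the path has
  to stand still; this is the reason for the clause on \<open>t = 0\<close> in
  \<open>variation\<close>. The derivatives of such a path vanish at 0.\<close>

lemma variation_zero:
  assumes c: "c \<in> A" "\<gamma> 0 \<in> fst c"
  shows "variation c 0 0 0"
  unfolding variation_def
proof (intro allI impI)
  fix \<eta> q q1 q2
  assume q: "C2_path \<eta> q q1 q2" "q 0 = xc c 0" "q1 0 = 0" "0 = (0::real) \<longrightarrow> (\<forall>s. q s = xc c 0)"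
  interpret M: chart_metric "chart_image c" "G c" by (rule chart_metric_chart[OF c(1)])
  have q1: "q1 s = 0" if "\<bar>s\<bar> < \<eta>" for s
  proof -
    have "q = (\<lambda>s. xc c 0)" using q(4) by auto
    then have "(q has_vector_derivative 0) (at s)" by simp
    then show ?thesis using q(1) that vector_derivative_unique_at unfolding C2_path_def by blast
  qed
  have \<eta>: "0 < \<eta>" using q(1) by (simp add: C2_path_def)
  have "((\<lambda>s. 0) has_vector_derivative q2 0) (at 0)"
  proof (rule has_vector_derivative_transform_within_open[of q1 "q2 0" 0 "{-\<eta><..<\<eta>}"])
    show "(q1 has_vector_derivative q2 0) (at 0)" using q(1) \<eta> by (simp add: C2_path_def)
  qed (use \<eta> q1 in auto)
  then have q2: "q2 0 = 0" using vector_derivative_unique_at has_vector_derivative_const by blast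
  have G0: "M.Gam (xc c 0) 0 0 = 0" using M.Gam_lin(3)[of "xc c 0" 0 0 0] by simp
  have x: "chart_inv c (q s) = \<gamma> 0" for s using q(4) c by (simp add: xc_def)
  show "\<exists>\<delta> \<epsilon> \<epsilon>1. 0 < \<delta> \<and> (\<forall>s. \<bar>s\<bar> < \<delta> \<longrightarrow> reach (\<gamma> 0) 0 (chart_inv c (q s)) (\<epsilon> s)) \<and>
      (\<forall>s. \<bar>s\<bar> < \<delta> \<longrightarrow> (\<epsilon> has_real_derivative \<epsilon>1 s) (at s)) \<and>
      (\<epsilon>1 has_real_derivative 0 + 2 * ip c (xc c 0) (q2 0 + Gam c (xc c 0) 0 0) (pc c 0)) (at 0) \<and>
      \<epsilon> 0 = 0 * L2 \<and> \<epsilon>1 0 = 2 * ip c (xc c 0) 0 (pc c 0)"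
    by (rule exI[of _ 1], rule exI[of _ "\<lambda>_. 0"], rule exI[of _ "\<lambda>_. 0"])
      (simp add: x reach_start q2 G0 M.ip_lin)
qed

text \<open>The path given in \<open>d\<close> is carried to \<open>c\<close>. Its second derivative
  acquires a \<open>ddvec\<close> term, and by \<open>cc_trans\<close> this is exactly what makes
  the covariant acceleration, paired with the velocity of the geodesic, the same in both charts;
  hence \<open>B\<close> does not change.\<close>

lemma variation_trans:
  assumes c: "c \<in> A" "\<gamma> t \<in> fst c" and d: "d \<in> A" "\<gamma> t \<in> fst d" and t: "t \<in> {0..1}"
    and var: "variation c t v B"
  shows "variation d t (dvec (transition c d) (xc c t) v) B"
  unfolding variation_def
proof (intro allI impI)
  fix \<eta> q q1 q2
  let ?v = "dvec (transition c d) (xc c t) v"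
  assume q: "C2_path \<eta> q q1 q2" "q 0 = xc d t" "q1 0 = ?v" "t = 0 \<longrightarrow> (\<forall>s. q s = xc d t)"
  interpret M: chart_metric "chart_image c" "G c" by (rule chart_metric_chart[OF c(1)])
  interpret N: chart_metric "chart_image d" "G d" by (rule chart_metric_chart[OF d(1)])
  let ?T = "transition d c"
  have o: "xc d t \<in> overlap d c" using c d by (simp add: overlap_iff xc_def)
  have Tx: "?T (xc d t) = xc c t" using d by (simp add: transition_def xc_def)
  have Jv: "dvec ?T (xc d t) ?v = v"
    using trans_inverse[OF c d] by (simp add: xc_def)
  have \<eta>: "0 < \<eta>" and qd: "\<And>s. \<bar>s\<bar> < \<eta> \<Longrightarrow> (q has_vector_derivative q1 s) (at s)"
    "\<And>s. \<bar>s\<bar> < \<eta> \<Longrightarrow> (q1 has_vector_derivative q2 s) (at s)" and q2c: "continuous_on {-\<eta><..<\<eta>} q2"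
    using q(1) unfolding C2_path_def by auto
  have "isCont q 0" using qd(1)[of 0] \<eta> has_vector_derivative_continuous by force
  then have "eventually (\<lambda>s. q s \<in> overlap d c) (nhds 0)"
    by (rule isCont_eventually_in[OF _ open_overlap[OF d(1) c(1)]]) (simp add: q(2) o)
  then obtain \<eta>1 where \<eta>1: "0 < \<eta>1" "\<And>s. \<bar>s\<bar> < \<eta>1 \<Longrightarrow> q s \<in> overlap d c"
    unfolding eventually_nhds_metric by (auto simp: dist_real_def)
  define \<zeta> where "\<zeta> = min \<eta> \<eta>1"
  have \<zeta>: "0 < \<zeta>" "\<And>s. \<bar>s\<bar> < \<zeta> \<Longrightarrow> \<bar>s\<bar> < \<eta> \<and> q s \<in> overlap d c"
    using \<eta> \<eta>1 by (auto simp: \<zeta>_def)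
  define r where "r s = ?T (q s)" for s
  define r1 where "r1 s = dvec ?T (q s) (q1 s)" for s
  define r2 where "r2 s = ddvec ?T (q s) (q1 s) (q1 s) + dvec ?T (q s) (q2 s)" for s
  let ?I = "{-\<zeta><..<\<zeta>}"
  have "continuous_on ?I q" "continuous_on ?I q1"
    by (rule continuous_on_vector_derivative, rule has_vector_derivative_at_within, rule qd,
        use \<zeta>(2) in \<open>auto simp: abs_less_iff\<close>)+
  note cont = this continuous_on_subset[OF q2c, of ?I]
  have qI: "q ` ?I \<subseteq> overlap d c" using \<zeta>(2) by (auto simp: abs_less_iff)
  have coeff: "continuous_on ?I (\<lambda>s. H (q s))" if "smooth_on (overlap d c) H" for H :: "real^'n \<Rightarrow> real"
    by (rule continuous_on_compose2[OF smooth_on_continuous[OF that] cont(1) qI])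
  note sT = smooth_trans[OF d(1) c(1)]
  have "continuous_on ?I r2"
    unfolding r2_def dvec_def ddvec_def
    by (intro continuous_on_add continuous_on_vec_lambda continuous_on_form1 continuous_on_form2
       coeff smooth_on_partial sT cont) (auto simp: \<zeta>_def)
  moreover have "(r has_vector_derivative r1 s) (at s)" "(r1 has_vector_derivative r2 s) (at s)" if s: "\<bar>s\<bar> < \<zeta>" for s
  proof -
    note td = trans_diff[OF d(1) c(1) conjunct2[OF \<zeta>(2)[OF s]]]
    note qs = qd[OF conjunct1[OF \<zeta>(2)[OF s]]]
    show "(r has_vector_derivative r1 s) (at s)"
      unfolding r_def r1_def by (rule dvec_along[OF td(1) qs(1)])
    show "(r1 has_vector_derivative r2 s) (at s)"
      unfolding r1_def r2_def by (rule ddvec_along[OF td(2) qs])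
  qed
  ultimately have rp: "C2_path \<zeta> r r1 r2" using \<zeta>(1) by (simp add: C2_path_def)
  have r0: "r 0 = xc c t" by (simp add: r_def q(2) Tx)
  have r10: "r1 0 = v" by (simp add: r1_def q(2,3) Jv)
  have rz: "t = 0 \<longrightarrow> (\<forall>s. r s = xc c t)" using q(4) Tx by (auto simp: r_def)
  obtain \<delta> \<epsilon> \<epsilon>1 where *: "0 < \<delta>" "\<And>s. \<bar>s\<bar> < \<delta> \<Longrightarrow> reach (\<gamma> 0) t (chart_inv c (r s)) (\<epsilon> s)"
      "\<And>s. \<bar>s\<bar> < \<delta> \<Longrightarrow> (\<epsilon> has_real_derivative \<epsilon>1 s) (at s)"
      "(\<epsilon>1 has_real_derivative B + 2 * ip c (xc c t) (r2 0 + Gam c (xc c t) v v) (pc c t)) (at 0)"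
      "\<epsilon> 0 = t * L2" "\<epsilon>1 0 = 2 * ip c (xc c t) v (pc c t)"
    using variationD[OF var rp r0 r10 rz] by blast
  have Jp: "dvec ?T (xc d t) (pc d t) = pc c t"
    using pc_trans[OF d c t] by simp
  have "ip c (xc c t) (r2 0 + Gam c (xc c t) v v) (pc c t) =
      ip c (xc c t) (ddvec ?T (xc d t) ?v ?v) (pc c t) + ip c (xc c t) (dvec ?T (xc d t) (q2 0)) (pc c t)
       + cc c (xc c t) v v (pc c t)"
    by (simp add: r2_def q(2,3) M.ip_lin M.ip_Gam[OF xc_mem[OF c]])
  also have "\<dots> = cc d (xc d t) ?v ?v (pc d t) + ip d (xc d t) (q2 0) (pc d t)"
    using cc_trans[OF d(1) c(1) o, of ?v "pc d t"] ip_trans[OF d(1) c(1) o, of "q2 0" "pc d t"]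
    by (simp add: Jp Jv Tx)
  also have "\<dots> = ip d (xc d t) (q2 0 + Gam d (xc d t) ?v ?v) (pc d t)"
    by (simp add: N.ip_lin N.ip_Gam[OF xc_mem[OF d]])
  finally have acc: "ip c (xc c t) (r2 0 + Gam c (xc c t) v v) (pc c t) = \<dots>" .
  have vel: "ip c (xc c t) v (pc c t) = ip d (xc d t) ?v (pc d t)"
    by (rule ip_pc_trans[OF c d t])
  have rs: "chart_inv c (r s) = chart_inv d (q s)" if "\<bar>s\<bar> < \<zeta>" for s
    unfolding r_def by (rule trans_simps(1)[OF d(1) c(1)]) (use \<zeta>(2)[OF that] in simp)
  have "reach (\<gamma> 0) t (chart_inv d (q s)) (\<epsilon> s)" if "\<bar>s\<bar> < min \<delta> \<zeta>" for s
    using *(2)[of s] rs[of s] that by simp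
  then show "\<exists>\<delta> \<epsilon> \<epsilon>1. 0 < \<delta> \<and> (\<forall>s. \<bar>s\<bar> < \<delta> \<longrightarrow> reach (\<gamma> 0) t (chart_inv d (q s)) (\<epsilon> s)) \<and>
      (\<forall>s. \<bar>s\<bar> < \<delta> \<longrightarrow> (\<epsilon> has_real_derivative \<epsilon>1 s) (at s)) \<and>
      (\<epsilon>1 has_real_derivative B + 2 * ip d (xc d t) (q2 0 + Gam d (xc d t) ?v ?v) (pc d t)) (at 0) \<and>
      \<epsilon> 0 = t * L2 \<and> \<epsilon>1 0 = 2 * ip d (xc d t) ?v (pc d t)"
    using *(1,3,4,5,6) \<zeta>(1) unfolding acc vel
    by (intro exI[of _ "min \<delta> \<zeta>"] exI[of _ \<epsilon>] exI[of _ \<epsilon>1]) auto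
qed

text \<open>The curves built so far are made to end on the coordinate line where the new piece
  starts. Their boundary term at \<open>a\<close> is then cancelled by the one in
  \<open>second_variation\<close>, and \<open>B\<close> grows by twice the index form over
  \<open>{a..b}\<close>.\<close>

lemma variation_step:
  assumes c: "c \<in> A" and ab: "a < b" and sub: "{a..b} \<subseteq> {0..1}" and im: "\<gamma> ` {a..b} \<subseteq> fst c"
    and V: "\<And>t. t \<in> {a..b} \<Longrightarrow> (V has_vector_derivative w t) (at t within {a..b})"
    and w: "continuous_on {a..b} w" and V0: "a = 0 \<Longrightarrow> V a = 0"
    and var: "variation c a (V a) B"
  shows "variation c b (V b) (B + 2 * integral {a..b} (\<lambda>t.
      ip c (xc c t) (w t + Gam c (xc c t) (pc c t) (V t)) (w t + Gam c (xc c t) (pc c t) (V t))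
      - ip c (xc c t) (chart_metric.Riem (G c) (xc c t) (V t) (pc c t) (pc c t)) (V t)))"
    (is "variation c b (V b) (B + 2 * ?J)")
  unfolding variation_def
proof (intro allI impI)
  fix \<eta> q q1 q2
  assume q: "C2_path \<eta> q q1 q2" "q 0 = xc c b" "q1 0 = V b" "b = 0 \<longrightarrow> (\<forall>s. q s = xc c b)"
  interpret M: chart_metric "chart_image c" "G c" by (rule chart_metric_chart[OF c])
  let ?x = "xc c" and ?p = "pc c"
  note x = xc_deriv_sub[OF c sub im]
  have xU: "?x ` {a..b} \<subseteq> chart_image c" using im xc_mem[OF c] by auto
  have \<eta>: "0 < \<eta>" and qd: "\<And>s. \<bar>s\<bar> < \<eta> \<Longrightarrow> (q has_vector_derivative q1 s) (at s)"
    "\<And>s. \<bar>s\<bar> < \<eta> \<Longrightarrow> (q1 has_vector_derivative q2 s) (at s)" and q2c: "continuous_on {-\<eta><..<\<eta>} q2"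
    using q(1) unfolding C2_path_def by auto
  \<comment> \<open>The deviation of the prescribed path from its tangent line at 0, which vanishes
    to first order.\<close>
  define R where "R s = q s - ?x b - s *\<^sub>R V b" for s
  define R1 where "R1 s = q1 s - V b" for s
  have Rd: "(R has_vector_derivative R1 s) (at s)" "(R1 has_vector_derivative q2 s) (at s)" if "\<bar>s\<bar> < \<eta>" for s
    unfolding R_def R1_def by (auto intro!: derivative_eq_intros qd[OF that])
  have R0: "R 0 = 0" "R1 0 = 0" by (simp_all add: R_def R1_def q(2,3))
  define k where "k = 1 / (b - a)"
  define y where "y s t = ?x t + s *\<^sub>R V t + ((t - a) * k) *\<^sub>R R s" for s t
  define z where "z s t = ?p t + s *\<^sub>R w t + k *\<^sub>R R s" for s t
  obtain \<delta>1 e1 where E: "0 < \<delta>1" "\<delta>1 < \<eta>"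
    "\<And>s t. \<bar>s\<bar> \<le> \<delta>1 \<Longrightarrow> t \<in> {a..b} \<Longrightarrow> y s t \<in> chart_image c"
    "\<And>s. \<bar>s\<bar> < \<delta>1 \<Longrightarrow> ((\<lambda>s. integral {a..b} (\<lambda>t. ip c (y s t) (z s t) (z s t))) has_real_derivative e1 s) (at s)"
    "e1 0 = 2 * (ip c (?x b) (V b) (?p b) - ip c (?x a) (V a) (?p a))"
    "(e1 has_real_derivative 2 * (?J + (ip c (?x b) (q2 0 + Gam c (?x b) (V b) (V b)) (?p b)
        - ip c (?x a) (Gam c (?x a) (V a) (V a)) (?p a)))) (at 0)"
    using M.second_variation[OF ab x(1) xU x(2) V w \<eta> Rd q2c R0]
    unfolding y_def z_def k_def by blast
  define qa where "qa s = ?x a + s *\<^sub>R V a" for s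
  have qp: "C2_path 1 qa (\<lambda>s. V a) (\<lambda>s. 0)"
    unfolding C2_path_def qa_def by (auto intro!: derivative_eq_intros)
  have q0: "qa 0 = ?x a" by (simp add: qa_def)
  have qz: "a = 0 \<longrightarrow> (\<forall>s. qa s = ?x a)" using V0 by (simp add: qa_def)
  obtain \<delta>2 \<epsilon> \<epsilon>1 where F: "0 < \<delta>2"
      "\<And>s. \<bar>s\<bar> < \<delta>2 \<Longrightarrow> reach (\<gamma> 0) a (chart_inv c (qa s)) (\<epsilon> s)"
      "\<And>s. \<bar>s\<bar> < \<delta>2 \<Longrightarrow> (\<epsilon> has_real_derivative \<epsilon>1 s) (at s)"
      "(\<epsilon>1 has_real_derivative B + 2 * ip c (?x a) (0 + Gam c (?x a) (V a) (V a)) (?p a)) (at 0)"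
      "\<epsilon> 0 = a * L2" "\<epsilon>1 0 = 2 * ip c (?x a) (V a) (?p a)"
    using variationD[OF var qp q0 refl qz] by blast
  define \<delta> where "\<delta> = min \<delta>1 \<delta>2"
  define \<epsilon>' where "\<epsilon>' s = \<epsilon> s + integral {a..b} (\<lambda>t. ip c (y s t) (z s t) (z s t))" for s
  define \<epsilon>1' where "\<epsilon>1' s = \<epsilon>1 s + e1 s" for s
  have "reach (\<gamma> 0) b (chart_inv c (q s)) (\<epsilon>' s)" if s: "\<bar>s\<bar> < \<delta>" for s
  proof -
    have "reach (\<gamma> 0) b (chart_inv c (y s b)) (\<epsilon> s + integral {a..b} (\<lambda>t. ip c (y s t) (z s t) (z s t)))"
    proof (rule reach_step[OF F(2) c ab])
      show "\<bar>s\<bar> < \<delta>2" using s by (simp add: \<delta>_def)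
      show "(y s has_vector_derivative z s \<tau>) (at \<tau> within {a..b})" if "\<tau> \<in> {a..b}" for \<tau>
        unfolding y_def z_def by (auto intro!: derivative_eq_intros x(1)[OF that] V[OF that])
      show "continuous_on {a..b} (z s)"
        unfolding z_def by (intro continuous_intros w continuous_on_vector_derivative[OF x(2)])
      show "y s ` {a..b} \<subseteq> chart_image c" using E(3)[of s] s by (auto simp: \<delta>_def)
      show "chart_inv c (y s a) = chart_inv c (qa s)" by (simp add: y_def qa_def)
    qed
    moreover have "y s b = q s" using ab by (simp add: y_def k_def R_def)
    ultimately show ?thesis by (simp add: \<epsilon>'_def)
  qed
  moreover have "(\<epsilon>' has_real_derivative \<epsilon>1' s) (at s)" if "\<bar>s\<bar> < \<delta>" for s
    unfolding \<epsilon>'_def \<epsilon>1'_def using that by (intro DERIV_add F(3) E(4)) (auto simp: \<delta>_def)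
  moreover have "(\<epsilon>1' has_real_derivative (B + 2 * ?J) + 2 * ip c (?x b) (q2 0 + Gam c (?x b) (V b) (V b)) (?p b)) (at 0)"
    unfolding \<epsilon>1'_def by (rule DERIV_cong[OF DERIV_add[OF F(4) E(6)]]) (simp add: algebra_simps)
  moreover have "\<epsilon>' 0 = b * L2"
  proof -
    have "integral {a..b} (\<lambda>t. ip c (y 0 t) (z 0 t) (z 0 t)) = integral {a..b} (\<lambda>t. L2)"
    proof (rule Henstock_Kurzweil_Integration.integral_cong)
      fix t assume "t \<in> {a..b}"
      then have "t \<in> {0..1}" "\<gamma> t \<in> fst c" using sub im by auto
      then show "ip c (y 0 t) (z 0 t) (z 0 t) = L2" using L2[OF c] by (simp add: y_def z_def R0)
    qed
    then show ?thesis using ab by (simp add: \<epsilon>'_def F(5) algebra_simps)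
  qed
  moreover have "\<epsilon>1' 0 = 2 * ip c (?x b) (V b) (?p b)" by (simp add: \<epsilon>1'_def F(6) E(5))
  moreover have "0 < \<delta>" using E(1) F(1) by (simp add: \<delta>_def)
  ultimately show "\<exists>\<delta> \<epsilon> \<epsilon>1. 0 < \<delta> \<and> (\<forall>s. \<bar>s\<bar> < \<delta> \<longrightarrow> reach (\<gamma> 0) b (chart_inv c (q s)) (\<epsilon> s)) \<and>
      (\<forall>s. \<bar>s\<bar> < \<delta> \<longrightarrow> (\<epsilon> has_real_derivative \<epsilon>1 s) (at s)) \<and>
      (\<epsilon>1 has_real_derivative (B + 2 * ?J) + 2 * ip c (?x b) (q2 0 + Gam c (?x b) (V b) (V b)) (?p b)) (at 0) \<and>
      \<epsilon> 0 = b * L2 \<and> \<epsilon>1 0 = 2 * ip c (?x b) (V b) (?p b)"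
    by blast
qed

subsection \<open>Parallel frames and the Laplacian comparison\<close>

definition dF where "dF c t = tv c (\<gamma> t) (pc c t) f"

lemma dF_trans:
  assumes "c \<in> A" "\<gamma> t \<in> fst c" "d \<in> A" "\<gamma> t \<in> fst d" "t \<in> {0..1}"
  shows "dF c t = dF d t"
  using tv_trans[OF assms(1-4)] pc_trans[OF assms] by (simp add: dF_def xc_def)

text \<open>The invariant carried along the geodesic. The factor \<open>t\<close> makes the
  variations vanish at the start. The bound on the sum of the \<open>B i\<close> is the comparison
  inequality integrated up to \<open>t\<close>; at \<open>t = 1\<close> it is the one used for the
  estimate.\<close>

definition frame where
  "frame c t e B \<longleftrightarrow> chart_metric.onb (G c) (xc c t) e \<and>
    (\<Sum>i\<in>UNIV. B i) \<le> 2 * ((real CARD('n) + m) * t + t\<^sup>2 * dF c t) \<and>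
    (\<forall>i. variation c t (t *\<^sub>R e i) (B i))"

lemma frame_zero:
  assumes c: "c \<in> A" "\<gamma> 0 \<in> fst c" obtains e B where "frame c 0 e B"
proof -
  interpret M: chart_metric "chart_image c" "G c" by (rule chart_metric_chart[OF c(1)])
  obtain e where "M.onb (xc c 0) e" using M.onb_exists[OF xc_mem[OF c]] .
  then have "frame c 0 e (\<lambda>_. 0)" using variation_zero[OF c] by (simp add: frame_def)
  then show ?thesis by (rule that)
qed

lemma frame_trans:
  assumes c: "c \<in> A" "\<gamma> t \<in> fst c" and d: "d \<in> A" "\<gamma> t \<in> fst d" and t: "t \<in> {0..1}"
    and fr: "frame c t e B"
  shows "frame d t (\<lambda>i. dvec (transition c d) (xc c t) (e i)) B"
proof -
  interpret M: chart_metric "chart_image c" "G c" by (rule chart_metric_chart[OF c(1)])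
  interpret N: chart_metric "chart_image d" "G d" by (rule chart_metric_chart[OF d(1)])
  have o: "xc c t \<in> overlap c d" using c d by (simp add: overlap_iff xc_def)
  have Tx: "transition c d (xc c t) = xc d t" using c by (simp add: transition_def xc_def)
  show ?thesis
    using fr variation_trans[OF c d t] dF_trans[OF c d t] ip_trans[OF c(1) d(1) o]
    by (simp add: frame_def M.onb_def N.onb_def Tx flip: dvec_lin(2))
qed

text \<open>For parallel \<open>E i\<close> the covariant derivative of
  \<open>t *\<^sub>R E i t\<close> is \<open>E i t\<close>, so the index form densities add up to n
  - t^2 Ric(p,p). The curvature hypothesis and a completed square bound this by the derivative of (n
  + m) t + t^2 \<open>dF c t\<close>, which is then integrated.\<close>

lemma frame_step:
  assumes c: "c \<in> A" and ab: "a < b" and sub: "{a..b} \<subseteq> {0..1}" and im: "\<gamma> ` {a..b} \<subseteq> fst c"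
    and E: "\<And>i. E i a = e i" "\<And>t. t \<in> {a..b} \<Longrightarrow> chart_metric.onb (G c) (xc c t) (\<lambda>i. E i t)"
      "\<And>i t. t \<in> {a..b} \<Longrightarrow> (E i has_vector_derivative - Gam c (xc c t) (pc c t) (E i t)) (at t within {a..b})"
    and fr: "frame c a e B"
  shows "\<exists>B'. frame c b (\<lambda>i. E i b) B'"
proof -
  interpret F: chart_function "chart_image c" "G c" "f \<circ> chart_inv c"
    by (rule chart_function_chart[OF f c])
  let ?x = "xc c" and ?p = "pc c" and ?n = "real CARD('n)"
  note x = xc_deriv_sub[OF c sub im]
  have xU: "?x t \<in> chart_image c" if "t \<in> {a..b}" for t using im that by (intro xc_mem[OF c]) auto
  have xU': "?x ` {a..b} \<subseteq> chart_image c" using xU by auto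
  have cx: "continuous_on {a..b} ?x" "continuous_on {a..b} ?p" "continuous_on {a..b} (E i)" for i
    by (rule continuous_on_vector_derivative[OF x(1)] continuous_on_vector_derivative[OF x(2)]
      continuous_on_vector_derivative[OF E(3)]; assumption)+
  define J where "J i t = 1 - t\<^sup>2 * ip c (?x t) (F.Riem (?x t) (E i t) (?p t) (?p t)) (E i t)" for i t
  define B' where "B' i = B i + 2 * integral {a..b} (J i)" for i
  have "variation c b (b *\<^sub>R E i b) (B' i)" for i
  proof -
    define w where "w t = E i t - t *\<^sub>R Gam c (?x t) (?p t) (E i t)" for t
    have V: "((\<lambda>t. t *\<^sub>R E i t) has_vector_derivative w t) (at t within {a..b})" if "t \<in> {a..b}" for t
      unfolding w_def by (rule derivative_eq_intros refl E(3)[OF that])+ simp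
    have wc: "continuous_on {a..b} w"
      unfolding w_def by (intro continuous_intros F.continuous_on_Gam cx xU')
    have var: "variation c a (a *\<^sub>R E i a) (B i)" using fr by (simp add: frame_def E(1))
    have "integral {a..b} (\<lambda>t.
        ip c (?x t) (w t + Gam c (?x t) (?p t) (t *\<^sub>R E i t)) (w t + Gam c (?x t) (?p t) (t *\<^sub>R E i t))
       - ip c (?x t) (F.Riem (?x t) (t *\<^sub>R E i t) (?p t) (?p t)) (t *\<^sub>R E i t)) = integral {a..b} (J i)"
    proof (rule Henstock_Kurzweil_Integration.integral_cong)
      fix t assume t: "t \<in> {a..b}"
      have "w t + Gam c (?x t) (?p t) (t *\<^sub>R E i t) = E i t" by (simp add: w_def F.Gam_lin)
      then show "ip c (?x t) (w t + Gam c (?x t) (?p t) (t *\<^sub>R E i t)) (w t + Gam c (?x t) (?p t) (t *\<^sub>R E i t))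
       - ip c (?x t) (F.Riem (?x t) (t *\<^sub>R E i t) (?p t) (?p t)) (t *\<^sub>R E i t) = J i t"
        using E(2)[OF t] by (simp add: J_def F.onb_def F.Riem_lin F.ip_lin power2_eq_square)
    qed
    with variation_step[OF c ab sub im V wc _ var] show ?thesis by (simp add: B'_def)
  qed
  moreover have "(\<Sum>i\<in>UNIV. B' i) \<le> 2 * ((?n + m) * b + b\<^sup>2 * dF c b)"
  proof -
    define H where "H t = (?n + m) * t + t\<^sup>2 * dF c t" for t
    \<comment> \<open>The Hessian of \<open>f\<close> on the velocity, which is the second
      derivative of \<open>f\<close> along the geodesic.\<close>
    define hs where "hs t = ip c (?x t) (F.N (?x t) (?p t)) (?p t)" for t
    have dF: "dF c t = ip c (?x t) (F.X (?x t)) (?p t)" if "t \<in> {a..b}" for t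
    proof -
      have "smooth_near A (\<gamma> t) f" using f unfolding smooth_near_def by blast
      then show ?thesis
        using F.ip_X[OF xU[OF that], of "pc c t"] by (simp add: dF_def tv_apply F.dF_def xc_def)
    qed
    have dFd: "(dF c has_real_derivative hs t) (at t within {a..b})" if t: "t \<in> {a..b}" for t
    proof (rule has_field_derivative_transform_within[OF _ zero_less_one t])
      show "((\<lambda>t. ip c (?x t) (F.X (?x t)) (?p t)) has_real_derivative hs t) (at t within {a..b})"
        by (rule DERIV_cong[OF F.ip_deriv_cov[OF xU[OF t] x(1)[OF t] dvec_along[OF F.X_diff[OF xU[OF t]] x(1)[OF t]] x(2)[OF t]]])
          (simp add: hs_def F.N_def F.ip_lin)
    qed (simp add: dF)
    have Hd: "(H has_vector_derivative ?n + m + 2 * t * dF c t + t\<^sup>2 * hs t) (at t within {a..b})" if t: "t \<in> {a..b}" for t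
      unfolding has_real_derivative_iff_has_vector_derivative[symmetric] H_def
      using dFd[OF t] by (auto intro!: derivative_eq_intros simp: algebra_simps)
    have Hi: "((\<lambda>t. ?n + m + 2 * t * dF c t + t\<^sup>2 * hs t) has_integral H b - H a) {a..b}"
      by (rule fundamental_theorem_of_calculus[OF less_imp_le[OF ab] Hd])
    have Jc: "continuous_on {a..b} (J i)" for i
      unfolding J_def by (intro continuous_intros F.continuous_on_ip F.continuous_on_Riem cx xU')
    have Ji: "((\<lambda>t. \<Sum>i\<in>UNIV. J i t) has_integral (\<Sum>i\<in>UNIV. integral {a..b} (J i))) {a..b}"
      by (intro has_integral_sum integrable_integral integrable_continuous_real Jc) simp
    have "(\<Sum>i\<in>UNIV. J i t) \<le> ?n + m + 2 * t * dF c t + t\<^sup>2 * hs t" if t: "t \<in> {a..b}" for t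
    proof -
      note U = xU[OF t]
      let ?R = "form2 (\<lambda>j k. ricci (G c) j k (?x t)) (?p t) (?p t)"
      have "linear (\<lambda>u. F.Riem (?x t) u (?p t) (?p t))" by (simp add: linear_iff F.Riem_lin)
      from F.onb_trace[OF U E(2)[OF t] this]
      have tr: "(\<Sum>i\<in>UNIV. ip c (?x t) (F.Riem (?x t) (E i t) (?p t) (?p t)) (E i t)) = ?R"
        by (simp add: F.ricci_trace)
      have sq: "form2 (\<lambda>i j. partial i (f \<circ> chart_inv c) (?x t) * partial j (f \<circ> chart_inv c) (?x t)) (?p t) (?p t)
          = (dF c t)\<^sup>2"
        using form1_lin(6)[of "dF c t" "\<lambda>l. partial l (f \<circ> chart_inv c) (?x t)" "?p t"]
        by (simp add: dF[OF t] F.ip_X[OF U] F.dF_def form2_def form1_lin power2_eq_square mult.commute)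
      have "?R \<ge> (dF c t)\<^sup>2 / m - hs t"
        using ricci_chart[OF ric c U, of "?p t"]
        by (simp only: form2_coeff sq) (simp add: hs_def F.ip_N[OF U])
      then have "t\<^sup>2 * ?R \<ge> t\<^sup>2 * ((dF c t)\<^sup>2 / m - hs t)" by (intro mult_left_mono) auto
      \<comment> \<open>The square trades the term quadratic in \<open>dF c t\<close> for
        \<open>2 * t * dF c t\<close> and the constant \<open>m\<close>; together with
        \<open>t\<^sup>2 * hs t\<close> the linear term is an exact derivative.\<close>
      moreover have "0 \<le> (t * dF c t + m)\<^sup>2 / m" using m by simp
      then have "0 \<le> t\<^sup>2 * ((dF c t)\<^sup>2 / m) + 2 * t * dF c t + m"
        using m by (simp add: power2_eq_square field_simps)
      moreover have "(\<Sum>i\<in>UNIV. J i t) = ?n - t\<^sup>2 * ?R"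
        by (simp add: J_def sum_subtractf tr flip: sum_distrib_left)
      ultimately show ?thesis by (simp add: algebra_simps)
    qed
    then have "(\<Sum>i\<in>UNIV. integral {a..b} (J i)) \<le> H b - H a"
      by (rule has_integral_le[OF Ji Hi])
    moreover have "(\<Sum>i\<in>UNIV. B i) \<le> 2 * H a" using fr by (simp add: frame_def H_def)
    moreover have "(\<Sum>i\<in>UNIV. B' i) = (\<Sum>i\<in>UNIV. B i) + 2 * (\<Sum>i\<in>UNIV. integral {a..b} (J i))"
      by (simp add: B'_def sum.distrib sum_distrib_left)
    ultimately show ?thesis by (simp add: H_def)
  qed
  moreover have "F.onb (?x b) (\<lambda>i. E i b)" using E(2)[of b] ab by simp
  ultimately show ?thesis unfolding frame_def by blast
qed

text \<open>One chart contains the geodesic near \<open>t0\<close>, and there a frame can be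
  transported from any time shortly before \<open>t0\<close> to any time shortly after. This is the
  local form that the bisection principle \<open>Bolzano\<close> asks for.\<close>

lemma frame_local:
  assumes t0: "t0 \<in> {0..1}"
  obtains d where "0 < d" "\<And>a b c e B. 0 \<le> a \<Longrightarrow> a \<le> t0 \<Longrightarrow> t0 \<le> b \<Longrightarrow> b \<le> 1 \<Longrightarrow> b - a < d \<Longrightarrow>
     c \<in> A \<Longrightarrow> \<gamma> a \<in> fst c \<Longrightarrow> frame c a e B \<Longrightarrow> \<exists>c\<in>A. \<gamma> b \<in> fst c \<and> (\<exists>e B. frame c b e B)"
proof -
  obtain c0 where c0: "c0 \<in> A" "\<gamma> t0 \<in> fst c0" by (rule chart_exists)
  interpret M: chart_metric "chart_image c0" "G c0" by (rule chart_metric_chart[OF c0(1)])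
  obtain r where r: "0 < r" "\<And>s. s \<in> {0..1} \<Longrightarrow> \<bar>s - t0\<bar> < r \<Longrightarrow> \<gamma> s \<in> fst c0"
    using nearby_chart[OF c0(1) t0 c0(2)] by blast
  define \<alpha> where "\<alpha> = max 0 (t0 - r / 2)"
  define \<beta> where "\<beta> = min 1 (t0 + r / 2)"
  have sub: "{\<alpha>..\<beta>} \<subseteq> {0..1}" by (auto simp: \<alpha>_def \<beta>_def)
  have im: "\<gamma> ` {\<alpha>..\<beta>} \<subseteq> fst c0"
    using r by (auto simp: \<alpha>_def \<beta>_def intro!: r(2))
  note x = xc_deriv_sub[OF c0(1) sub im]
  have xU: "xc c0 ` {\<alpha>..\<beta>} \<subseteq> chart_image c0" using im xc_mem[OF c0(1)] by auto
  obtain d where d: "0 < d" "\<And>a b e. \<alpha> \<le> a \<Longrightarrow> a \<le> b \<Longrightarrow> b \<le> \<beta> \<Longrightarrow> b - a < d \<Longrightarrow> M.onb (xc c0 a) e \<Longrightarrow>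
      \<exists>E. (\<forall>i. E i a = e i) \<and> (\<forall>t\<in>{a..b}. M.onb (xc c0 t) (\<lambda>i. E i t)) \<and>
        (\<forall>i. \<forall>t\<in>{a..b}. (E i has_vector_derivative - M.Gam (xc c0 t) (pc c0 t) (E i t)) (at t within {a..b}))"
    using M.parallel_frame[OF continuous_on_vector_derivative[OF x(1)] xU continuous_on_vector_derivative[OF x(2)] x(1)]
    by blast
  show ?thesis
  proof (rule that[of "min d (r / 2)"])
    show "0 < min d (r / 2)" using d(1) r(1) by simp
    fix a b c e B
    assume a: "0 \<le> a" "a \<le> t0" "t0 \<le> b" "b \<le> 1" "b - a < min d (r / 2)"
      and c: "c \<in> A" "\<gamma> a \<in> fst c" and fr: "frame c a e B"
    have ab: "\<alpha> \<le> a" "b \<le> \<beta>" "a \<le> b" "b - a < d" using a by (auto simp: \<alpha>_def \<beta>_def)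
    have a1: "a \<in> {0..1}" and ga: "\<gamma> a \<in> fst c0" using a ab im by auto
    have sub': "{a..b} \<subseteq> {0..1}" "\<gamma> ` {a..b} \<subseteq> fst c0" using a ab im by auto
    from frame_trans[OF c c0(1) ga a1 fr] obtain e' where fr': "frame c0 a e' B" by blast
    show "\<exists>c\<in>A. \<gamma> b \<in> fst c \<and> (\<exists>e B. frame c b e B)"
    proof (cases "a = b")
      case True
      then show ?thesis using c fr by blast
    next
      case False
      then have "a < b" using ab by simp
      obtain E where E: "\<And>i. E i a = e' i" "\<And>t. t \<in> {a..b} \<Longrightarrow> M.onb (xc c0 t) (\<lambda>i. E i t)"
        "\<And>i t. t \<in> {a..b} \<Longrightarrow> (E i has_vector_derivative - M.Gam (xc c0 t) (pc c0 t) (E i t)) (at t within {a..b})"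
        using d(2)[OF ab(1,3,2,4), of e'] fr' unfolding frame_def by blast
      have "\<exists>B'. frame c0 b (\<lambda>i. E i b) B'"
        by (rule frame_step[OF c0(1) \<open>a < b\<close> sub' E fr'])
      moreover have "\<gamma> b \<in> fst c0" using sub' ab by auto
      ultimately show ?thesis using c0(1) by blast
    qed
  qed
qed

text \<open>Bisection replaces a subdivision of \<open>{0..1}\<close> into finitely many chart
  intervals: the relation \<open>P\<close> is transitive and holds on short intervals around every
  time.\<close>

lemma frame_end:
  assumes c: "c \<in> A" "\<gamma> 1 \<in> fst c" obtains e B where "frame c 1 e B"
proof -
  define Q where "Q t \<longleftrightarrow> (\<exists>c\<in>A. \<gamma> t \<in> fst c \<and> (\<exists>e B. frame c t e B))" for t
  define P where "P a b \<longleftrightarrow> (0 \<le> a \<longrightarrow> b \<le> 1 \<longrightarrow> Q a \<longrightarrow> Q b)" for a b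
  have "P 0 1"
  proof (rule Bolzano[of 0 1 P])
    show "P a c" if "P a b" "P b c" "a \<le> b" "b \<le> c" for a b c
      using that by (auto simp: P_def)
  next
    fix x :: real assume "0 \<le> x" "x \<le> 1"
    then have "x \<in> {0..1}" by simp
    from frame_local[OF this] obtain d where d: "0 < d" "\<And>a b c e B. 0 \<le> a \<Longrightarrow> a \<le> x \<Longrightarrow> x \<le> b \<Longrightarrow> b \<le> 1 \<Longrightarrow> b - a < d \<Longrightarrow>
     c \<in> A \<Longrightarrow> \<gamma> a \<in> fst c \<Longrightarrow> frame c a e B \<Longrightarrow> \<exists>c\<in>A. \<gamma> b \<in> fst c \<and> (\<exists>e B. frame c b e B)" by metis
    then show "\<exists>d>0. \<forall>a b. a \<le> x \<and> x \<le> b \<and> b - a < d \<longrightarrow> P a b" unfolding P_def Q_def by blast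
  qed simp
  moreover have "Q 0"
  proof -
    obtain c where "c \<in> A" "\<gamma> 0 \<in> fst c" by (rule chart_exists)
    then show ?thesis unfolding Q_def using frame_zero by metis
  qed
  ultimately obtain d e B where "d \<in> A" "\<gamma> 1 \<in> fst d" "frame d 1 e B" unfolding P_def Q_def by auto
  from frame_trans[OF this(1,2) c _ this(3)] that show ?thesis by auto
qed

end

text \<open>If \<open>M2\<close> were positive, \<open>M1\<close> would be positive just to the
  right of its zero at 0, and by the mean value theorem \<open>M\<close> would exceed its
  maximum.\<close>

lemma second_derivative_test:
  fixes M :: "real \<Rightarrow> real"
  assumes \<delta>: "0 < \<delta>" and max: "\<And>s. \<bar>s\<bar> < \<delta> \<Longrightarrow> M s \<le> M 0"
    and M1: "\<And>s. \<bar>s\<bar> < \<delta> \<Longrightarrow> (M has_real_derivative M1 s) (at s)"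
    and M2: "(M1 has_real_derivative M2) (at 0)"
  shows "M1 0 = 0" "M2 \<le> 0"
proof -
  show 0: "M1 0 = 0"
    by (rule DERIV_local_max[OF M1 \<delta>]) (use \<delta> max in auto)
  show "M2 \<le> 0"
  proof (rule ccontr)
    assume "\<not> M2 \<le> 0"
    then obtain d where d: "d > 0" "\<And>h. 0 < h \<Longrightarrow> h < d \<Longrightarrow> M1 0 < M1 (0 + h)"
      using DERIV_pos_inc_right[OF M2] by auto
    define s where "s = min d \<delta> / 2"
    have s: "0 < s" "s < d" "s < \<delta>" using d \<delta> by (auto simp: s_def)
    obtain z where z: "0 < z" "z < s" "M s - M 0 = (s - 0) * M1 z"
      using MVT2[of 0 s M M1] M1 s by auto
    then have "M s - M 0 > 0" using d(2)[of z] s 0 by simp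
    then show False using max[of s] s by simp
  qed
qed

section \<open>Lower semicontinuity of the distance\<close>

context geodesic_curve
begin

text \<open>Run in time \<open>T\<close>, the geodesic has squared speed L2 / T^2. A choice of
  \<open>T\<close> below 1 leaves time for another segment before time 1.\<close>

lemma reach_scaled:
  assumes L2: "\<And>c t. c \<in> A \<Longrightarrow> t \<in> {0..1} \<Longrightarrow> \<gamma> t \<in> fst c \<Longrightarrow> ip c (xc c t) (pc c t) (pc c t) = L2"
    and T: "0 < T"
  shows "reach (\<gamma> 0) T (\<gamma> 1) (L2 / T)"
proof -
  define R where "R t \<longleftrightarrow> reach (\<gamma> 0) (T * t) (\<gamma> t) (t * L2 / T)" for t
  define P where "P a b \<longleftrightarrow> (0 \<le> a \<longrightarrow> b \<le> 1 \<longrightarrow> R a \<longrightarrow> R b)" for a b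
  have "P 0 1"
  proof (rule Bolzano[of 0 1 P])
    show "P a c" if "P a b" "P b c" "a \<le> b" "b \<le> c" for a b c
      using that by (auto simp: P_def)
  next
    fix t0 :: real assume "0 \<le> t0" "t0 \<le> 1"
    then have t0: "t0 \<in> {0..1}" by simp
    obtain c where c: "c \<in> A" "\<gamma> t0 \<in> fst c" by (rule chart_exists)
    obtain r where r: "0 < r" "\<And>s. s \<in> {0..1} \<Longrightarrow> \<bar>s - t0\<bar> < r \<Longrightarrow> \<gamma> s \<in> fst c"
      using nearby_chart[OF c(1) t0 c(2)] by blast
    have "P a b" if ab: "a \<le> t0" "t0 \<le> b" "b - a < r" for a b
      unfolding P_def
    proof (intro impI)
      assume a: "0 \<le> a" "b \<le> 1" "R a"
      show "R b"
      proof (cases "a = b")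
        case False
        then have lt: "a < b" using ab by simp
        have sub: "{a..b} \<subseteq> {0..1}" using a by auto
        have im: "\<gamma> ` {a..b} \<subseteq> fst c" using ab a by (auto intro!: r(2))
        interpret M: chart_metric "chart_image c" "G c" by (rule chart_metric_chart[OF c(1)])
        note x = xc_deriv_sub[OF c(1) sub im]
        have div: "\<tau> / T \<in> {a..b}" if "\<tau> \<in> {T * a..T * b}" for \<tau>
          using that T by (auto simp: field_simps)
        have chain: "((\<lambda>\<tau>. h (\<tau> / T)) has_vector_derivative (1 / T) *\<^sub>R h') (at \<tau> within {T * a..T * b})"
          if "(h has_vector_derivative h') (at (\<tau> / T) within {a..b})" "\<tau> \<in> {T * a..T * b}"
          for h :: "real \<Rightarrow> real^'n" and h' \<tau>
        proof -
          have 1: "((\<lambda>\<tau>. \<tau> / T) has_vector_derivative 1 / T) (at \<tau> within {T * a..T * b})"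
            using T by (auto intro!: derivative_eq_intros)
          have 2: "(h has_vector_derivative h') (at (\<tau> / T) within (\<lambda>\<tau>. \<tau> / T) ` {T * a..T * b})"
            by (rule has_vector_derivative_within_subset[OF that(1)]) (use div in auto)
          show ?thesis using vector_diff_chain_within[OF 1 2] by (simp add: o_def)
        qed
        have "\<gamma> a \<in> fst c" "\<gamma> b \<in> fst c" using im lt by auto
        then have inv: "chart_inv c (xc c a) = \<gamma> a" "chart_inv c (xc c b) = \<gamma> b"
          using c(1) by (auto simp: xc_def)
        let ?\<xi> = "\<lambda>\<tau>. xc c (\<tau> / T)" and ?\<xi>' = "\<lambda>\<tau>. (1 / T) *\<^sub>R pc c (\<tau> / T)"
        have "reach (\<gamma> 0) (T * b) (chart_inv c (?\<xi> (T * b))) (a * L2 / T +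
            integral {T * a..T * b} (\<lambda>\<tau>. ip c (?\<xi> \<tau>) (?\<xi>' \<tau>) (?\<xi>' \<tau>)))"
        proof (rule reach_step[OF a(3)[unfolded R_def] c(1)])
          show "T * a < T * b" using lt T by simp
          show "(?\<xi> has_vector_derivative ?\<xi>' \<tau>) (at \<tau> within {T * a..T * b})" if "\<tau> \<in> {T * a..T * b}" for \<tau>
            by (rule chain[OF x(1)[OF div[OF that]] that])
          have "continuous_on {T * a..T * b} (\<lambda>\<tau>. pc c (\<tau> / T))"
            by (rule continuous_on_vector_derivative[OF chain[OF x(2)[OF div]]])
          then show "continuous_on {T * a..T * b} ?\<xi>'" by (intro continuous_intros)
          show "?\<xi> ` {T * a..T * b} \<subseteq> chart_image c" using div im by (auto intro!: xc_mem[OF c(1)])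
          show "chart_inv c (?\<xi> (T * a)) = \<gamma> a" using T inv by simp
        qed
        moreover have "chart_inv c (?\<xi> (T * b)) = \<gamma> b" using T inv by simp
        moreover have "integral {T * a..T * b} (\<lambda>\<tau>. ip c (?\<xi> \<tau>) (?\<xi>' \<tau>) (?\<xi>' \<tau>)) = integral {T * a..T * b} (\<lambda>\<tau>. L2 / T\<^sup>2)"
        proof (rule Henstock_Kurzweil_Integration.integral_cong)
          fix \<tau> assume "\<tau> \<in> {T * a..T * b}"
          from div[OF this] have "\<tau> / T \<in> {0..1}" "\<gamma> (\<tau> / T) \<in> fst c" using sub im by auto
          from L2[OF c(1) this] show "ip c (?\<xi> \<tau>) (?\<xi>' \<tau>) (?\<xi>' \<tau>) = L2 / T\<^sup>2"
            by (simp add: M.ip_lin power2_eq_square)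
        qed
        moreover have "a * L2 / T + integral {T * a..T * b} (\<lambda>\<tau>. L2 / T\<^sup>2) = b * L2 / T"
          using T lt by (simp add: field_simps power2_eq_square)
        ultimately show ?thesis unfolding R_def by metis
      qed (use a in simp)
    qed
    then show "\<exists>d>0. \<forall>a b. a \<le> t0 \<and> t0 \<le> b \<and> b - a < d \<longrightarrow> P a b" using r(1) by blast
  qed simp
  moreover have "R 0" unfolding R_def using reach_start by simp
  ultimately show ?thesis unfolding P_def R_def by simp
qed

end

context riem
begin

lemma minimal_geodesicE:
  assumes "minimal_geodesic A g p q \<gamma>"
  obtains L2 where "geodesic_curve A g \<gamma>" "\<gamma> 0 = p" "\<gamma> 1 = q" "0 \<le> L2" "riemannian_dist A g p q = sqrt L2"
    "\<And>c t. c \<in> A \<Longrightarrow> t \<in> {0..1} \<Longrightarrow> \<gamma> t \<in> fst c \<Longrightarrow>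
      ip c (geodesic_curve.xc \<gamma> c t) (geodesic_curve.pc \<gamma> c t) (geodesic_curve.pc \<gamma> c t) = L2"
proof -
  have m: "geodesic A g \<gamma>" "\<gamma> 0 = p" "\<gamma> 1 = q" "curve_length A g \<gamma> = riemannian_dist A g p q"
    using assms by (auto simp: minimal_geodesic_def)
  interpret C: geodesic_curve A g \<gamma> by unfold_locales (rule m(1))
  obtain L2 where L2: "\<And>c t. c \<in> A \<Longrightarrow> t \<in> {0..1} \<Longrightarrow> \<gamma> t \<in> fst c \<Longrightarrow> ip c (C.xc c t) (C.pc c t) (C.pc c t) = L2"
    using C.speed_constant by blast
  show ?thesis
    by (rule that[OF C.geodesic_curve_axioms m(2,3) C.minimal_geodesic_dist(2,1)[OF L2 m(4)] L2])
qed

text \<open>The segment is straight in the chart and run at constant speed. Convexity keeps it in a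
  compact coordinate ball, on which \<open>C\<close> bounds the metric by the Euclidean one.\<close>

lemma chart_segment_energy:
  assumes c: "c \<in> A" "y \<in> fst c"
  obtains \<rho> C where "0 < \<rho>" "0 < C" "cball (snd c y) \<rho> \<subseteq> chart_image c"
    "\<And>x T T' p e \<zeta>. reach x T p e \<Longrightarrow> T < T' \<Longrightarrow> \<zeta> \<in> cball (snd c y) \<rho> \<Longrightarrow> p = chart_inv c \<zeta> \<Longrightarrow>
      \<exists>e'. reach x T' y e' \<and> e' \<le> e + C * (norm (snd c y - \<zeta>))\<^sup>2 / (T' - T)"
proof -
  interpret M: chart_metric "chart_image c" "G c" by (rule chart_metric_chart[OF c(1)])
  let ?y = "snd c y"
  obtain \<rho> where \<rho>: "0 < \<rho>" "cball ?y \<rho> \<subseteq> chart_image c"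
    using open_chart(2)[OF c(1)] c open_contains_cball by (metis chart_simps(2))
  let ?S = "cball ?y \<rho> \<times> sphere (0::real^'n) 1"
  have "continuous_on ?S (\<lambda>q. ip c (fst q) (snd q) (snd q))"
    by (rule M.continuous_on_ip) (use \<rho>(2) in \<open>auto intro!: continuous_intros\<close>)
  then have "compact ((\<lambda>q. ip c (fst q) (snd q) (snd q)) ` ?S)"
    by (intro compact_continuous_image compact_Times compact_cball compact_sphere)
  from compact_imp_bounded[OF this]
  obtain K where K: "\<bar>ip c z v v\<bar> \<le> K" if "z \<in> cball ?y \<rho>" "norm v = 1" for z v
    unfolding bounded_iff by fastforce
  define C where "C = max K 1"
  have C: "0 < C" by (simp add: C_def)
  have bound: "ip c z v v \<le> C * (norm v)\<^sup>2" if z: "z \<in> cball ?y \<rho>" for z v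
  proof (cases "v = 0")
    case False
    have "ip c z (v /\<^sub>R norm v) (v /\<^sub>R norm v) \<le> C"
      using K[OF z, of "v /\<^sub>R norm v"] False by (simp add: C_def)
    then show ?thesis using False by (simp add: M.ip_lin field_simps power2_eq_square)
  qed (simp add: M.ip_lin)
  show ?thesis
  proof (rule that[OF \<rho>(1) C \<rho>(2)])
    fix x T T' p e \<zeta>
    assume r: "reach x T p e" and T: "T < T'" and \<zeta>: "\<zeta> \<in> cball ?y \<rho>" "p = chart_inv c \<zeta>"
    define v where "v = (1 / (T' - T)) *\<^sub>R (?y - \<zeta>)"
    define \<xi> where "\<xi> t = \<zeta> + (t - T) *\<^sub>R v" for t
    have seg: "\<xi> t \<in> cball ?y \<rho>" if "t \<in> {T..T'}" for t
    proof -
      have "\<xi> t = (1 - (t - T) / (T' - T)) *\<^sub>R \<zeta> + ((t - T) / (T' - T)) *\<^sub>R ?y"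
        by (simp add: \<xi>_def v_def algebra_simps)
      also have "\<dots> \<in> cball ?y \<rho>"
      proof (rule convexD[OF convex_cball \<zeta>(1)])
        show "0 \<le> 1 - (t - T) / (T' - T)" "0 \<le> (t - T) / (T' - T)"
          using that T by (simp_all add: divide_le_eq)
      qed (use \<rho>(1) in auto)
      finally show ?thesis .
    qed
    have "reach x T' (chart_inv c (\<xi> T')) (e + integral {T..T'} (\<lambda>t. ip c (\<xi> t) v v))"
    proof (rule reach_step[OF r c(1) T])
      show "(\<xi> has_vector_derivative v) (at \<tau> within {T..T'})" for \<tau>
        unfolding \<xi>_def by (auto intro!: derivative_eq_intros)
      show "\<xi> ` {T..T'} \<subseteq> chart_image c" using seg \<rho>(2) by auto
      show "chart_inv c (\<xi> T) = p" by (simp add: \<xi>_def \<zeta>(2))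
    qed simp
    moreover have "chart_inv c (\<xi> T') = y" using T c by (simp add: \<xi>_def v_def)
    moreover have "integral {T..T'} (\<lambda>t. ip c (\<xi> t) v v) \<le> C * (norm (?y - \<zeta>))\<^sup>2 / (T' - T)"
    proof -
      have nv: "norm v = norm (?y - \<zeta>) / (T' - T)" using T by (simp add: v_def)
      have "continuous_on {T..T'} \<xi>" unfolding \<xi>_def by (intro continuous_intros)
      then have "(\<lambda>t. ip c (\<xi> t) v v) integrable_on {T..T'}"
        by (intro integrable_continuous_real M.continuous_on_ip) (use seg \<rho>(2) in auto)
      then have "integral {T..T'} (\<lambda>t. ip c (\<xi> t) v v) \<le> integral {T..T'} (\<lambda>t. C * (norm v)\<^sup>2)"
        by (rule integral_le) (use bound[OF seg] in auto)
      also have "\<dots> = C * (norm (?y - \<zeta>))\<^sup>2 / (T' - T)"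
        using T nv by (simp add: power_divide) (simp add: power2_eq_square)
      finally show ?thesis .
    qed
    ultimately show "\<exists>e'. reach x T' y e' \<and> e' \<le> e + C * (norm (?y - \<zeta>))\<^sup>2 / (T' - T)"
      by (metis add_left_mono)
  qed
qed

text \<open>\<open>reach_start\<close> has duration 0; a segment of length zero over unit time turns
  it into a competitor for the distance.\<close>

lemma dist_refl: "riemannian_dist A g x x = 0"
proof -
  obtain c where c: "c \<in> A" "x \<in> fst c" by (rule chart_exists)
  obtain \<rho> C where *: "0 < \<rho>" "0 < C" "cball (snd c x) \<rho> \<subseteq> chart_image c"
    "\<And>x' T T' p e \<zeta>. reach x' T p e \<Longrightarrow> T < T' \<Longrightarrow> \<zeta> \<in> cball (snd c x) \<rho> \<Longrightarrow> p = chart_inv c \<zeta> \<Longrightarrow>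
      \<exists>e'. reach x' T' x e' \<and> e' \<le> e + C * (norm (snd c x - \<zeta>))\<^sup>2 / (T' - T)"
    using chart_segment_energy[OF c] by metis
  from *(4)[OF reach_start[of x], of 1 "snd c x"] *(1) c
  obtain e where e: "reach x 1 x e" "e \<le> 0" by auto
  then show ?thesis using reach_dist[OF e(1)] by simp
qed

text \<open>Run the geodesic to \<open>z\<close> in time 1 - \<delta> and spend the remaining time
  \<delta> on a segment from \<open>z\<close> to \<open>y\<close>. As the squared length of the
  geodesic is at most a^2, the faster run costs at most 2 a^2 \<delta>; the segment costs at most C
  \<sigma>^2 / \<delta>.\<close>

lemma dist_lower_semicontinuous:
  assumes \<epsilon>: "0 < \<epsilon>" and a: "0 < a"
  obtains W where "open W" "y \<in> W"
    "\<And>z \<gamma>. z \<in> W \<Longrightarrow> minimal_geodesic A g x z \<gamma> \<Longrightarrow> riemannian_dist A g x z < a \<Longrightarrow>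
       0 \<le> riemannian_dist A g x y \<and> (riemannian_dist A g x y)\<^sup>2 \<le> (riemannian_dist A g x z)\<^sup>2 + \<epsilon>"
proof -
  obtain c where c: "c \<in> A" "y \<in> fst c" by (rule chart_exists)
  obtain \<rho> C where *: "0 < \<rho>" "0 < C" "cball (snd c y) \<rho> \<subseteq> chart_image c"
    "\<And>x' T T' p e \<zeta>. reach x' T p e \<Longrightarrow> T < T' \<Longrightarrow> \<zeta> \<in> cball (snd c y) \<rho> \<Longrightarrow> p = chart_inv c \<zeta> \<Longrightarrow>
      \<exists>e'. reach x' T' y e' \<and> e' \<le> e + C * (norm (snd c y - \<zeta>))\<^sup>2 / (T' - T)"
    using chart_segment_energy[OF c] by metis
  let ?y = "snd c y"
  \<comment> \<open>First \<delta> is fixed so that the faster run costs at most \<epsilon> / 2,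
    then the radius \<sigma>, depending on \<delta>, so that the segment costs at most as
    much.\<close>
  define \<delta> where "\<delta> = min (1/2) (\<epsilon> / (4 * a\<^sup>2))"
  have \<delta>: "0 < \<delta>" "\<delta> \<le> 1/2" "2 * a\<^sup>2 * \<delta> \<le> \<epsilon> / 2"
  proof -
    show "0 < \<delta>" "\<delta> \<le> 1/2" using \<epsilon> a by (auto simp: \<delta>_def)
    have "\<delta> \<le> \<epsilon> / (4 * a\<^sup>2)" by (simp add: \<delta>_def)
    then show "2 * a\<^sup>2 * \<delta> \<le> \<epsilon> / 2" using a by (simp add: field_simps)
  qed
  define \<sigma> where "\<sigma> = min \<rho> (sqrt (\<epsilon> * \<delta> / (2 * C)))"
  have \<sigma>: "0 < \<sigma>" "\<sigma> \<le> \<rho>" "C * \<sigma>\<^sup>2 / \<delta> \<le> \<epsilon> / 2"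
  proof -
    have p: "0 < \<epsilon> * \<delta> / (2 * C)" using \<epsilon> \<delta> *(2) by simp
    then show s: "0 < \<sigma>" "\<sigma> \<le> \<rho>" using *(1) by (auto simp: \<sigma>_def)
    have "\<sigma>\<^sup>2 \<le> (sqrt (\<epsilon> * \<delta> / (2 * C)))\<^sup>2" using s by (intro power_mono) (auto simp: \<sigma>_def)
    then have "\<sigma>\<^sup>2 \<le> \<epsilon> * \<delta> / (2 * C)" using p by simp
    then show "C * \<sigma>\<^sup>2 / \<delta> \<le> \<epsilon> / 2" using \<delta>(1) *(2) by (simp add: field_simps)
  qed
  have sub: "ball ?y \<sigma> \<subseteq> chart_image c" using *(3) \<sigma>(2) by (auto simp: subset_iff)
  show ?thesis
  proof (rule that[of "chart_inv c ` ball ?y \<sigma>"])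
    show "open (chart_inv c ` ball ?y \<sigma>)" by (rule open_chart_inv_image[OF c(1) open_ball sub])
    show "y \<in> chart_inv c ` ball ?y \<sigma>" using c \<sigma>(1) by (metis centre_in_ball chart_simps(1) imageI)
    fix z \<gamma>
    assume z: "z \<in> chart_inv c ` ball ?y \<sigma>" and \<gamma>: "minimal_geodesic A g x z \<gamma>" and az: "riemannian_dist A g x z < a"
    obtain L2 where L: "geodesic_curve A g \<gamma>" "\<gamma> 0 = x" "\<gamma> 1 = z" "0 \<le> L2" "riemannian_dist A g x z = sqrt L2"
      "\<And>c t. c \<in> A \<Longrightarrow> t \<in> {0..1} \<Longrightarrow> \<gamma> t \<in> fst c \<Longrightarrow>
      ip c (geodesic_curve.xc \<gamma> c t) (geodesic_curve.pc \<gamma> c t) (geodesic_curve.pc \<gamma> c t) = L2"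
      using minimal_geodesicE[OF \<gamma>] by blast
    obtain \<zeta> where \<zeta>: "\<zeta> \<in> ball ?y \<sigma>" "z = chart_inv c \<zeta>" using z by blast
    have "reach x (1 - \<delta>) z (L2 / (1 - \<delta>))"
      using geodesic_curve.reach_scaled[OF L(1) L(6), of "1 - \<delta>"] \<delta> L(2,3) by simp
    from *(4)[OF this _ _ \<zeta>(2), of 1] obtain e where e: "reach x 1 y e" "e \<le> L2 / (1 - \<delta>) + C * (norm (?y - \<zeta>))\<^sup>2 / \<delta>"
      using \<delta> \<zeta>(1) \<sigma>(2) by auto
    note rd = reach_dist[OF e(1)]
    have "C * (norm (?y - \<zeta>))\<^sup>2 / \<delta> \<le> C * \<sigma>\<^sup>2 / \<delta>"
      using \<zeta>(1) *(2) \<delta>(1) by (intro divide_right_mono mult_left_mono power_mono) (auto simp: dist_norm)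
    moreover have "L2 / (1 - \<delta>) \<le> L2 + 2 * a\<^sup>2 * \<delta>"
    proof -
      have "L2 \<le> a\<^sup>2" using az a L(4,5) real_less_lsqrt sqrt_le_D by (metis less_imp_le real_sqrt_le_iff real_sqrt_unique abs_of_pos real_sqrt_abs)
      then have "L2 * \<delta> \<le> (2 * a\<^sup>2 * \<delta>) * (1 - \<delta>)"
      proof -
        have "L2 * \<delta> \<le> a\<^sup>2 * \<delta>" using \<open>L2 \<le> a\<^sup>2\<close> \<delta>(1) by simp
        also have "\<dots> \<le> (a\<^sup>2 * \<delta>) * (2 * (1 - \<delta>))"
          using mult_left_mono[of 1 "2 * (1 - \<delta>)" "a\<^sup>2 * \<delta>"] \<delta>(1,2) by simp
        finally show ?thesis by (simp add: algebra_simps)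
      qed
      then show ?thesis using \<delta> by (simp add: divide_le_eq algebra_simps)
    qed
    ultimately have "e \<le> L2 + \<epsilon>" using e(2) \<delta>(3) \<sigma>(3) by linarith
    moreover have "(riemannian_dist A g x y)\<^sup>2 \<le> e"
      using rd power_mono[OF rd(1,3), of 2] by simp
    ultimately show "0 \<le> riemannian_dist A g x y \<and> (riemannian_dist A g x y)\<^sup>2 \<le> (riemannian_dist A g x z)\<^sup>2 + \<epsilon>"
      using rd(3) L(4,5) by simp
  qed
qed

end

section \<open>The gradient estimate\<close>

locale gradient_estimate = riem A g
  for A :: "('a::{t2_space, second_countable_topology}, 'n::finite) chart set" and g :: "'a metric" +
  fixes f :: "'a \<Rightarrow> real" and \<phi> :: "real \<Rightarrow> real" and m a :: real and x :: 'a
  assumes m: "0 < m" and f: "smooth_fun_on A UNIV f"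
    and ric: "bakry_emery_ricci_nonneg A g f m"
    and lap: "\<And>c p. c \<in> A \<Longrightarrow> p \<in> fst c \<Longrightarrow> f_laplacian A g f c f p = \<phi> (f p)"
    and \<phi>: "\<And>t. \<phi> differentiable (at t)" "\<And>t. deriv \<phi> t + 2 / real CARD('n) * \<phi> t \<ge> 0"
    and a: "0 < a"
    and conn: "geodesically_connected A g (metric_ball A g x a)"
    and comp: "compact (closure (metric_ball A g x a))"
begin

abbreviation r where "r \<equiv> riemannian_dist A g x"
abbreviation B where "B \<equiv> metric_ball A g x a"
definition u where "u p = g p (gradient A g f p) (gradient A g f p)"
definition w where "w p = (a\<^sup>2 - (r p)\<^sup>2)\<^sup>2 * u p"

lemma u_chart: "c \<in> A \<Longrightarrow> p \<in> fst c \<Longrightarrow> u p = ip c (snd c p) (gradX f c (snd c p)) (gradX f c (snd c p))"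
  by (simp add: u_def gradient_eq[OF f] g_tv_ip)

lemma u_nonneg: "u p \<ge> 0"
proof -
  obtain c where c: "c \<in> A" "p \<in> fst c" by (rule chart_exists)
  show ?thesis unfolding u_def gradient_eq[OF f c] by (rule g_nonneg[OF tv_tangent[OF c]])
qed

lemma u_continuous: "continuous (at p) u"
proof -
  obtain c where c: "c \<in> A" "p \<in> fst c" by (rule chart_exists)
  interpret F: chart_function "chart_image c" "G c" "f \<circ> chart_inv c"
    by (rule chart_function_chart[OF f c(1)])
  have sc: "snd c ` fst c \<subseteq> chart_image c" by (simp add: chart_image_def)
  have X: "continuous_on (fst c) (\<lambda>p. F.X (snd c p))"
  proof -
    have "continuous_on (fst c) (\<lambda>p. \<chi> k. F.X (snd c p) $ k)"
      by (intro continuous_on_vec_lambda F.continuous_on_coeff[OF F.smooth_X] continuous_chart c sc)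
    then show ?thesis by simp
  qed
  have "continuous_on (fst c) (\<lambda>p. ip c (snd c p) (F.X (snd c p)) (F.X (snd c p)))"
    by (intro F.continuous_on_ip continuous_chart c sc X)
  then have "continuous_on (fst c) u"
    by (rule iffD1[OF continuous_on_cong[OF refl], rotated]) (simp add: u_chart[OF c(1)])
  then show ?thesis using c continuous_on_eq_continuous_at open_chart by blast
qed

lemma center: "x \<in> B" "r x = 0"
  using dist_refl[of x] a by (auto simp: metric_ball_def)

lemma ball_geodesic: assumes "y \<in> B" obtains \<gamma> where "minimal_geodesic A g x y \<gamma>"
  using conn center(1) assms unfolding geodesically_connected_def by blast

lemma chart_hypotheses:
  assumes "c \<in> A" "y \<in> chart_image c"
  shows "(\<Sum>i\<in>UNIV. \<Sum>j\<in>UNIV. matrix_inv (G c y) $ i $ j * hessian (G c) (f \<circ> chart_inv c) i j y)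
     - ip c y (gradX f c y) (gradX f c y) = \<phi> ((f \<circ> chart_inv c) y)"
  using lap[OF assms(1), of "chart_inv c y"] f_laplacian_chart[OF f assms] assms by simp

lemma max_estimate:
  assumes y: "y \<in> B" and max: "\<And>z. z \<in> B \<Longrightarrow> w z \<le> w y"
  shows "w y \<le> 2 * real CARD('n) * (m + real CARD('n) + 6) * a\<^sup>2"
proof -
  let ?n = "real CARD('n)"
  obtain \<gamma> where \<gamma>: "minimal_geodesic A g x y \<gamma>" using ball_geodesic[OF y] .
  obtain L2 where L: "geodesic_curve A g \<gamma>" "\<gamma> 0 = x" "\<gamma> 1 = y" "0 \<le> L2" "r y = sqrt L2"
      "\<And>c t. c \<in> A \<Longrightarrow> t \<in> {0..1} \<Longrightarrow> \<gamma> t \<in> fst c \<Longrightarrow>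
      ip c (geodesic_curve.xc \<gamma> c t) (geodesic_curve.pc \<gamma> c t) (geodesic_curve.pc \<gamma> c t) = L2"
    using minimal_geodesicE[OF \<gamma>] by blast
  interpret C: bakry_emery_geodesic A g \<gamma> f m L2
    by (intro bakry_emery_geodesic.intro bakry_emery_geodesic_axioms.intro L(1) f m ric L(6))
  have rL: "(r y)\<^sup>2 = L2" using L(4,5) by simp
  have "sqrt L2 < a" using y L(5) by (simp add: metric_ball_def)
  then have La: "L2 < a\<^sup>2" using L(4) real_sqrt_less_iff[of L2 "a\<^sup>2"] a by simp
  define h0 where "h0 = a\<^sup>2 - L2"
  have h0: "0 < h0" using La by (simp add: h0_def)
  obtain c where c: "c \<in> A" "y \<in> fst c" by (rule chart_exists)
  then have c1: "\<gamma> 1 \<in> fst c" by (simp add: L(3))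
  interpret F: chart_function "chart_image c" "G c" "f \<circ> chart_inv c"
    by (rule chart_function_chart[OF f c(1)])
  define y0 where "y0 = snd c y"
  define p where "p = C.pc c 1"
  have y0: "y0 \<in> chart_image c" "C.xc c 1 = y0" "chart_inv c y0 = y"
    using c by (auto simp: y0_def C.xc_def L(3))
  define U where "U = ip c y0 (F.X y0) (F.X y0)"
  have U: "u y = U" "0 \<le> U" using u_chart[OF c] u_nonneg[of y] by (auto simp: U_def y0_def)
  obtain e b where fr: "C.frame c 1 e b" using C.frame_end[OF c(1) c1] .
  have e: "F.onb y0 e" and b: "(\<Sum>i\<in>UNIV. b i) \<le> 2 * ((?n + m) + C.dF c 1)"
    and var: "\<And>i. C.variation c 1 (e i) (b i)"
    using fr unfolding C.frame_def by (auto simp: y0)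
  have dF: "C.dF c 1 = ip c y0 (F.X y0) p"
  proof -
    have "smooth_near A (\<gamma> 1) f" using f unfolding smooth_near_def by blast
    then show ?thesis
      using F.ip_X[OF y0(1), of p] by (simp add: C.dF_def tv_apply F.dF_def y0_def p_def L(3))
  qed
  have pp: "ip c y0 p p = L2" using L(6)[OF c(1) _ c1] y0(2) by (simp add: p_def)
  have key: "h0 * ip c y0 (F.Z y0) (e i) = 2 * (ip c y0 (e i) p) * U"
    "h0\<^sup>2 * (2 * ip c y0 (F.DZ y0 (e i)) (e i)) - 2 * h0 * b i * U - 24 * (ip c y0 (e i) p)\<^sup>2 * U \<le> 0" for i
  proof -
    \<comment> \<open>This second-order coefficient makes the covariant acceleration of
      \<open>q\<close> zero at 0. The boundary term in \<open>variation\<close> disappears, and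
      \<open>norm_X_deriv2\<close> applies.\<close>
    define W where "W = - F.Gam y0 (e i) (e i)"
    define q where "q s = y0 + s *\<^sub>R e i + (s\<^sup>2 / 2) *\<^sub>R W" for s
    define q1 where "q1 s = e i + s *\<^sub>R W" for s
    have qd: "(q has_vector_derivative q1 s) (at s)" "(q1 has_vector_derivative W) (at s)" for s
      unfolding q_def q1_def by (auto intro!: derivative_eq_intros)
    have qp: "C2_path 1 q q1 (\<lambda>_. W)" unfolding C2_path_def using qd by auto
    have q0: "q 0 = C.xc c 1" "q1 0 = e i" by (auto simp: q_def q1_def y0(2))
    have acc: "W + F.Gam y0 (e i) (e i) = 0" by (simp add: W_def)
    obtain \<delta>1 \<epsilon> \<epsilon>1 where E: "0 < \<delta>1" "\<And>s. \<bar>s\<bar> < \<delta>1 \<Longrightarrow> reach x 1 (chart_inv c (q s)) (\<epsilon> s)"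
      "\<And>s. \<bar>s\<bar> < \<delta>1 \<Longrightarrow> (\<epsilon> has_real_derivative \<epsilon>1 s) (at s)"
      "(\<epsilon>1 has_real_derivative b i) (at 0)" "\<epsilon> 0 = L2" "\<epsilon>1 0 = 2 * ip c y0 (e i) p"
      using C.variationD[OF var qp q0] unfolding y0(2) L(2) p_def[symmetric] acc by (auto simp: F.ip_lin)
    have "isCont q 0" using qd(1)[of 0] has_vector_derivative_continuous by force
    then have ev1: "eventually (\<lambda>s. q s \<in> chart_image c) (nhds 0)"
      by (rule isCont_eventually_in[OF _ F.open_U]) (simp add: q0 y0)
    have "isCont \<epsilon> 0" using E(1,3) DERIV_isCont by force
    from isCont_eventually_in[OF this open_lessThan, of "a\<^sup>2"]
    have "eventually (\<lambda>s. \<epsilon> s < a\<^sup>2) (nhds 0)" using E(5) La by simp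
    with ev1 have "eventually (\<lambda>s. q s \<in> chart_image c \<and> \<epsilon> s < a\<^sup>2) (nhds 0)"
      by (rule eventually_conj)
    then obtain \<delta>2 where \<delta>2: "0 < \<delta>2" "\<And>s. \<bar>s\<bar> < \<delta>2 \<Longrightarrow> q s \<in> chart_image c \<and> \<epsilon> s < a\<^sup>2"
      unfolding eventually_nhds_metric by (auto simp: dist_real_def)
    define \<delta> where "\<delta> = min \<delta>1 \<delta>2"
    have \<delta>: "0 < \<delta>" using E(1) \<delta>2(1) by (simp add: \<delta>_def)
    define V where "V s = ip c (q s) (F.X (q s)) (F.X (q s))" for s
    define V1 where "V1 s = 2 * ip c (q s) (F.Z (q s)) (q1 s)" for s
    \<comment> \<open>The barrier: \<open>w\<close> along \<open>q\<close> with the squared distance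
      replaced by the energy, so that \<open>M\<close> lies below \<open>w\<close> and touches it at
      0.\<close>
    define M where "M s = (a\<^sup>2 - \<epsilon> s)\<^sup>2 * V s" for s
    define M1 where "M1 s = - 2 * (a\<^sup>2 - \<epsilon> s) * \<epsilon>1 s * V s + (a\<^sup>2 - \<epsilon> s)\<^sup>2 * V1 s" for s
    have Vd: "(V has_real_derivative V1 s) (at s)" if "\<bar>s\<bar> < \<delta>" for s
      unfolding V_def V1_def
      by (rule F.norm_X_deriv[OF _ qd(1)]) (use \<delta>2(2)[of s] that in \<open>simp add: \<delta>_def\<close>)
    have V1d: "(V1 has_real_derivative 2 * ip c y0 (F.DZ y0 (e i)) (e i)) (at 0)"
    proof -
      have "(q1 has_vector_derivative - F.Gam (q 0) (q1 0) (q1 0)) (at 0)"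
        using qd(2)[of 0] by (simp add: W_def q0 y0(2))
      from F.norm_X_deriv2[of q 0 q1 UNIV, OF _ qd(1) this] show ?thesis
        using y0(1) unfolding V1_def by (simp add: q0 y0(2))
    qed
    have Md: "(M has_real_derivative M1 s) (at s)" if "\<bar>s\<bar> < \<delta>" for s
      unfolding M_def M1_def using that
      by (auto intro!: derivative_eq_intros E(3) Vd simp: \<delta>_def algebra_simps)
    have V0: "V 0 = U" "V1 0 = 2 * ip c y0 (F.Z y0) (e i)"
      by (simp_all add: V_def V1_def U_def q0 y0(2))
    have M1d: "(M1 has_real_derivative 2 * (\<epsilon>1 0)\<^sup>2 * U - 2 * h0 * b i * U - 4 * h0 * \<epsilon>1 0 * V1 0
        + h0\<^sup>2 * (2 * ip c y0 (F.DZ y0 (e i)) (e i))) (at 0)"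
      unfolding M1_def
      by (rule derivative_eq_intros E(3) E(4) Vd V1d refl | (use E(1) \<delta> in simp; fail))+
        (simp add: V0(1) E(5) h0_def power2_eq_square algebra_simps)
    have Mmax: "M s \<le> M 0" if s: "\<bar>s\<bar> < \<delta>" for s
    proof -
      let ?z = "chart_inv c (q s)"
      have qs: "q s \<in> chart_image c" "\<epsilon> s < a\<^sup>2" using \<delta>2(2)[of s] s by (auto simp: \<delta>_def)
      note rd = reach_dist[OF E(2)[of s]]
      have rz: "r ?z \<le> sqrt (\<epsilon> s)" "0 \<le> \<epsilon> s" "0 \<le> r ?z" using rd s by (auto simp: \<delta>_def)
      have "sqrt (\<epsilon> s) < a" using qs(2) a rz(2) real_sqrt_less_iff[of "\<epsilon> s" "a\<^sup>2"] by simp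
      then have zB: "?z \<in> B" using rz(1) by (simp add: metric_ball_def)
      have "(r ?z)\<^sup>2 \<le> \<epsilon> s" using power_mono[OF rz(1,3), of 2] rz(2) by simp
      then have "(a\<^sup>2 - \<epsilon> s)\<^sup>2 \<le> (a\<^sup>2 - (r ?z)\<^sup>2)\<^sup>2" using qs(2) by (intro power_mono) auto
      then have "M s \<le> w ?z"
        using u_chart[OF c(1), of ?z] u_nonneg[of ?z] qs(1) c(1)
        unfolding M_def w_def V_def by (simp add: mult_right_mono)
      also have "\<dots> \<le> w y" by (rule max[OF zB])
      also have "\<dots> = M 0" by (simp add: w_def M_def rL E(5) V0 U)
      finally show ?thesis .
    qed
    note test = second_derivative_test[OF \<delta> Mmax Md M1d]
    have "M1 0 = - 2 * h0 * \<epsilon>1 0 * U + h0\<^sup>2 * V1 0" by (simp add: M1_def E(5) V0(1) h0_def)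
    then have "h0 * (h0 * V1 0) = h0 * (2 * \<epsilon>1 0 * U)"
      using test(1) by (simp add: power2_eq_square mult_ac)
    then have first: "h0 * V1 0 = 2 * \<epsilon>1 0 * U" using h0 by simp
    then show "h0 * ip c y0 (F.Z y0) (e i) = 2 * (ip c y0 (e i) p) * U"
      by (simp add: V0(2) E(6))
    \<comment> \<open>The first-order condition turns the mixed term into
      \<open>8 * (\<epsilon>1 0)\<^sup>2 * U\<close>. With the 2 from differentiating the square
      this leaves the coefficient -6, and since \<open>\<epsilon>1 0\<close> is twice an inner
      product it becomes -24.\<close>
    have "4 * h0 * \<epsilon>1 0 * V1 0 = 4 * \<epsilon>1 0 * (h0 * V1 0)" by simp
    also have "\<dots> = 8 * (\<epsilon>1 0)\<^sup>2 * U" unfolding first by (simp add: power2_eq_square)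
    finally have "h0\<^sup>2 * (2 * ip c y0 (F.DZ y0 (e i)) (e i)) - 2 * h0 * b i * U - 6 * ((\<epsilon>1 0)\<^sup>2 * U) \<le> 0"
      using test(2) by linarith
    then show "h0\<^sup>2 * (2 * ip c y0 (F.DZ y0 (e i)) (e i)) - 2 * h0 * b i * U - 24 * (ip c y0 (e i) p)\<^sup>2 * U \<le> 0"
      by (simp add: E(6) power_mult_distrib)
  qed
  have expand: "ip c y0 v' v = (\<Sum>i\<in>UNIV. ip c y0 (e i) v' * ip c y0 (e i) v)" for v v'
    by (subst F.onb_expand[OF y0(1) e, of v']) (simp add: F.ip_sum F.ip_lin)
  have Pars: "(\<Sum>i\<in>UNIV. (ip c y0 (e i) p)\<^sup>2) = L2"
    using expand[of p p] pp by (simp add: power2_eq_square)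
  \<comment> \<open>Weighting the first-order conditions with the components of the gradient gives
    half the derivative of \<open>u\<close> along the gradient of \<open>f\<close>, which is the
    drift term in the Bochner inequality.\<close>
  have ZX: "h0 * ip c y0 (F.Z y0) (F.X y0) = 2 * U * C.dF c 1"
  proof -
    have "h0 * ip c y0 (F.Z y0) (F.X y0) = (\<Sum>i\<in>UNIV. (h0 * ip c y0 (F.Z y0) (e i)) * ip c y0 (e i) (F.X y0))"
      by (subst expand) (simp add: F.ip_sym[OF y0(1), of "e _" "F.Z y0"] sum_distrib_left mult_ac)
    also have "\<dots> = 2 * U * (\<Sum>i\<in>UNIV. ip c y0 (e i) (F.X y0) * ip c y0 (e i) p)"
      unfolding key(1) by (simp add: sum_distrib_left mult_ac)
    finally show ?thesis unfolding dF expand[of "F.X y0" p] .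
  qed
  have boch: "(\<Sum>i\<in>UNIV. ip c y0 (F.DZ y0 (e i)) (e i)) - ip c y0 (F.Z y0) (F.X y0) \<ge> U\<^sup>2 / ?n"
    unfolding U_def
    by (rule F.bochner_inequality[OF y0(1) e m chart_hypotheses[OF c(1)] ricci_chart[OF ric c(1) y0(1)] \<phi>])
  define S where "S = (\<Sum>i\<in>UNIV. ip c y0 (F.DZ y0 (e i)) (e i))"
  have "(\<Sum>i\<in>UNIV. h0\<^sup>2 * (2 * ip c y0 (F.DZ y0 (e i)) (e i)) - 2 * h0 * b i * U - 24 * (ip c y0 (e i) p)\<^sup>2 * U) \<le> 0"
    by (rule sum_nonpos) (rule key(2))
  then have sum: "2 * h0\<^sup>2 * S \<le> 2 * h0 * U * (\<Sum>i\<in>UNIV. b i) + 24 * L2 * U"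
    by (simp add: sum_subtractf sum.distrib S_def Pars[symmetric] sum_distrib_left sum_distrib_right mult_ac)
  have "2 * h0 * U * (\<Sum>i\<in>UNIV. b i) \<le> 2 * h0 * U * (2 * ((?n + m) + C.dF c 1))"
    using b h0 U(2) by (intro mult_left_mono) auto
  with sum have s1: "2 * h0\<^sup>2 * S \<le> 4 * h0 * U * (?n + m) + 4 * h0 * U * C.dF c 1 + 24 * L2 * U"
    by (simp add: algebra_simps)
  have "2 * h0\<^sup>2 * (U\<^sup>2 / ?n) \<le> 2 * h0\<^sup>2 * (S - ip c y0 (F.Z y0) (F.X y0))"
    using boch unfolding S_def by (intro mult_left_mono) auto
  also have "\<dots> = 2 * h0\<^sup>2 * S - 2 * h0 * (h0 * ip c y0 (F.Z y0) (F.X y0))"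
    by (simp add: power2_eq_square algebra_simps)
  \<comment> \<open>The two multiples of \<open>C.dF c 1\<close> cancel: one comes from the
    comparison bound on the \<open>b i\<close>, the other from \<open>ZX\<close>.\<close>
  also have "\<dots> \<le> U * (4 * h0 * (?n + m) + 24 * L2)"
    using s1 unfolding ZX by (simp add: algebra_simps)
  finally have fin: "2 * h0\<^sup>2 * (U\<^sup>2 / ?n) \<le> U * (4 * h0 * (?n + m) + 24 * L2)" .
  have n: "0 < ?n" by simp
  have wy: "w y = h0\<^sup>2 * U" by (simp add: w_def rL U h0_def)
  show ?thesis
  proof (cases "U = 0")
    case True
    then show ?thesis using wy m n by simp
  next
    case False
    then have U0: "0 < U" using U(2) by simp
    have "U * (2 * (h0\<^sup>2 * U)) = 2 * h0\<^sup>2 * (U\<^sup>2 / ?n) * ?n" by (simp add: power2_eq_square)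
    also have "\<dots> \<le> U * (4 * h0 * (?n + m) + 24 * L2) * ?n" using fin n by (intro mult_right_mono) auto
    finally have "2 * (h0\<^sup>2 * U) \<le> (4 * h0 * (?n + m) + 24 * L2) * ?n"
      using U0 by (simp add: mult.assoc)
    \<comment> \<open>Both \<open>h0\<close> and \<open>L2\<close> are at most
      \<open>a\<^sup>2\<close>; half of 4 (n + m) + 24 is 2 (n + m + 6).\<close>
    also have "\<dots> \<le> (4 * a\<^sup>2 * (?n + m) + 24 * a\<^sup>2) * ?n"
      using La L(4) m n by (intro mult_right_mono add_mono mult_left_mono) (auto simp: h0_def)
    finally show ?thesis unfolding wy by (simp add: algebra_simps)
  qed
qed

text \<open>\<open>w\<close> is upper semicontinuous on the closure of the ball if it is extended by \<open>0\<close>.\<close>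

lemma w_upper_semicontinuous:
  assumes lam: "if y \<in> B then w y < \<Lambda> else 0 < \<Lambda>"
  obtains W where "open W" "y \<in> W" "\<And>z. z \<in> W \<Longrightarrow> z \<in> B \<Longrightarrow> w z < \<Lambda>"
proof -
  \<comment> \<open>Off the ball \<open>r y\<close> is at least \<open>a\<close>, and the choice
    \<open>a\<^sup>2\<close> encodes the value 0 of the extended function.\<close>
  define \<rho> where "\<rho> = (if y \<in> B then (r y)\<^sup>2 else a\<^sup>2)"
  have lt: "(a\<^sup>2 - \<rho> + 0)\<^sup>2 * (u y + 0) < \<Lambda>" using lam by (auto simp: \<rho>_def w_def split: if_splits)
  \<comment> \<open>The strict bound survives when both factors are enlarged by a small \<epsilon>,
    which then absorbs the error in the squared distance and the oscillation of \<open>u\<close>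
    near \<open>y\<close>.\<close>
  have lim: "((\<lambda>\<epsilon>. (a\<^sup>2 - \<rho> + \<epsilon>)\<^sup>2 * (u y + \<epsilon>)) \<longlongrightarrow> (a\<^sup>2 - \<rho> + 0)\<^sup>2 * (u y + 0)) (at_right 0)"
    by (intro tendsto_intros)
  note order_tendstoD(2)[OF lim lt]
  moreover have "eventually (\<lambda>\<epsilon>::real. 0 < \<epsilon>) (at_right 0)" by (rule eventually_at_right_less)
  ultimately have "eventually (\<lambda>\<epsilon>. 0 < \<epsilon> \<and> (a\<^sup>2 - \<rho> + \<epsilon>)\<^sup>2 * (u y + \<epsilon>) < \<Lambda>) (at_right 0)"
    by eventually_elim simp
  then obtain \<epsilon> where \<epsilon>: "0 < \<epsilon>" "(a\<^sup>2 - \<rho> + \<epsilon>)\<^sup>2 * (u y + \<epsilon>) < \<Lambda>"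
    using eventually_happens by force
  obtain W1 where W1: "open W1" "y \<in> W1" "\<And>z \<gamma>. z \<in> W1 \<Longrightarrow> minimal_geodesic A g x z \<gamma> \<Longrightarrow> r z < a \<Longrightarrow>
       0 \<le> r y \<and> (r y)\<^sup>2 \<le> (r z)\<^sup>2 + \<epsilon>"
    using dist_lower_semicontinuous[OF \<epsilon>(1) a, of y x] by metis
  have "eventually (\<lambda>z. u z < u y + \<epsilon>) (nhds y)"
    using isCont_eventually_in[OF u_continuous open_lessThan, of y "u y + \<epsilon>"] \<epsilon>(1) by simp
  then obtain W2 where W2: "open W2" "y \<in> W2" "\<And>z. z \<in> W2 \<Longrightarrow> u z < u y + \<epsilon>"
    unfolding eventually_nhds by blast
  show ?thesis
  proof (rule that[of "W1 \<inter> W2"])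
    show "open (W1 \<inter> W2)" "y \<in> W1 \<inter> W2" using W1 W2 by auto
    fix z assume z: "z \<in> W1 \<inter> W2" "z \<in> B"
    obtain \<gamma> where \<gamma>: "minimal_geodesic A g x z \<gamma>" using ball_geodesic[OF z(2)] .
    have rz: "0 \<le> r z" "r z < a"
    proof -
      show "r z < a" using z(2) by (simp add: metric_ball_def)
      show "0 \<le> r z" by (rule minimal_geodesicE[OF \<gamma>]) simp
    qed
    have ry: "0 \<le> r y" "(r y)\<^sup>2 \<le> (r z)\<^sup>2 + \<epsilon>" using W1(3)[OF _ \<gamma> rz(2)] z(1) by auto
    have "\<rho> \<le> (r y)\<^sup>2"
      using a by (auto simp: \<rho>_def metric_ball_def not_less intro: power_mono)
    then have "a\<^sup>2 - (r z)\<^sup>2 \<le> a\<^sup>2 - \<rho> + \<epsilon>" using ry(2) by simp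
    moreover have "(r z)\<^sup>2 \<le> a\<^sup>2" using rz by (intro power_mono) auto
    ultimately have "(a\<^sup>2 - (r z)\<^sup>2)\<^sup>2 \<le> (a\<^sup>2 - \<rho> + \<epsilon>)\<^sup>2" by (intro power_mono) auto
    then have "w z \<le> (a\<^sup>2 - \<rho> + \<epsilon>)\<^sup>2 * (u y + \<epsilon>)"
      unfolding w_def using W2(3)[of z] z(1) u_nonneg[of z] by (intro mult_mono) auto
    then show "w z < \<Lambda>" using \<epsilon>(2) by simp
  qed
qed

text \<open>Without a maximum, every point would have a neighbourhood in which \<open>w\<close>
  stays below some value \<open>w t\<close> with \<open>t\<close> in the ball. Finitely many of
  these cover the ball, yet the largest of the finitely many values is itself taken in the ball.
  Positivity of \<open>w x\<close> provides such a \<open>t\<close> at points outside the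
  ball.\<close>

lemma max_exists:
  assumes pos: "0 < w x"
  obtains y where "y \<in> B" "\<And>z. z \<in> B \<Longrightarrow> w z \<le> w y"
proof -
  have "\<exists>y\<in>B. \<forall>z\<in>B. w z \<le> w y"
  proof (rule ccontr)
    assume no: "\<not> ?thesis"
    have "\<exists>W t. open W \<and> y \<in> W \<and> t \<in> B \<and> (\<forall>z\<in>W \<inter> B. w z < w t)" for y
    proof -
      obtain t where t: "t \<in> B" "if y \<in> B then w y < w t else 0 < w t"
      proof (cases "y \<in> B")
        case True
        with no obtain t where "t \<in> B" "w y < w t" by (auto simp: not_le)
        with True show ?thesis using that by simp
      qed (use that[of x] pos center(1) in simp)
      show ?thesis using w_upper_semicontinuous[OF t(2)] t(1) by (metis IntE)
    qed
    then obtain W t where W: "\<And>y. open (W y)" "\<And>y. y \<in> W y" "\<And>y. t y \<in> B" "\<And>y z. z \<in> W y \<Longrightarrow> z \<in> B \<Longrightarrow> w z < w (t y)"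
      by (metis IntI)
    have "closure B \<subseteq> (\<Union>y\<in>UNIV. W y)" using W(2) by auto
    from compactE_image[OF comp _ this]
    obtain Y where Y: "finite Y" "closure B \<subseteq> (\<Union>y\<in>Y. W y)" using W(1) by metis
    have BY: "B \<subseteq> (\<Union>y\<in>Y. W y)" using Y(2) closure_subset by blast
    then have "Y \<noteq> {}" using center(1) by auto
    then have "Max ((\<lambda>y. w (t y)) ` Y) \<in> (\<lambda>y. w (t y)) ` Y" using Y(1) by (intro Max_in) auto
    then obtain y where "y \<in> Y" "Max ((\<lambda>y. w (t y)) ` Y) = w (t y)" by blast
    then have y: "y \<in> Y" "\<And>y'. y' \<in> Y \<Longrightarrow> w (t y') \<le> w (t y)"
      using Y(1) Max_ge[of "(\<lambda>y. w (t y)) ` Y"] by auto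
    obtain y' where "y' \<in> Y" "t y \<in> W y'" using BY W(3)[of y] by auto
    then show False using W(4)[of "t y" y'] W(3)[of y] y(2)[of y'] by simp
  qed
  then show ?thesis using that by blast
qed

text \<open>The distance is 0 at the centre, so \<open>w x\<close> is a^4 times \<open>u x\<close>;
  comparing with the maximum and dividing by a^4 gives the bound.\<close>

lemma gradient_bound: "u x \<le> 2 * real CARD('n) * (m + real CARD('n) + 6) / a\<^sup>2"
proof (cases "u x = 0")
  case True
  then show ?thesis using m by simp
next
  case False
  then have "0 < u x" using u_nonneg[of x] by simp
  then have "0 < w x" using a center(2) by (simp add: w_def)
  then obtain y where y: "y \<in> B" "\<And>z. z \<in> B \<Longrightarrow> w z \<le> w y" using max_exists by blast
  have "a\<^sup>2 * (a\<^sup>2 * u x) = w x" using center(2) by (simp add: w_def power2_eq_square)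
  also have "\<dots> \<le> w y" by (rule y(2)[OF center(1)])
  also have "\<dots> \<le> a\<^sup>2 * (2 * real CARD('n) * (m + real CARD('n) + 6))" using max_estimate[OF y] by (simp add: mult.commute)
  finally have "a\<^sup>2 * u x \<le> 2 * real CARD('n) * (m + real CARD('n) + 6)"
    by (rule mult_left_le_imp_le) (use a in simp)
  then show ?thesis using a by (simp add: le_divide_eq mult.commute)
qed

end

theorem theorem1p5:
  fixes A :: "('a::{t2_space, second_countable_topology}, 'n::finite) chart set"
    and g :: "'a metric"
    and f :: "'a \<Rightarrow> real"
    and \<phi> :: "real \<Rightarrow> real"
    and m a :: real
    and n :: nat
    and x :: 'a
  assumes "riemannian_manifold A g"
    and "n = CARD('n)"
    and "0 < m"
    and "smooth_fun_on A UNIV f"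
    and "bakry_emery_ricci_nonneg A g f m"
    and "\<forall>c\<in>A. \<forall>p\<in>fst c. f_laplacian A g f c f p = \<phi> (f p)"
    and "\<forall>t. \<phi> differentiable (at t)"
    and "\<forall>t. deriv \<phi> t + 2 / real n * \<phi> t \<ge> 0"
    and "0 < a"
    and "geodesically_connected A g (metric_ball A g x a)"
    and "compact (closure (metric_ball A g x a))"
  shows "g x (gradient A g f x) (gradient A g f x)
           \<le> 2 * real n * (m + real n + 6) / a\<^sup>2"
proof -
  interpret gradient_estimate A g f \<phi> m a x
    using assms riemannian_manifoldD[OF assms(1)] by unfold_locales auto
  show ?thesis using gradient_bound by (simp add: u_def assms(2))
qed

end
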